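(* Let $n\ge2$ and let $\Sigma$ be a closed (compact with no boundary) immersed hypersurface in the Heisenberg cylinder $(H_n\setminus\{0\},\rho^{-2}\Theta)$. Suppose either (a) $H_\Sigma\le0$, or (b) $H_\Sigma\ge0$ and the interior region of $\Sigma$ contains the origin of $H_n$ holds. Then $\Sigma$ must be a Heisenberg sphere defined by $\rho^4=c$ for some constant $c>0$. In particular, $H_\Sigma\equiv0$.
   Context: $H_n=\mathbb{R}^{2n+1}$ with coordinates $(x^1,\dots,x^{2n},z)$, $\Theta:=dz+\sum_{j=1}^n(x^jdx^{n+j}-x^{n+j}dx^j)$, $\rho:=[(\sum_{K=1}^{2n}(x^K)^2)^2+4z^2]^{1/4}$. The Heisenberg cylinder $(H_n\setminus\{0\},\rho^{-2}\Theta)$ is $H_n\setminus\{0\}$ with the CR structure of $H_n$ and contact form $\theta=\rho^{-2}\Theta$, viewed as a subriemannian manifold: with $\theta^I=\rho^{-1}dx^I$ ($1\le I\le2n$), the nonnegative inner product on the cotangent bundle is $\langle\theta^I,\theta^K\rangle^*=\delta_{IK}$, $\langle\theta,\cdot\rangle^*=0$, and the volume form is $dV=\theta^1\wedge\dots\wedge\theta^{2n}\wedge\theta$. For a 1-form $\omega$, $\omega\lrcorner dV$ is the $2n$-form with $\eta\wedge(\omega\lrcorner dV)=\langle\eta,\omega\rangle^*dV$ for all 1-forms $\eta$, and $|\omega|_*=(\langle\omega,\omega\rangle^* )^{1/2}$. For a hypersurface $\Sigma$ with (local) defining function $\phi$, the horizontal ($p$-)mean curvature $H_\Sigma$ is,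 at nonsingular points ($|d\phi|_*\ne0$), the restriction to $\Sigma$ of $H_\phi$, where $d\big(\frac{d\phi}{|d\phi|_*}\lrcorner dV\big)=H_\phi\,dV$. Sign convention: the defining function is chosen negative in the interior region bounded by $\Sigma$ (e.g. $\phi=\rho^4-c$ for a Heisenberg sphere). $H_\Sigma$ is defined, and the inequalities are understood, at nonsingular points. *)

theory Defs
  imports "HOL-Analysis.Analysis"
begin

section \<open>Smooth maps\<close>

text \<open>Meaningful for open sets \<open>S\<close>; the derivative is tested on all constant directions.\<close>

primrec Ck_on :: "nat \<Rightarrow> 'a::real_normed_vector set \<Rightarrow> ('a \<Rightarrow> 'b::real_normed_vector) \<Rightarrow> bool" where
  "Ck_on 0 S g \<longleftrightarrow> continuous_on S g"
| "Ck_on (Suc k) S g \<longleftrightarrow>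
     (\<forall>x\<in>S. g differentiable (at x)) \<and> (\<forall>v. Ck_on k S (\<lambda>x. frechet_derivative g (at x) v))"

definition smooth_on :: "'a::real_normed_vector set \<Rightarrow> ('a \<Rightarrow> 'b::real_normed_vector) \<Rightarrow> bool" where
  "smooth_on S g \<longleftrightarrow> (\<forall>k. Ck_on k S g)"


section \<open>Exterior calculus on a normed space\<close>

text \<open>
  An alternating form of degree \<open>k\<close> on the vector space \<open>'a\<close> is a function on lists of vectors
  that is supported on the lists of length \<open>k\<close>. Covectors (1-forms at a point) are elements of
  \<open>'a \<Rightarrow>\<^sub>L real\<close>. A differential form is a map from points to alternating forms. The convention
  is the determinant one, \<open>(\<eta>\<^sub>1 \<and> \<dots> \<and> \<eta>\<^sub>k) (v\<^sub>1, \<dots>, v\<^sub>k) = det (\<eta>\<^sub>i v\<^sub>j)\<close>, without factorials.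
\<close>

definition alt_forms :: "nat \<Rightarrow> ('a::real_normed_vector list \<Rightarrow> real) set" where
  "alt_forms k = {\<beta>.
     (\<forall>vs. length vs \<noteq> k \<longrightarrow> \<beta> vs = 0) \<and>
     (\<forall>vs i. length vs = k \<longrightarrow> i < k \<longrightarrow> linear (\<lambda>v. \<beta> (vs[i := v]))) \<and>
     (\<forall>vs i j. length vs = k \<longrightarrow> i < j \<longrightarrow> j < k \<longrightarrow> vs ! i = vs ! j \<longrightarrow> \<beta> vs = 0)}"

definition remove_nth :: "nat \<Rightarrow> 'a list \<Rightarrow> 'a list" where
  "remove_nth i vs = take i vs @ drop (Suc i) vs"

definition wedge :: "('a::real_normed_vector \<Rightarrow>\<^sub>L real) \<Rightarrow> ('a list \<Rightarrow> real) \<Rightarrow> 'a list \<Rightarrow> real" where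
  "wedge \<eta> \<beta> vs = (\<Sum>i<length vs. (-1) ^ i * blinfun_apply \<eta> (vs ! i) * \<beta> (remove_nth i vs))"

definition wedge_list :: "('a::real_normed_vector \<Rightarrow>\<^sub>L real) list \<Rightarrow> 'a list \<Rightarrow> real" where
  "wedge_list \<eta>s = foldr wedge \<eta>s (\<lambda>vs. if vs = [] then 1 else 0)"

text \<open>The invariant formula for \<open>d\<beta>\<close>, evaluated on constant vector fields (whose brackets vanish).\<close>

definition ext_deriv :: "('a::real_normed_vector \<Rightarrow> 'a list \<Rightarrow> real) \<Rightarrow> 'a \<Rightarrow> 'a list \<Rightarrow> real" where
  "ext_deriv \<beta> q vs =
     (\<Sum>i<length vs. (-1) ^ i * frechet_derivative (\<lambda>q'. \<beta> q' (remove_nth i vs)) (at q) (vs ! i))"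

definition differential :: "('a::real_normed_vector \<Rightarrow> real) \<Rightarrow> 'a \<Rightarrow> ('a \<Rightarrow>\<^sub>L real)" where
  "differential \<phi> q = Blinfun (frechet_derivative \<phi> (at q))"


section \<open>The Heisenberg cylinder\<close>

text \<open>
  A point of \<open>H\<^sub>n\<close>, \<open>n = CARD('n)\<close>, is a pair \<open>(x, z)\<close>; the component \<open>x $ Inl j\<close> is \<open>x\<^sup>j\<close> and
  \<open>x $ Inr j\<close> is the coordinate with upper index \<open>n + j\<close>. The linear order on \<open>'n\<close> only serves to
  list the coordinates in the order \<open>1, \<dots>, 2n\<close>.
\<close>

type_synonym 'n heis = "(real ^ ('n + 'n)) \<times> real"

definition dx :: "'n + 'n \<Rightarrow> ('n::finite heis \<Rightarrow>\<^sub>L real)" where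
  "dx K = Blinfun (\<lambda>v. fst v $ K)"

definition dz :: "'n::finite heis \<Rightarrow>\<^sub>L real" where
  "dz = Blinfun snd"

definition Theta :: "'n::finite heis \<Rightarrow> ('n heis \<Rightarrow>\<^sub>L real)" where
  "Theta q = dz + (\<Sum>j\<in>UNIV. (fst q $ Inl j) *\<^sub>R dx (Inr j) - (fst q $ Inr j) *\<^sub>R dx (Inl j))"

definition rho :: "'n::finite heis \<Rightarrow> real" where
  "rho q = root 4 ((\<Sum>K\<in>UNIV. (fst q $ K)\<^sup>2)\<^sup>2 + 4 * (snd q)\<^sup>2)"

definition theta_hor :: "'n::finite heis \<Rightarrow> 'n + 'n \<Rightarrow> ('n heis \<Rightarrow>\<^sub>L real)" where
  "theta_hor q K = (1 / rho q) *\<^sub>R dx K"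

definition theta_contact :: "'n::finite heis \<Rightarrow> ('n heis \<Rightarrow>\<^sub>L real)" where
  "theta_contact q = (1 / (rho q)\<^sup>2) *\<^sub>R Theta q"

text \<open>
  Away from the origin the \<open>\<theta>\<^sup>I\<close> and \<open>\<theta>\<close> form a basis of the covectors, so the bilinear form
  is uniquely determined there.
\<close>

definition cometric :: "'n::finite heis \<Rightarrow> ('n heis \<Rightarrow>\<^sub>L real) \<Rightarrow> ('n heis \<Rightarrow>\<^sub>L real) \<Rightarrow> real" where
  "cometric q = (THE B. bilinear B \<and>
     (\<forall>I K. B (theta_hor q I) (theta_hor q K) = (if I = K then 1 else 0)) \<and>
     (\<forall>\<eta>. B (theta_contact q) \<eta> = 0 \<and> B \<eta> (theta_contact q) = 0))"

definition conorm :: "'n::finite heis \<Rightarrow> ('n heis \<Rightarrow>\<^sub>L real) \<Rightarrow> real" where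
  "conorm q \<omega> = sqrt (cometric q \<omega> \<omega>)"

definition hor_indices :: "('n::{finite,linorder} + 'n) list" where
  "hor_indices = map Inl (sorted_list_of_set UNIV) @ map Inr (sorted_list_of_set UNIV)"

definition dV :: "'n::{finite,linorder} heis \<Rightarrow> 'n heis list \<Rightarrow> real" where
  "dV q = wedge_list (map (theta_hor q) hor_indices @ [theta_contact q])"

definition contract_dV ::
  "'n::{finite,linorder} heis \<Rightarrow> ('n heis \<Rightarrow>\<^sub>L real) \<Rightarrow> 'n heis list \<Rightarrow> real" where
  "contract_dV q \<omega> = (THE \<beta>. \<beta> \<in> alt_forms (2 * CARD('n)) \<and>
     (\<forall>\<eta>. wedge \<eta> \<beta> = (\<lambda>vs. cometric q \<eta> \<omega> * dV q vs)))"

definition H_fun :: "('n::{finite,linorder} heis \<Rightarrow> real) \<Rightarrow> 'n heis \<Rightarrow> real" where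
  "H_fun \<phi> q = (THE h. \<forall>vs.
     ext_deriv (\<lambda>q'. contract_dV q' ((1 / conorm q' (differential \<phi> q')) *\<^sub>R differential \<phi> q')) q vs
       = h * dV q vs)"


section \<open>Immersed hypersurfaces\<close>

text \<open>
  The abstract \<open>2n\<close>-dimensional manifold is a whole type \<open>'m\<close>, with a smooth atlas of charts
  \<open>(U, \<psi>)\<close>, where \<open>\<psi>\<close> is only relevant on \<open>U\<close>.
\<close>

definition smooth_atlas :: "('m::t2_space set \<times> ('m \<Rightarrow> 'e::euclidean_space)) set \<Rightarrow> bool" where
  "smooth_atlas A \<longleftrightarrow>
     (\<Union>(U, \<psi>)\<in>A. U) = UNIV \<and>
     (\<forall>(U, \<psi>)\<in>A. open U \<and> open (\<psi> ` U) \<and> homeomorphism U (\<psi> ` U) \<psi> (inv_into U \<psi>)) \<and>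
     (\<forall>(U, \<psi>)\<in>A. \<forall>(V, \<psi>')\<in>A. smooth_on (\<psi> ` (U \<inter> V)) (\<psi>' \<circ> inv_into U \<psi>))"

definition smooth_immersion ::
  "('m::t2_space set \<times> ('m \<Rightarrow> 'e::euclidean_space)) set \<Rightarrow> ('m \<Rightarrow> 'b::euclidean_space) \<Rightarrow> bool" where
  "smooth_immersion A f \<longleftrightarrow>
     (\<forall>(U, \<psi>)\<in>A. smooth_on (\<psi> ` U) (f \<circ> inv_into U \<psi>) \<and>
        (\<forall>y\<in>\<psi> ` U. inj (frechet_derivative (f \<circ> inv_into U \<psi>) (at y))))"

definition coorientation ::
  "('m::t2_space set \<times> ('m \<Rightarrow> 'e::euclidean_space)) set \<Rightarrow> ('m \<Rightarrow> 'b::euclidean_space) \<Rightarrow>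
     ('m \<Rightarrow> 'b) \<Rightarrow> bool" where
  "coorientation A f N \<longleftrightarrow> continuous_on UNIV N \<and>
     (\<forall>(U, \<psi>)\<in>A. \<forall>p\<in>U. N p \<notin> range (frechet_derivative (f \<circ> inv_into U \<psi>) (at (\<psi> p))))"

text \<open>
  Sign convention: the side \<open>- N\<close>, on which defining functions are negative, is never the exterior
  (the unbounded component of the complement). For an embedded closed hypersurface this says that
  \<open>- N\<close> points into the bounded component everywhere.
\<close>

definition outward :: "('m \<Rightarrow> 'b::euclidean_space) \<Rightarrow> ('m \<Rightarrow> 'b) \<Rightarrow> bool" where
  "outward f N \<longleftrightarrow> (\<forall>p. eventually (\<lambda>t. f p - t *\<^sub>R N p \<notin> outside (range f)) (at_right 0))"

text \<open>
  The interior region consists of the bounded components of the complement such that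
  defining functions are negative there, i.e. \<open>N\<close> never points into the component. In the
  embedded case with outward \<open>N\<close> this is all of \<open>inside (range f)\<close>. For an immersion with
  self-intersections \<open>inside (range f)\<close> may also have components lying on the positive side of
  some sheet that borders them; these are not bounded by the hypersurface in the sense of the
  sign convention.
\<close>

definition interior_region :: "('m \<Rightarrow> 'b::euclidean_space) \<Rightarrow> ('m \<Rightarrow> 'b) \<Rightarrow> 'b set" where
  "interior_region f N = {q \<in> inside (range f).
     \<forall>p. eventually (\<lambda>t. f p + t *\<^sub>R N p \<notin> connected_component_set (- range f) q) (at_right 0)}"

text \<open>
  A defining function for the sheet of the immersed hypersurface through the parameter point
  \<open>p\<close>, increasing in the direction \<open>N\<close>.
\<close>

definition local_defining_function ::
  "('m::t2_space \<Rightarrow> 'n::finite heis) \<Rightarrow> ('m \<Rightarrow> 'n heis) \<Rightarrow> 'm \<Rightarrow> ('n heis \<Rightarrow> real) \<Rightarrow> bool" where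
  "local_defining_function f N p \<phi> \<longleftrightarrow> (\<exists>U W.
     open U \<and> p \<in> U \<and> open W \<and> 0 \<notin> W \<and> smooth_on W \<phi> \<and>
     (\<forall>q\<in>W. differential \<phi> q \<noteq> 0) \<and> f ` U = {q \<in> W. \<phi> q = 0} \<and>
     (\<forall>p'\<in>U. blinfun_apply (differential \<phi> (f p')) (N p') > 0))"

definition nonsingular_at ::
  "('m::t2_space \<Rightarrow> 'n::finite heis) \<Rightarrow> ('m \<Rightarrow> 'n heis) \<Rightarrow> 'm \<Rightarrow> bool" where
  "nonsingular_at f N p \<longleftrightarrow>
     (\<exists>\<phi>. local_defining_function f N p \<phi> \<and> conorm (f p) (differential \<phi> (f p)) \<noteq> 0)"

text \<open>At a nonsingular point the value does not depend on the choice of \<open>\<phi>\<close>.\<close>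

definition H_surf ::
  "('m::t2_space \<Rightarrow> 'n::{finite,linorder} heis) \<Rightarrow> ('m \<Rightarrow> 'n heis) \<Rightarrow> 'm \<Rightarrow> real" where
  "H_surf f N p = (THE h. \<exists>\<phi>. local_defining_function f N p \<phi> \<and> h = H_fun \<phi> (f p))"

end

theory Submission
  imports Defs
begin

text \<open>
  The mean curvature of the level sets of \<open>\<phi>\<close> is a positive multiple of a quasilinear degenerate elliptic operator
  \<open>mean_op\<close> that annihilates \<open>rho4 = \<rho>\<^sup>4\<close>, and the surface is compared with the Heisenberg sphere that
  it touches at a maximum of \<open>\<rho>\<close> in case (a), at a minimum in case (b). The sign convention makes the coorientations
  agree on the touching set.

  The operator is only subelliptic, so Hopf's barrier \<open>exp (- l g)\<close> needs a function \<open>g\<close> that separates the touching point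
  from the rest of the sphere and whose tangential sublaplacian is negative wherever its tangential horizontal gradient
  vanishes. Off the axis \<open>x = 0\<close> such a \<open>g\<close> is the function \<open>sep\<close>; here \<open>n \<ge> 2\<close> is used. At a pole
  \<open>x = 0\<close> of the sphere the touching set contains a punctured neighbourhood or is isolated, and an isolated point is
  excluded by the barrier \<open>\<rho>\<^sup>4 \<plusminus> \<epsilon> \<bar>x\<bar>\<close>. So the touching set is open and closed, the image is
  open and closed in the sphere, and comparing in both directions gives vanishing mean curvature.
\<close>

section \<open>Alternating forms\<close>

text \<open>Off the axis the linearized operator controls only the horizontal directions tangent to
  the sphere, so a barrier adapted to one interior ball does not propagate touching. Instead the
  barrier is centred at a point \<open>q1\<close> of the sphere that the sheet misses. Maxima of the
  perturbed gauge over the sheet accumulate at some touching point about which only a bound on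
  \<open>g\<close> is known, so the barrier has to be strict at every touching point of a fixed
  ball. This forces a global condition on \<open>g\<close> and hence an explicit function.

  With T = u^2 (|x|^2 + 2 i z), u the complex coordinate of x / |x| along a fixed vector, T
  satisfies tan_lap T = - 4 (n - 1) T / |x|^2. The squared distance of T to a constant therefore has
  a sign where its gradient vanishes, while z must be added with a power above two so that its own
  gradient does not spoil that sign.

  Comparison is a second order test at a single point on a linear combination of two defining
  functions, so the sheet is never written as a graph. At a pole the linearization itself vanishes,
  and the quadratic and cubic terms in the size of the perturbation decide.\<close>

lemma length_remove_nth: "i < length vs \<Longrightarrow> length (remove_nth i vs) = length vs - 1"
  by (simp add: remove_nth_def)

lemma nth_remove_nth:
  "i < length vs \<Longrightarrow> k < length vs - 1 \<Longrightarrow>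
    remove_nth i vs ! k = (if k < i then vs ! k else vs ! Suc k)"
  by (auto simp: remove_nth_def nth_append min_def)

lemma remove_nth_update_same: "remove_nth i (vs[i := v]) = remove_nth i vs"
  by (simp add: remove_nth_def)

lemma remove_nth_update:
  assumes "i \<noteq> j" "i < length vs" "j < length vs"
  shows "remove_nth j (vs[i := v]) = (remove_nth j vs)[(if i < j then i else i - 1) := v]"
  using assms by (intro nth_equalityI) (auto simp: length_remove_nth nth_remove_nth nth_list_update)

lemma remove_nth_Cons_Suc: "remove_nth (Suc i) (v # vs) = v # remove_nth i vs"
  by (simp add: remove_nth_def)

lemma remove_nth_Cons_0: "remove_nth 0 (v # vs) = vs"
  by (simp add: remove_nth_def)

lemma alt_forms_linear:
  "\<beta> \<in> alt_forms k \<Longrightarrow> length vs = k \<Longrightarrow> i < k \<Longrightarrow> linear (\<lambda>v. \<beta> (vs[i := v]))"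
  by (simp add: alt_forms_def)

lemma alt_forms_length: "\<beta> \<in> alt_forms k \<Longrightarrow> length vs \<noteq> k \<Longrightarrow> \<beta> vs = 0"
  by (simp add: alt_forms_def)

lemma alt_forms_repeat:
  "\<beta> \<in> alt_forms k \<Longrightarrow> length vs = k \<Longrightarrow> i < k \<Longrightarrow> j < k \<Longrightarrow> i \<noteq> j \<Longrightarrow> vs ! i = vs ! j \<Longrightarrow> \<beta> vs = 0"
  by (cases "i < j") (auto simp: alt_forms_def dest: spec[of _ vs] simp del: not_less elim: linorder_neqE_nat)

text \<open>Polarizing the hypothesis on neighbours gives antisymmetry under adjacent swaps, and
  equal entries at any distance are brought together one swap at a time. For a wedge only the case
  of neighbours is easy to see directly.\<close>

lemma alt_formsI_adjacent:
  assumes len: "\<And>vs. length vs \<noteq> k \<Longrightarrow> \<beta> vs = 0"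
    and lin: "\<And>vs i. length vs = k \<Longrightarrow> i < k \<Longrightarrow> linear (\<lambda>v. \<beta> (vs[i := v]))"
    and adj: "\<And>vs i. length vs = k \<Longrightarrow> Suc i < k \<Longrightarrow> vs ! i = vs ! Suc i \<Longrightarrow> \<beta> vs = 0"
  shows "\<beta> \<in> alt_forms k"
proof -
  have swap: "\<beta> (vs[i := a, Suc i := b]) = - \<beta> (vs[i := b, Suc i := a])"
    if l: "length vs = k" and i: "Suc i < k" for vs i a b
  proof -
    have fst: "\<beta> (vs[i := c + d, Suc i := e]) = \<beta> (vs[i := c, Suc i := e]) + \<beta> (vs[i := d, Suc i := e])" for c d e
      using linear_add[OF lin[of "vs[Suc i := e]" i], of c d] l i
      by (simp add: list_update_swap[of i "Suc i"])
    have snd: "\<beta> (vs[i := e, Suc i := c + d]) = \<beta> (vs[i := e, Suc i := c]) + \<beta> (vs[i := e, Suc i := d])" for c d e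
      using linear_add[OF lin[of "vs[i := e]" "Suc i"], of c d] l i by simp
    have z: "\<beta> (vs[i := c, Suc i := c]) = 0" for c
      using l i by (intro adj[of _ i]) auto
    show ?thesis
      using z[of "a + b"] z[of a] z[of b] unfolding fst snd by linarith
  qed
  have rep: "\<beta> vs = 0" if "length vs = k" "i + Suc d < k" "vs ! i = vs ! (i + Suc d)" for vs i d
    using that
  proof (induction d arbitrary: vs)
    case 0
    then show ?case by (intro adj[of _ i]) auto
  next
    case (Suc d)
    let ?j = "i + Suc d"
    have "vs = vs[?j := vs ! ?j, Suc ?j := vs ! Suc ?j]" by simp
    then have "\<beta> vs = - \<beta> (vs[?j := vs ! Suc ?j, Suc ?j := vs ! ?j])"
      using swap[of vs ?j "vs ! ?j" "vs ! Suc ?j"] Suc.prems by simp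
    moreover have "\<beta> (vs[?j := vs ! Suc ?j, Suc ?j := vs ! ?j]) = 0"
      using Suc.prems by (intro Suc.IH) (auto simp: nth_list_update)
    ultimately show ?case by simp
  qed
  have "\<beta> vs = 0" if "length vs = k" "i < j" "j < k" "vs ! i = vs ! j" for vs i j
    using rep[of vs i "j - i - 1"] that by simp
  then show ?thesis
    using len lin by (simp add: alt_forms_def)
qed

text \<open>If two neighbours agree, a summand that deletes another entry still contains both and
  vanishes; the two summands that delete one of them involve the same list with opposite
  signs.\<close>

lemma wedge_in_alt_forms:
  assumes b: "\<beta> \<in> alt_forms k"
  shows "wedge \<eta> \<beta> \<in> alt_forms (Suc k)"
proof (rule alt_formsI_adjacent)
  fix vs :: "'a list"
  assume "length vs \<noteq> Suc k"
  then show "wedge \<eta> \<beta> vs = 0"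
    unfolding wedge_def
    by (intro sum.neutral) (auto simp: length_remove_nth intro!: alt_forms_length[OF b])
next
  fix vs :: "'a list" and i
  assume l: "length vs = Suc k" and i: "i < Suc k"
  have "linear (\<lambda>v. (-1) ^ j * \<eta> (vs[i := v] ! j) * \<beta> (remove_nth j (vs[i := v])))" if j: "j < Suc k" for j
  proof (cases "j = i")
    case True
    have "linear (\<lambda>v. \<eta> v * ((-1) ^ j * \<beta> (remove_nth i vs)))"
      by (intro bounded_linear.linear bounded_linear_mult_const blinfun.bounded_linear_right)
    then show ?thesis using True l i
      by (simp add: remove_nth_update_same mult_ac)
  next
    case False
    have "linear (\<lambda>v. ((-1) ^ j * \<eta> (vs ! j)) *\<^sub>R \<beta> ((remove_nth j vs)[(if i < j then i else i - 1) := v]))"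
      using l i j False
      by (intro linear_compose_scale_right alt_forms_linear[OF b]) (auto simp: length_remove_nth)
    then show ?thesis using False l i j
      by (simp add: remove_nth_update)
  qed
  then have "linear (\<lambda>v. \<Sum>j<Suc k. (-1) ^ j * \<eta> (vs[i := v] ! j) * \<beta> (remove_nth j (vs[i := v])))"
    by (intro linear_compose_sum) auto
  then show "linear (\<lambda>v. wedge \<eta> \<beta> (vs[i := v]))"
    by (simp add: wedge_def l)
next
  fix vs :: "'a list" and i
  assume l: "length vs = Suc k" and i: "Suc i < Suc k" and eq: "vs ! i = vs ! Suc i"
  let ?t = "\<lambda>j. (-1) ^ j * \<eta> (vs ! j) * \<beta> (remove_nth j vs)"
  have "?t j = 0" if j: "j < Suc k" "j \<noteq> i" "j \<noteq> Suc i" for j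
  proof -
    have "\<beta> (remove_nth j vs) = 0"
      by (rule alt_forms_repeat[OF b, of _ "if i < j then i else i - 1" "if i < j then Suc i else i"])
        (use j i l eq in \<open>auto simp: length_remove_nth nth_remove_nth\<close>)
    then show ?thesis by simp
  qed
  then have "(\<Sum>j<Suc k. ?t j) = (\<Sum>j\<in>{i, Suc i}. ?t j)"
    using i by (intro sum.mono_neutral_right) auto
  moreover have "remove_nth (Suc i) vs = remove_nth i vs"
    using l i eq by (intro nth_equalityI) (auto simp: length_remove_nth nth_remove_nth less_Suc_eq)
  ultimately show "wedge \<eta> \<beta> vs = 0"
    by (simp add: wedge_def l eq)
qed

lemma wedge_list_Nil: "wedge_list [] = (\<lambda>vs. if vs = [] then 1 else 0)"
  by (simp add: wedge_list_def)

lemma wedge_list_Cons: "wedge_list (\<eta> # \<eta>s) = wedge \<eta> (wedge_list \<eta>s)"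
  by (simp add: wedge_list_def)

lemma wedge_list_in_alt_forms: "wedge_list \<eta>s \<in> alt_forms (length \<eta>s)"
proof (induction \<eta>s)
  case Nil
  then show ?case by (simp add: wedge_list_Nil alt_forms_def)
next
  case (Cons \<eta> \<eta>s)
  then show ?case by (simp add: wedge_list_Cons wedge_in_alt_forms)
qed

text \<open>Among too many vectors one lies in the span of the others. The form is linear in that
  slot and vanishes when the slot repeats another entry.\<close>

lemma alt_forms_dependent:
  fixes \<beta> :: "'a::euclidean_space list \<Rightarrow> real"
  assumes b: "\<beta> \<in> alt_forms k" and k: "DIM('a) < k"
  shows "\<beta> vs = 0"
proof (cases "length vs = k")
  case l: True
  show ?thesis
  proof (cases "distinct vs")
    case False
    then show ?thesis
      using alt_forms_repeat[OF b l] l by (auto simp: distinct_conv_nth)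
  next
    case True
    then have "dependent (set vs)"
      using dependent_biggerset[of "set vs"] k l by (simp add: distinct_card)
    then obtain v where v: "v \<in> set vs" "v \<in> span (set vs - {v})"
      by (auto simp: dependent_def)
    then obtain i where i: "i < k" "vs ! i = v" using l by (auto simp: in_set_conv_nth)
    have "\<beta> (vs[i := u]) = 0" if u: "u \<in> set vs - {v}" for u
    proof -
      obtain j where j: "j < k" "vs ! j = u" using u l by (auto simp: in_set_conv_nth)
      moreover have "j \<noteq> i" using u i j by auto
      ultimately
      show ?thesis by (intro alt_forms_repeat[OF b, of _ i j]) (use l i in auto)
    qed
    then have "\<beta> (vs[i := v]) = 0"
      using linear_eq_0_on_span[OF alt_forms_linear[OF b l i(1)]] v(2) by blast
    then show ?thesis using i by auto
  qed
qed (rule alt_forms_length[OF b])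

lemma wedge_Cons:
  "wedge \<eta> \<beta> (w # vs) = \<eta> w * \<beta> vs - wedge \<eta> (\<lambda>us. \<beta> (w # us)) vs"
  by (simp add: wedge_def sum.lessThan_Suc_shift remove_nth_Cons_0 remove_nth_Cons_Suc sum_negf del: sum.lessThan_Suc)

lemma Cons_form_in_alt_forms:
  assumes b: "\<beta> \<in> alt_forms (Suc k)"
  shows "(\<lambda>vs. \<beta> (w # vs)) \<in> alt_forms k"
proof -
  have "linear (\<lambda>v. \<beta> (w # vs[i := v]))" if "length vs = k" "i < k" for vs i
    using alt_forms_linear[OF b, of "w # vs" "Suc i"] that by simp
  moreover have "\<beta> (w # vs) = 0" if "length vs = k" "i < j" "j < k" "vs ! i = vs ! j" for vs i j
    using alt_forms_repeat[OF b, of "w # vs" "Suc i" "Suc j"] that by simp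
  ultimately show ?thesis
    using alt_forms_length[OF b] by (auto simp: alt_forms_def)
qed

text \<open>The wedge of a covector with a top form is zero by degree; expanding it along the first
  argument \<open>w\<close> leaves this contraction rule. It identifies the contraction of the
  volume form with a vector as the form sought in \<open>contract_dV\<close>.\<close>

lemma wedge_Cons_top:
  fixes \<beta> :: "'a::euclidean_space list \<Rightarrow> real"
  assumes b: "\<beta> \<in> alt_forms (DIM('a))"
  shows "wedge \<eta> (\<lambda>us. \<beta> (w # us)) = (\<lambda>vs. \<eta> w * \<beta> vs)"
  using alt_forms_dependent[OF wedge_in_alt_forms[OF b], of \<eta> "w # vs" for vs]
  by (auto simp: wedge_Cons)

text \<open>Below top degree there is a vector \<open>w\<close> orthogonal to all arguments. The
  covector of inner products with \<open>w\<close> kills them, so its wedge evaluated at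
  \<open>w # vs\<close> is |w|^2 times the form at \<open>vs\<close>.\<close>

lemma wedge_inject:
  fixes \<beta> \<beta>' :: "'a::euclidean_space list \<Rightarrow> real"
  assumes b: "\<beta> \<in> alt_forms k" "\<beta>' \<in> alt_forms k" and k: "k < DIM('a)"
    and eq: "\<And>\<eta>. wedge \<eta> \<beta> = wedge \<eta> \<beta>'"
  shows "\<beta> = \<beta>'"
proof
  fix vs
  show "\<beta> vs = \<beta>' vs"
  proof (cases "length vs = k")
    case True
    have "dim (set vs) < DIM('a)"
      using dim_le_card'[of "set vs"] card_length[of vs] True k by simp
    then obtain w where w: "w \<noteq> 0" "\<And>y. y \<in> span (set vs) \<Longrightarrow> orthogonal w y"
      by (metis orthogonal_to_subspace_exists)
    then have "blinfun_inner_right w (vs ! i) = 0" if "i < length vs" for i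
      using that w(2)[OF span_base[of "vs ! i"]] by (simp add: orthogonal_def)
    then have "wedge (blinfun_inner_right w) \<gamma> vs = 0" for \<gamma>
      by (auto simp: wedge_def intro: sum.neutral)
    then show ?thesis
      using fun_cong[OF eq[of "blinfun_inner_right w"], of "w # vs"] w(1) by (simp add: wedge_Cons)
  next
    case False
    then show ?thesis using b by (simp add: alt_forms_length)
  qed
qed

lemma alt_forms_Cons_linear:
  assumes b: "\<beta> \<in> alt_forms (Suc k)" and "length vs = k"
  shows "linear (\<lambda>w. \<beta> (w # vs))"
  using alt_forms_linear[OF b, of "undefined # vs" 0] assms by simp

text \<open>Expand \<open>A\<close> into the rank one maps \<open>v \<mapsto> (A v \<bullet> b) b\<close> and apply \<open>wedge_Cons_top\<close> to each.\<close>

lemma alt_forms_trace: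
  fixes \<beta> :: "'a::euclidean_space list \<Rightarrow> real"
  assumes b: "\<beta> \<in> alt_forms (DIM('a))" and A: "linear A" and l: "length vs = DIM('a)"
  shows "(\<Sum>i<length vs. (-1) ^ i * \<beta> (A (vs ! i) # remove_nth i vs)) = (\<Sum>b\<in>Basis. A b \<bullet> b) * \<beta> vs"
proof -
  define \<eta> where "\<eta> b = Blinfun (\<lambda>v. A v \<bullet> b)" for b
  have \<eta>: "\<eta> b v = A v \<bullet> b" for b v
    unfolding \<eta>_def
    using bounded_linear_inner_left_comp[of A b] A
    by (simp add: bounded_linear_Blinfun_apply linear_conv_bounded_linear)
  have "\<beta> (A (vs ! i) # remove_nth i vs) = (\<Sum>b\<in>Basis. \<eta> b (vs ! i) * \<beta> (b # remove_nth i vs))"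
    if i: "i < length vs" for i
  proof -
    have lin: "linear (\<lambda>w. \<beta> (w # remove_nth i vs))"
      using b l i by (intro alt_forms_Cons_linear[of _ "DIM('a) - 1"]) (auto simp: length_remove_nth)
    have "\<beta> (A (vs ! i) # remove_nth i vs) = \<beta> ((\<Sum>b\<in>Basis. (A (vs ! i) \<bullet> b) *\<^sub>R b) # remove_nth i vs)"
      by (simp add: euclidean_representation)
    also have "\<dots> = (\<Sum>b\<in>Basis. \<eta> b (vs ! i) * \<beta> (b # remove_nth i vs))"
      by (simp add: linear_sum[OF lin] linear_scale[OF lin] \<eta>)
    finally show ?thesis .
  qed
  then have "(\<Sum>i<length vs. (-1) ^ i * \<beta> (A (vs ! i) # remove_nth i vs))
    = (\<Sum>i<length vs. \<Sum>b\<in>Basis. (-1) ^ i * \<eta> b (vs ! i) * \<beta> (b # remove_nth i vs))"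
    by (simp add: sum_distrib_left mult_ac)
  also have "\<dots> = (\<Sum>b\<in>Basis. wedge (\<eta> b) (\<lambda>us. \<beta> (b # us)) vs)"
    by (subst sum.swap) (simp add: wedge_def)
  finally show ?thesis
    by (simp add: wedge_Cons_top[OF b] \<eta> sum_distrib_right)
qed

section \<open>Horizontal gradients and the mean curvature operator\<close>

text \<open>The complex structure up to sign, normalized such that
  \<open>Theta q v = snd v - fst v \<bullet> Jp (fst q)\<close>.\<close>

definition Jp :: "real ^ ('n::finite + 'n) \<Rightarrow> real ^ ('n + 'n)" where
  "Jp x = (\<chi> K. case K of Inl j \<Rightarrow> x $ Inr j | Inr j \<Rightarrow> - (x $ Inl j))"

text \<open>The unique vector in the kernel of \<open>Theta q\<close> that projects to
  \<open>a\<close>. The lifts of the coordinate vectors are the standard left invariant horizontal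
  frame.\<close>

definition lift :: "'n::finite heis \<Rightarrow> real ^ ('n + 'n) \<Rightarrow> 'n heis" where
  "lift q a = (a, a \<bullet> Jp (fst q))"

definition hor_grad :: "'n::finite heis \<Rightarrow> ('n heis \<Rightarrow> real) \<Rightarrow> real ^ ('n + 'n)" where
  "hor_grad q \<omega> = (\<chi> I. \<omega> (lift q (axis I 1)))"

lemma linear_Jp: "linear Jp"
  by (rule linearI) (auto simp: Jp_def vec_eq_iff split: sum.splits)

lemma sum_UNIV_Plus:
  "(\<Sum>K\<in>UNIV. f K) = (\<Sum>j\<in>UNIV. f (Inl j)) + (\<Sum>j\<in>UNIV. f (Inr j))"
  for f :: "'a::finite + 'b::finite \<Rightarrow> 'c::comm_monoid_add"
  using sum.Plus[of UNIV UNIV f] by (simp add: UNIV_Plus_UNIV comp_def)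

lemma inner_Jp_Inl_Inr: "a \<bullet> Jp x = (\<Sum>j\<in>UNIV. a $ Inl j * x $ Inr j - a $ Inr j * x $ Inl j)"
  by (simp add: inner_vec_def Jp_def sum_UNIV_Plus sum_subtractf sum_negf)

lemma Jp_skew: "a \<bullet> Jp b = - (Jp a \<bullet> b)"
  by (simp add: inner_Jp_Inl_Inr inner_commute[of "Jp a"] sum_negf[symmetric] algebra_simps)

lemma inner_Jp_self [simp]: "a \<bullet> Jp a = 0" "Jp a \<bullet> a = 0"
  by (simp_all add: inner_Jp_Inl_Inr inner_commute[of "Jp a"] mult.commute)

lemma Jp_Jp [simp]: "Jp (Jp x) = - x"
  by (auto simp: Jp_def vec_eq_iff split: sum.splits)

lemma Jp_inner_Jp [simp]: "Jp a \<bullet> Jp b = a \<bullet> b"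
  using Jp_skew[of "Jp a" b] by simp

lemma linear_lift: "linear (lift q)"
  by (rule linearI) (auto simp: lift_def inner_add_left)

lemma hor_grad_inner:
  assumes "linear \<omega>"
  shows "hor_grad q \<omega> \<bullet> a = \<omega> (lift q a)"
proof -
  have "\<omega> (lift q a) = \<omega> (lift q (\<Sum>I\<in>UNIV. a $ I *\<^sub>R axis I 1))"
    using basis_expansion[of a] by (simp add: scalar_mult_eq_scaleR)
  also have "\<dots> = (\<Sum>I\<in>UNIV. a $ I * \<omega> (lift q (axis I 1)))"
    by (simp add: linear_sum[OF linear_lift] linear_sum[OF assms] linear_scale[OF linear_lift] linear_scale[OF assms])
  finally show ?thesis
    by (simp add: hor_grad_def inner_vec_def mult.commute)
qed

section \<open>Frame, cometric and volume form of the Heisenberg cylinder\<close>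

lemma dx_apply: "dx K v = fst v $ K"
  unfolding dx_def
  by (rule fun_cong[OF bounded_linear_Blinfun_apply])
    (intro bounded_linear_compose[OF bounded_linear_vec_nth] bounded_linear_fst)

lemma dz_apply: "dz v = snd v"
  unfolding dz_def by (rule fun_cong[OF bounded_linear_Blinfun_apply]) (rule bounded_linear_snd)

lemma Theta_apply: "Theta q v = snd v - fst v \<bullet> Jp (fst q)"
  by (simp add: Theta_def blinfun.add_left blinfun.sum_left blinfun.diff_left blinfun.scaleR_left
      dx_apply dz_apply inner_Jp_Inl_Inr sum_subtractf mult.commute)

definition rho4 :: "'n::finite heis \<Rightarrow> real" where
  "rho4 q = (fst q \<bullet> fst q)\<^sup>2 + 4 * (snd q)\<^sup>2"

lemma rho_rho4: "rho q = root 4 (rho4 q)"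
  by (simp add: rho_def rho4_def inner_vec_def power2_eq_square)

lemma rho4_nonneg: "rho4 q \<ge> 0"
  by (simp add: rho4_def)

lemma rho_power4: "rho q ^ 4 = rho4 q"
  by (simp add: rho_rho4 rho4_nonneg)

lemma rho4_pos: "q \<noteq> 0 \<Longrightarrow> rho4 q > 0"
  by (cases q) (auto simp: rho4_def zero_prod_def add_pos_nonneg add_nonneg_pos)

lemma rho_pos: "q \<noteq> 0 \<Longrightarrow> rho q > 0"
  by (simp add: rho_rho4 rho4_pos)

text \<open>The horizontal lifts of the coordinate vectors together with the vertical unit vector
  form the basis dual to the \<open>dx I\<close> and \<open>Theta q\<close>.\<close>

lemma covector_expand:
  fixes \<eta> :: "'n::finite heis \<Rightarrow>\<^sub>L real"
  shows "\<eta> = (\<Sum>I\<in>UNIV. \<eta> (lift q (axis I 1)) *\<^sub>R dx I) + \<eta> (0, 1) *\<^sub>R Theta q"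
proof (rule blinfun_eqI)
  fix v :: "'n heis"
  have v: "v = lift q (fst v) + Theta q v *\<^sub>R (0, 1)"
    by (simp add: lift_def Theta_apply prod_eq_iff)
  have "\<eta> v = \<eta> (lift q (fst v)) + Theta q v * \<eta> (0, 1)"
    by (subst v) (simp add: blinfun.add_right blinfun.scaleR_right del: scaleR_Pair)
  also have "\<eta> (lift q (fst v)) = (\<Sum>I\<in>UNIV. \<eta> (lift q (axis I 1)) * fst v $ I)"
    using hor_grad_inner[of "blinfun_apply \<eta>" q "fst v"]
    by (simp add: bounded_linear.linear[OF blinfun.bounded_linear_right] hor_grad_def inner_vec_def)
  finally show "\<eta> v = ((\<Sum>I\<in>UNIV. \<eta> (lift q (axis I 1)) *\<^sub>R dx I) + \<eta> (0, 1) *\<^sub>R Theta q) v"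
    by (simp add: blinfun.add_left blinfun.sum_left blinfun.scaleR_left dx_apply)
qed

text \<open>Off the origin the prescribed values determine a bilinear form, since the covectors
  involved form a basis; expanding both arguments resolves the description. The factor comes from
  \<open>theta_hor\<close>: each \<open>dx I\<close> has length \<open>rho q\<close>.\<close>

lemma cometric_eq:
  fixes q :: "'n::finite heis"
  assumes q: "q \<noteq> 0"
  shows "cometric q \<eta> \<omega> = (rho q)\<^sup>2 * (hor_grad q \<eta> \<bullet> hor_grad q \<omega>)"
proof -
  let ?B = "\<lambda>(\<eta> :: 'n heis \<Rightarrow>\<^sub>L real) (\<omega> :: 'n heis \<Rightarrow>\<^sub>L real). (rho q)\<^sup>2 * (hor_grad q \<eta> \<bullet> hor_grad q \<omega>)"
  let ?P = "\<lambda>B. bilinear B \<and>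
     (\<forall>I K. B (theta_hor q I) (theta_hor q K) = (if I = K then 1 else 0)) \<and>
     (\<forall>\<eta>. B (theta_contact q) \<eta> = 0 \<and> B \<eta> (theta_contact q) = 0)"
  have r: "rho q > 0" using rho_pos[OF q] .
  have dx: "hor_grad q (dx I) = axis I 1" for I
    by (simp add: hor_grad_def dx_apply lift_def vec_eq_iff axis_def)
  have th: "hor_grad q (Theta q) = 0"
    by (simp add: hor_grad_def Theta_apply lift_def vec_eq_iff)
  have lin: "hor_grad q (blinfun_apply (a *\<^sub>R \<eta> + b *\<^sub>R \<omega>)) = a *\<^sub>R hor_grad q \<eta> + b *\<^sub>R hor_grad q \<omega>"
    for a b and \<eta> \<omega> :: "'n heis \<Rightarrow>\<^sub>L real"
    by (simp add: hor_grad_def vec_eq_iff blinfun.add_left blinfun.scaleR_left)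
  have linear: "linear (\<lambda>\<eta>::'n heis \<Rightarrow>\<^sub>L real. hor_grad q \<eta>)"
    using lin[of 1 _ 1] lin[of _ _ 0] by (intro linearI) auto
  have P: "?P ?B"
  proof (intro conjI allI)
    show "bilinear ?B"
      unfolding bilinear_def
      by (auto intro!: linearI simp: linear_add[OF linear] linear_scale[OF linear] inner_add algebra_simps)
    show "?B (theta_hor q I) (theta_hor q K) = (if I = K then 1 else 0)" for I K
      using r by (simp add: theta_hor_def linear_scale[OF linear] dx inner_axis_axis power2_eq_square)
    show "?B (theta_contact q) \<eta> = 0" "?B \<eta> (theta_contact q) = 0" for \<eta>
      by (simp_all add: theta_contact_def linear_scale[OF linear] th)
  qed
  have expand: "\<eta> = (\<Sum>I\<in>UNIV. (rho q * hor_grad q \<eta> $ I) *\<^sub>R theta_hor q I) + ((rho q)\<^sup>2 * \<eta> (0, 1)) *\<^sub>R theta_contact q"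
    for \<eta> :: "'n heis \<Rightarrow>\<^sub>L real"
    using covector_expand[of \<eta> q] r by (simp add: theta_hor_def theta_contact_def hor_grad_def)
  have "B \<eta> \<omega> = ?B \<eta> \<omega>" if "?P B" for B \<eta> \<omega>
  proof -
    from that have bil: "bilinear B"
      and h: "\<And>I K. B (theta_hor q I) (theta_hor q K) = (if I = K then 1 else 0)"
      and c: "\<And>\<eta>. B (theta_contact q) \<eta> = 0" "\<And>\<eta>. B \<eta> (theta_contact q) = 0"
      by auto
    have "B \<eta> \<omega> = B (\<Sum>I\<in>UNIV. (rho q * hor_grad q \<eta> $ I) *\<^sub>R theta_hor q I)
      (\<Sum>I\<in>UNIV. (rho q * hor_grad q \<omega> $ I) *\<^sub>R theta_hor q I)"
      by (subst expand[of \<eta>], subst expand[of \<omega>])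
        (simp add: bilinear_ladd[OF bil] bilinear_radd[OF bil] bilinear_lmul[OF bil] bilinear_rmul[OF bil] c)
    also have "\<dots> = (\<Sum>I\<in>UNIV. \<Sum>K\<in>UNIV. (rho q * hor_grad q \<eta> $ I) * ((rho q * hor_grad q \<omega> $ K) * (if I = K then 1 else 0)))"
      by (simp add: bilinear_sum[OF bil] bilinear_lmul[OF bil] bilinear_rmul[OF bil] h sum.cartesian_product mult.left_commute)
    also have "\<dots> = ?B \<eta> \<omega>"
      by (simp add: inner_vec_def sum_distrib_left power2_eq_square mult_ac if_distrib cong: if_cong)
    finally show ?thesis .
  qed
  then have "cometric q = ?B"
    unfolding cometric_def using P by (intro the_equality) blast+
  then show ?thesis by simp
qed

lemma conorm_eq: "q \<noteq> 0 \<Longrightarrow> conorm q \<omega> = rho q * norm (hor_grad q \<omega>)"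
  using rho_pos[of q]
  by (simp add: conorm_def cometric_eq real_sqrt_mult norm_eq_sqrt_inner)

lemma wedge_scale_left: "wedge (c *\<^sub>R \<eta>) \<beta> = (\<lambda>vs. c * wedge \<eta> \<beta> vs)"
  by (simp add: wedge_def fun_eq_iff blinfun.scaleR_left sum_distrib_left mult_ac)

lemma wedge_scale_right: "wedge \<eta> (\<lambda>vs. c * \<beta> vs) = (\<lambda>vs. c * wedge \<eta> \<beta> vs)"
  by (simp add: wedge_def fun_eq_iff sum_distrib_left mult_ac)

lemma wedge_add_left: "wedge (\<eta> + \<omega>) \<beta> = (\<lambda>vs. wedge \<eta> \<beta> vs + wedge \<omega> \<beta> vs)"
  by (simp add: wedge_def fun_eq_iff blinfun.add_left sum.distrib algebra_simps)

lemma wedge_add_right: "wedge \<eta> (\<lambda>vs. \<beta> vs + \<gamma> vs) = (\<lambda>vs. wedge \<eta> \<beta> vs + wedge \<eta> \<gamma> vs)"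
  by (simp add: wedge_def fun_eq_iff sum.distrib algebra_simps)

lemma wedge_list_scale:
  "wedge_list (map (\<lambda>K. c *\<^sub>R \<eta> K) Ks @ \<eta>s) = (\<lambda>vs. c ^ length Ks * wedge_list (map \<eta> Ks @ \<eta>s) vs)"
  by (induction Ks) (simp_all add: wedge_list_Cons wedge_scale_left wedge_scale_right mult_ac)

lemma wedge_list_snoc_scale:
  "wedge_list (\<eta>s @ [c *\<^sub>R \<eta>]) = (\<lambda>vs. c * wedge_list (\<eta>s @ [\<eta>]) vs)"
  by (induction \<eta>s) (simp_all add: wedge_list_Cons wedge_scale_left wedge_scale_right)

lemma wedge_list_snoc_add:
  "wedge_list (\<eta>s @ [\<eta> + \<omega>]) = (\<lambda>vs. wedge_list (\<eta>s @ [\<eta>]) vs + wedge_list (\<eta>s @ [\<omega>]) vs)"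
  by (induction \<eta>s) (simp_all add: wedge_list_Cons wedge_add_left wedge_add_right)

lemma wedge_list_annihilated_Cons:
  assumes "\<And>\<eta>. \<eta> \<in> set \<eta>s \<Longrightarrow> blinfun_apply \<eta> \<zeta> = 0"
  shows "wedge_list \<eta>s (\<zeta> # vs) = 0"
  using assms
proof (induction \<eta>s arbitrary: vs)
  case Nil
  then show ?case by (simp add: wedge_list_Nil)
next
  case (Cons \<eta> \<eta>s)
  then have "(\<lambda>us. wedge_list \<eta>s (\<zeta> # us)) = (\<lambda>us. 0)" by auto
  then have "wedge \<eta> (\<lambda>us. wedge_list \<eta>s (\<zeta> # us)) vs = 0" by (simp add: wedge_def)
  then show ?case using Cons.prems by (simp add: wedge_list_Cons wedge_Cons)
qed

text \<open>Contracting with \<open>\<zeta>\<close> gives zero factor by factor. A further wedge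
  with the covector of \<open>\<zeta>\<close> has degree above the dimension, and its value at
  \<open>\<zeta> # vs\<close> is |\<zeta>|^2 times the claimed quantity.\<close>

lemma wedge_list_annihilated:
  fixes \<zeta> :: "'a::euclidean_space"
  assumes ann: "\<And>\<eta>. \<eta> \<in> set \<eta>s \<Longrightarrow> blinfun_apply \<eta> \<zeta> = 0" and "\<zeta> \<noteq> 0" and "length \<eta>s = DIM('a)"
  shows "wedge_list \<eta>s vs = 0"
proof -
  let ?\<eta> = "blinfun_inner_right \<zeta>"
  have "wedge ?\<eta> (wedge_list \<eta>s) (\<zeta> # vs) = 0"
    using wedge_list_in_alt_forms[of \<eta>s] assms(3)
    by (intro alt_forms_dependent[of _ "Suc (DIM('a))"] wedge_in_alt_forms) auto
  then show ?thesis
    using assms(2) wedge_list_annihilated_Cons[of \<eta>s \<zeta>, OF ann] wedge_Cons[of ?\<eta> "wedge_list \<eta>s" \<zeta> vs]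
    by (simp add: wedge_def[of _ "\<lambda>us. 0"])
qed

lemma wedge_list_dual:
  assumes "length \<eta>s = length vs"
    and "\<And>i j. i < length vs \<Longrightarrow> j < length vs \<Longrightarrow> blinfun_apply (\<eta>s ! i) (vs ! j) = (if i = j then 1 else 0)"
  shows "wedge_list \<eta>s vs = 1"
  using assms
proof (induction \<eta>s vs rule: list_induct2)
  case Nil
  then show ?case by (simp add: wedge_list_Nil)
next
  case (Cons \<eta> \<eta>s v vs)
  have "blinfun_apply \<eta> (vs ! j) = 0" if "j < length vs" for j
    using Cons.prems[of 0 "Suc j"] that by simp
  then have "wedge \<eta> \<beta> vs = 0" for \<beta> by (simp add: wedge_def)
  moreover have "wedge_list \<eta>s vs = 1"
    using Cons.prems[of "Suc i" "Suc j" for i j] by (intro Cons.IH) auto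
  ultimately show ?case
    using Cons.prems[of 0 0] by (simp add: wedge_list_Cons wedge_Cons)
qed

definition vol0 :: "'n::{finite,linorder} heis list \<Rightarrow> real" where
  "vol0 = wedge_list (map dx hor_indices @ [dz])"

lemma length_hor_indices: "length (hor_indices :: ('n::{finite,linorder} + 'n) list) = 2 * CARD('n)"
  by (simp add: hor_indices_def)

lemma DIM_heis: "DIM('n::finite heis) = Suc (2 * CARD('n))"
  by simp

lemma distinct_hor_indices: "distinct hor_indices"
  by (auto simp: hor_indices_def distinct_map)

lemma vol0_alt: "(vol0 :: 'n::{finite,linorder} heis list \<Rightarrow> real) \<in> alt_forms (Suc (2 * CARD('n)))"
  using wedge_list_in_alt_forms[of "map dx (hor_indices :: ('n + 'n) list) @ [dz]"]
  by (simp add: vol0_def length_hor_indices)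

lemma vol0_nonzero: "\<exists>vs. vol0 vs \<noteq> 0"
proof -
  have "vol0 (map (\<lambda>K. (axis K 1, 0)) hor_indices @ [(0, 1)]) = 1"
    unfolding vol0_def
    by (rule wedge_list_dual)
      (auto simp: nth_append less_Suc_eq dx_apply dz_apply axis_def nth_eq_iff_index_eq[OF distinct_hor_indices])
  then show ?thesis by (metis zero_neq_one)
qed

text \<open>\<open>Theta q - dz\<close> is a combination of the \<open>dx I\<close> and drops out of
  the wedge, because all factors then annihilate the vertical direction. The exponent counts one
  power of 1/rho per horizontal covector and two for the contact form.\<close>

lemma dV_eq:
  fixes q :: "'n::{finite,linorder} heis"
  shows "dV q = (\<lambda>vs. (1 / rho q) ^ (2 * CARD('n) + 2) * vol0 vs)"
proof -
  let ?xs = "map dx (hor_indices :: ('n + 'n) list)"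
  define \<omega> where "\<omega> = Theta q - dz"
  have \<omega>: "Theta q = dz + \<omega>" by (simp add: \<omega>_def)
  have "wedge_list (?xs @ [\<omega>]) vs = 0" for vs
    by (rule wedge_list_annihilated[of _ "(0, 1)"])
      (auto simp: dx_apply \<omega>_def Theta_apply dz_apply blinfun.diff_left length_hor_indices zero_prod_def)
  then have "wedge_list (?xs @ [Theta q]) = vol0"
    unfolding \<omega> wedge_list_snoc_add by (simp add: vol0_def)
  then have "wedge_list (?xs @ [theta_contact q]) = (\<lambda>vs. (1 / rho q)\<^sup>2 * vol0 vs)"
    by (simp add: theta_contact_def wedge_list_snoc_scale power_one_over)
  then show ?thesis
    unfolding dV_def theta_hor_def[abs_def] wedge_list_scale
    by (simp add: length_hor_indices power_add power2_eq_square)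
qed

text \<open>The vector represents \<open>\<omega>\<close> for the cometric: every covector
  \<open>\<eta>\<close> takes the value \<open>cometric q \<eta> \<omega>\<close> on it. So
  \<open>wedge_Cons_top\<close> verifies the defining property and \<open>wedge_inject\<close> gives
  uniqueness.\<close>

lemma contract_dV_eq:
  fixes q :: "'n::{finite,linorder} heis" and \<omega> :: "'n heis \<Rightarrow>\<^sub>L real"
  assumes q: "q \<noteq> 0"
  shows "contract_dV q \<omega> = (\<lambda>vs. dV q ((rho q)\<^sup>2 *\<^sub>R lift q (hor_grad q \<omega>) # vs))"
proof -
  let ?W = "(rho q)\<^sup>2 *\<^sub>R lift q (hor_grad q \<omega>)"
  let ?P = "\<lambda>\<beta>. \<beta> \<in> alt_forms (2 * CARD('n)) \<and>
     (\<forall>\<eta>. wedge \<eta> \<beta> = (\<lambda>vs. cometric q \<eta> \<omega> * dV q vs))"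
  have alt: "dV q \<in> alt_forms (Suc (2 * CARD('n)))"
    using wedge_list_in_alt_forms[of "map (theta_hor q) hor_indices @ [theta_contact q]"]
    by (simp add: dV_def length_hor_indices)
  have \<eta>: "\<eta> ?W = cometric q \<eta> \<omega>" for \<eta> :: "'n heis \<Rightarrow>\<^sub>L real"
    using hor_grad_inner[OF bounded_linear.linear[OF blinfun.bounded_linear_right[of \<eta>]], of q "hor_grad q \<omega>"]
    by (simp add: cometric_eq[OF q] blinfun.scaleR_right)
  have P: "?P (\<lambda>vs. dV q (?W # vs))"
  proof -
    have "dV q \<in> alt_forms (DIM('n heis))"
      using alt by (simp only: DIM_heis)
    then have "wedge \<eta> (\<lambda>us. dV q (?W # us)) = (\<lambda>vs. cometric q \<eta> \<omega> * dV q vs)" for \<eta>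
      using wedge_Cons_top[of "dV q" \<eta> ?W] by (simp only: \<eta>)
    then show ?thesis
      by (intro conjI allI Cons_form_in_alt_forms[OF alt])
  qed
  have unique: "\<beta> = (\<lambda>vs. dV q (?W # vs))" if \<beta>: "?P \<beta>" for \<beta>
  proof (rule wedge_inject[OF conjunct1[OF \<beta>] conjunct1[OF P]])
    show "2 * CARD('n) < DIM('n heis)" by simp
    show "wedge \<eta> \<beta> = wedge \<eta> (\<lambda>vs. dV q (?W # vs))" for \<eta>
      unfolding spec[OF conjunct2[OF \<beta>]] spec[OF conjunct2[OF P]] ..
  qed
  show ?thesis
    unfolding contract_dV_def by (rule the_equality[of ?P, OF P unique])
qed

section \<open>Second order jets and the divergence form of the mean curvature\<close>

definition has_jet ::
  "('a::real_normed_vector \<Rightarrow> real) \<Rightarrow> 'a set \<Rightarrow> ('a \<Rightarrow> 'a \<Rightarrow> real) \<Rightarrow> ('a \<Rightarrow> 'a \<Rightarrow> 'a \<Rightarrow> real) \<Rightarrow> bool" where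
  "has_jet \<phi> W d b \<longleftrightarrow> open W \<and>
     (\<forall>q\<in>W. (\<phi> has_derivative d q) (at q) \<and> (\<forall>v. ((\<lambda>q. d q v) has_derivative b q v) (at q))) \<and>
     (\<forall>v w. continuous_on W (\<lambda>q. b q v w))"

lemma has_jetD:
  assumes "has_jet \<phi> W d b" "q \<in> W"
  shows "(\<phi> has_derivative d q) (at q)" "((\<lambda>q. d q v) has_derivative b q v) (at q)" "open W"
    "linear (d q)" "linear (b q v)"
  using assms by (auto simp: has_jet_def intro: has_derivative_linear)

text \<open>In \<open>b q v w\<close> the argument \<open>w\<close> is the direction of the second
  differentiation. Linearity in \<open>v\<close> is inherited from the nearby differentials because
  derivatives are unique.\<close>

lemma has_jet_linear_left:
  assumes j: "has_jet \<phi> W d b" "q \<in> W"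
  shows "linear (\<lambda>v. b q v w)"
proof (rule linearI)
  note D = has_jetD[OF j]
  have eq: "b q v = g" if "((\<lambda>q. d q v) has_derivative g) (at q)" for v g
    using D(2) that by (rule has_derivative_unique)
  have ev: "\<forall>\<^sub>F q' in at q. linear (d q')"
    using eventually_at_in_open'[OF D(3) j(2)] by eventually_elim (use has_jetD(4)[OF j(1)] in auto)
  fix v v' c
  have "((\<lambda>q. d q (v + v')) has_derivative (\<lambda>w. b q v w + b q v' w)) (at q)"
    using has_derivative_add[OF D(2)[of v] D(2)[of v']]
    by (rule has_derivative_transform_eventually)
      (use ev linear_add[OF D(4)] in \<open>auto elim: eventually_mono simp: linear_add\<close>)
  then show "b q (v + v') w = b q v w + b q v' w" by (simp add: eq)
  have "((\<lambda>q. d q (c *\<^sub>R v)) has_derivative (\<lambda>w. c *\<^sub>R b q v w)) (at q)"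
    using has_derivative_scaleR_right[OF D(2)[of v], of c]
    by (rule has_derivative_transform_eventually)
      (use ev linear_scale[OF D(4)] in \<open>auto elim: eventually_mono simp: linear_scale\<close>)
  then show "b q (c *\<^sub>R v) w = c *\<^sub>R b q v w" by (simp add: eq)
qed

text \<open>A quarter of the horizontal gradient of \<open>rho4\<close>; the Jp-part comes from the
  z-derivative along the horizontal frame.\<close>

definition Pt :: "'n::finite heis \<Rightarrow> real ^ ('n + 'n)" where
  "Pt q = (fst q \<bullet> fst q) *\<^sub>R fst q + (2 * snd q) *\<^sub>R Jp (fst q)"

definition hor_trace :: "'n::finite heis \<Rightarrow> ('n heis \<Rightarrow> 'n heis \<Rightarrow> real) \<Rightarrow> real" where
  "hor_trace q b = (\<Sum>I\<in>UNIV. b (lift q (axis I 1)) (lift q (axis I 1)))"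

text \<open>The numerator of the mean curvature: \<open>H_fun \<phi> = \<rho> mean_op / |p|\<^sup>3\<close> with \<open>p\<close> the horizontal gradient.\<close>

definition mean_op :: "'n::finite heis \<Rightarrow> ('n heis \<Rightarrow> real) \<Rightarrow> ('n heis \<Rightarrow> 'n heis \<Rightarrow> real) \<Rightarrow> real" where
  "mean_op q \<omega> b = (let p = hor_grad q \<omega> in
     (p \<bullet> p) * hor_trace q b - b (lift q p) (lift q p)
       - (2 * real CARD('n) + 1) * (p \<bullet> p) * (p \<bullet> Pt q) / rho4 q)"

lemma has_derivative_rho4:
  "(rho4 has_derivative (\<lambda>w. 4 * (fst q \<bullet> fst q) * (fst q \<bullet> fst w) + 8 * snd q * snd w)) (at q)"
  unfolding rho4_def
  by (auto intro!: derivative_eq_intros simp: fun_eq_iff inner_commute algebra_simps)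

text \<open>The frame turns with the base point: the lift of a fixed vector changes by a vertical
  vector, which produces the summand with \<open>Jp (fst w)\<close>. Being skew, it contributes
  neither to the trace nor to the quadratic form on the gradient.\<close>

lemma has_derivative_hor_grad:
  fixes q :: "'n::finite heis"
  assumes j: "has_jet \<phi> W d b" and q: "q \<in> W"
  shows "((\<lambda>q. hor_grad q (d q)) has_derivative
    (\<lambda>w. hor_grad q (\<lambda>v. b q v w) + d q (0, 1) *\<^sub>R Jp (fst w))) (at q)"
proof -
  note D = has_jetD[OF j]
  have split: "lift q (axis I 1) = (axis I 1, 0) + (Jp (fst q) $ I) *\<^sub>R (0, 1)" for q I
    by (simp add: lift_def inner_axis')
  have lin: "f (lift q (axis I 1)) = f (axis I 1, 0) + Jp (fst q) $ I * f (0, 1)" if "linear f" for q f I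
    by (subst split) (simp add: linear_add[OF that] linear_scale[OF that] del: scaleR_Pair)
  have J: "((\<lambda>q. Jp (fst q)) has_derivative (\<lambda>w. Jp (fst w))) (at q)"
    by (intro bounded_linear_imp_has_derivative bounded_linear_compose[OF _ bounded_linear_fst])
      (use linear_Jp in \<open>simp add: linear_conv_bounded_linear\<close>)
  have JI: "((\<lambda>q. Jp (fst q) $ I) has_derivative (\<lambda>w. Jp (fst w) $ I)) (at q)" for I
    using bounded_linear.has_derivative[OF bounded_linear_vec_nth J] .
  have sum_axis: "(\<chi> I. f I) = (\<Sum>I\<in>UNIV. f I *\<^sub>R axis I 1)" for f :: "'n + 'n \<Rightarrow> real"
    using basis_expansion[of "\<chi> I. f I"] by (simp add: scalar_mult_eq_scaleR)
  have "((\<lambda>q. \<chi> I. d q (axis I 1, 0) + Jp (fst q) $ I * d q (0, 1)) has_derivative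
      (\<lambda>w. \<chi> I. b q (axis I 1, 0) w + (Jp (fst q) $ I * b q (0, 1) w + Jp (fst w) $ I * d q (0, 1)))) (at q)"
    unfolding sum_axis
    by (intro has_derivative_sum has_derivative_scaleR_left has_derivative_add has_derivative_mult D(2)[OF q] JI)
  moreover have "\<forall>\<^sub>F q' in at q. (\<chi> I. d q' (axis I 1, 0) + Jp (fst q') $ I * d q' (0, 1)) = hor_grad q' (d q')"
    using eventually_at_in_open'[OF D(3)[OF q] q]
    by eventually_elim (simp add: hor_grad_def lin[OF D(4)])
  ultimately have "((\<lambda>q. hor_grad q (d q)) has_derivative
      (\<lambda>w. \<chi> I. b q (axis I 1, 0) w + (Jp (fst q) $ I * b q (0, 1) w + Jp (fst w) $ I * d q (0, 1)))) (at q)"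
    by (rule has_derivative_transform_eventually) (simp_all add: hor_grad_def lin[OF D(4)[OF q]])
  moreover have "(\<chi> I. b q (axis I 1, 0) w + (Jp (fst q) $ I * b q (0, 1) w + Jp (fst w) $ I * d q (0, 1)))
      = hor_grad q (\<lambda>v. b q v w) + d q (0, 1) *\<^sub>R Jp (fst w)" for w
    by (simp add: vec_eq_iff hor_grad_def lin[OF has_jet_linear_left[OF j q]])
  ultimately show ?thesis by simp
qed

lemma hor_grad_bilinear_inner:
  assumes j: "has_jet \<phi> W d b" and q: "q \<in> W"
  shows "a \<bullet> hor_grad q (\<lambda>v. b q v w) = b q (lift q a) w"
  using hor_grad_inner[OF has_jet_linear_left[OF j q]] by (simp add: inner_commute)

lemma has_derivative_lift:
  assumes y: "(y has_derivative y') (at q)"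
  shows "((\<lambda>q. lift q (y q)) has_derivative
    (\<lambda>w. (y' w, y' w \<bullet> Jp (fst q) + y q \<bullet> Jp (fst w)))) (at q)"
proof -
  have J: "((\<lambda>q. Jp (fst q)) has_derivative (\<lambda>w. Jp (fst w))) (at q)"
    by (intro bounded_linear_imp_has_derivative bounded_linear_compose[OF _ bounded_linear_fst])
      (use linear_Jp in \<open>simp add: linear_conv_bounded_linear\<close>)
  show ?thesis
    unfolding lift_def
    by (auto intro!: derivative_eq_intros y J simp: algebra_simps)
qed

text \<open>The left side is the divergence of the horizontal field \<open>lift q (y q)\<close>.\<close>

lemma trace_horizontal:
  fixes y' :: "'n::finite heis \<Rightarrow> real ^ ('n + 'n)"
  assumes y': "linear y'"
  shows "(\<Sum>c\<in>Basis. (y' c, y' c \<bullet> Jp (fst q) + y \<bullet> Jp (fst c)) \<bullet> c) = (\<Sum>I\<in>UNIV. y' (lift q (axis I 1)) $ I)"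
proof -
  have J0: "Jp 0 = (0 :: real ^ ('n + 'n))" using linear_0[OF linear_Jp] .
  have "(\<Sum>c\<in>Basis. (y' c, y' c \<bullet> Jp (fst q) + y \<bullet> Jp (fst c)) \<bullet> c)
    = (\<Sum>c\<in>Basis. y' (c, 0) \<bullet> c) + y' (0, 1) \<bullet> Jp (fst q)"
    unfolding Basis_prod_def
    by (subst sum.union_disjoint) (auto simp: sum.reindex inj_on_def inner_Pair_0 J0 nonzero_Basis)
  also have "(\<Sum>c\<in>Basis. y' (c, 0) \<bullet> c) = (\<Sum>I\<in>UNIV. y' (axis I 1, 0) $ I)"
    by (subst sum.reindex_bij_betw[of "\<lambda>I. axis I 1" UNIV Basis, symmetric])
      (auto simp: bij_betw_def inj_on_def axis_eq_axis Basis_vec_def inner_axis)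
  also have "\<dots> + y' (0, 1) \<bullet> Jp (fst q) = (\<Sum>I\<in>UNIV. y' (lift q (axis I 1)) $ I)"
  proof -
    have "lift q (axis I 1) = (axis I 1, 0) + (Jp (fst q) $ I) *\<^sub>R (0, 1)" for I
      by (simp add: lift_def inner_axis')
    then show ?thesis
      by (simp add: linear_add[OF y'] linear_scale[OF y'] inner_vec_def sum.distrib mult.commute del: scaleR_Pair)
  qed
  finally show ?thesis .
qed

text \<open>For a constant top form the exterior derivative of its contraction with a vector field
  is the divergence of the field times the form. The exterior derivative is an alternating sum over
  the slots, which \<open>alt_forms_trace\<close> evaluates as a trace.\<close>

lemma ext_deriv_Cons_form:
  fixes \<beta> :: "'a::euclidean_space list \<Rightarrow> real"
  assumes b: "\<beta> \<in> alt_forms (DIM('a))" and Y: "(Y has_derivative Y') (at q)"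
    and eq: "\<forall>\<^sub>F q' in nhds q. \<alpha> q' = (\<lambda>vs. \<beta> (Y q' # vs))"
  shows "ext_deriv \<alpha> q vs = (\<Sum>c\<in>Basis. Y' c \<bullet> c) * \<beta> vs"
proof -
  have DIM: "DIM('a) = Suc (DIM('a) - 1)" using DIM_positive[where 'a='a] by simp
  have D: "frechet_derivative (\<lambda>q'. \<alpha> q' us) (at q) = (\<lambda>w. \<beta> (Y' w # us))" for us
  proof -
    have "linear (\<lambda>w. \<beta> (w # us))"
    proof (cases "length us = DIM('a) - 1")
      case True
      then show ?thesis using b DIM by (intro alt_forms_Cons_linear) auto
    next
      case False
      then have "(\<lambda>w. \<beta> (w # us)) = (\<lambda>w. 0)" using DIM by (auto intro!: alt_forms_length[OF b])
      then show ?thesis by (simp add: linear_zero)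
    qed
    then have "((\<lambda>q'. \<beta> (Y q' # us)) has_derivative (\<lambda>w. \<beta> (Y' w # us))) (at q)"
      using bounded_linear.has_derivative[OF _ Y] by (simp add: linear_conv_bounded_linear)
    moreover have "\<forall>\<^sub>F q' in at q. \<beta> (Y q' # us) = \<alpha> q' us"
      using eq by (auto simp: eventually_at_filter elim: eventually_mono)
    ultimately have "((\<lambda>q'. \<alpha> q' us) has_derivative (\<lambda>w. \<beta> (Y' w # us))) (at q)"
      by (rule has_derivative_transform_eventually) (use eventually_nhds_x_imp_x[OF eq] in auto)
    then show ?thesis by (simp add: frechet_derivative_at[symmetric])
  qed
  show ?thesis
  proof (cases "length vs = DIM('a)")
    case True
    then show ?thesis
      using alt_forms_trace[OF b has_derivative_linear[OF Y] True] by (simp add: ext_deriv_def D)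
  next
    case False
    have "\<beta> (Y' (vs ! i) # remove_nth i vs) = 0" if "i < length vs" for i
      using False that by (intro alt_forms_length[OF b]) (auto simp: length_remove_nth)
    then show ?thesis
      using alt_forms_length[OF b False] by (simp add: ext_deriv_def D)
  qed
qed

text \<open>The contracted form is the Euclidean volume form contracted with one horizontal field,
  the unit gradient times a power of rho, so the mean curvature is the divergence of that field
  relative to \<open>dV\<close>. Differentiating the direction yields the trace and quadratic terms
  of \<open>mean_op\<close>, differentiating the power of rho the last one.\<close>

lemma H_fun_eq:
  fixes q :: "'n::{finite,linorder} heis"
  assumes j: "has_jet \<phi> W d b" and q: "q \<in> W" "q \<noteq> 0" and ns: "hor_grad q (d q) \<noteq> 0"
  shows "H_fun \<phi> q = rho q * mean_op q (d q) (b q) / norm (hor_grad q (d q)) ^ 3"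
proof -
  let ?m = "2 * real CARD('n) + 1"
  define p where "p q' = hor_grad q' (d q')" for q'
  \<comment> \<open>The exponent of rho is -(2n + 2) from \<open>dV\<close>, + 2 from the cometric
    and - 1 from the norm of the covector, in total -(2n + 1), written as a power of the smooth
    function \<open>rho4\<close>.\<close>
  define g where "g q' = rho4 q' powr (- ?m / 4)" for q' :: "'n heis"
  define y where "y q' = (g q' / norm (p q')) *\<^sub>R p q'" for q'
  define Y where "Y q' = lift q' (y q')" for q'
  note D = has_jetD[OF j]
  define p' where "p' w = hor_grad q (\<lambda>v. b q v w) + d q (0, 1) *\<^sub>R Jp (fst w)" for w
  have p: "(p has_derivative p') (at q)"
    using has_derivative_hor_grad[OF j q(1)] by (simp add: p_def[abs_def] p'_def[abs_def])
  have pq: "norm (p q) > 0" using ns by (simp add: p_def)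
  have S: "rho4 q > 0" using rho4_pos[OF q(2)] .
  have rho_g: "g q' = (1 / rho q') ^ (2 * CARD('n) + 1)" if "q' \<noteq> 0" for q' :: "'n heis"
  proof -
    have "rho q' = rho4 q' powr (1 / 4)"
      using root_powr_inverse[of 4 "rho4 q'"] rho4_pos[OF that] by (simp add: rho_rho4)
    then have "1 / rho q' = rho4 q' powr (- 1 / 4)"
      by (simp add: powr_minus_divide[symmetric])
    then have "(1 / rho q') ^ (2 * CARD('n) + 1) = (rho4 q' powr (- 1 / 4)) powr ?m"
      using powr_realpow[of "rho4 q' powr (- 1 / 4)" "2 * CARD('n) + 1"] rho4_pos[OF that]
      by (simp add: add.commute)
    moreover have "(- 1 / 4) * ?m = - ?m / 4" by (simp add: field_simps)
    ultimately show ?thesis by (simp only: g_def powr_powr)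
  qed
  define g' where "g' w = - ?m / 4 * g q / rho4 q * (4 * (fst q \<bullet> fst q) * (fst q \<bullet> fst w) + 8 * snd q * snd w)" for w
  have g: "(g has_derivative g') (at q)"
    unfolding g_def[abs_def] g'_def[abs_def]
    by (rule has_derivative_eq_rhs, rule has_derivative_powr[OF has_derivative_rho4 has_derivative_const S])
      (auto simp: fun_eq_iff)
  have n: "((\<lambda>q'. norm (p q')) has_derivative (\<lambda>w. (p q \<bullet> p' w) / norm (p q))) (at q)"
    by (rule has_derivative_eq_rhs, rule has_derivative_compose[OF p has_derivative_norm])
      (use pq in \<open>auto simp: fun_eq_iff sgn_div_norm inner_commute field_simps\<close>)
  define y' where "y' w = (g q / norm (p q)) *\<^sub>R p' w
      + (g' w / norm (p q) - g q * (p q \<bullet> p' w) / norm (p q) ^ 3) *\<^sub>R p q" for w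
  have y: "(y has_derivative y') (at q)"
    unfolding y_def[abs_def] y'_def[abs_def] using pq
    by (auto intro!: derivative_eq_intros g n p simp: fun_eq_iff power3_eq_cube field_simps)
  have Y: "(Y has_derivative (\<lambda>w. (y' w, y' w \<bullet> Jp (fst q) + y q \<bullet> Jp (fst w)))) (at q)"
    unfolding Y_def[abs_def] by (rule has_derivative_lift[OF y])
  have contract: "contract_dV q' ((1 / conorm q' (differential \<phi> q')) *\<^sub>R differential \<phi> q') =
      (\<lambda>vs. vol0 (Y q' # vs))" if q': "q' \<in> W" "q' \<noteq> 0" for q'
  proof
    fix vs :: "'n heis list"
    have r: "rho q' > 0" using rho_pos[OF q'(2)] .
    have "differential \<phi> q' = Blinfun (d q')"
      using frechet_derivative_at[OF D(1)] has_jetD(1)[OF j q'(1)]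
      by (simp add: differential_def frechet_derivative_at[symmetric])
    then have dq: "blinfun_apply (differential \<phi> q') = d q'"
      using has_jetD(4)[OF j q'(1)] by (simp add: bounded_linear_Blinfun_apply linear_conv_bounded_linear)
    have "Y q' = ((1 / rho q') ^ (2 * CARD('n) + 1) / norm (p q')) *\<^sub>R lift q' (p q')"
      by (simp add: Y_def y_def linear_scale[OF linear_lift] rho_g[OF q'(2)])
    also have "\<dots> = (1 / rho q') ^ (2 * CARD('n) + 2) *\<^sub>R ((rho q')\<^sup>2 *\<^sub>R
        lift q' (hor_grad q' ((1 / conorm q' (differential \<phi> q')) *\<^sub>R differential \<phi> q')))"
    proof -
      have "hor_grad q' ((1 / conorm q' (differential \<phi> q')) *\<^sub>R differential \<phi> q')
          = (1 / (rho q' * norm (p q'))) *\<^sub>R p q'"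
        by (simp add: conorm_eq[OF q'(2)] hor_grad_def vec_eq_iff blinfun.scaleR_left dq p_def)
      then show ?thesis
        using r by (simp add: linear_scale[OF linear_lift] power2_eq_square field_simps)
    qed
    finally have Yq: "Y q' = (1 / rho q') ^ (2 * CARD('n) + 2) *\<^sub>R ((rho q')\<^sup>2 *\<^sub>R
        lift q' (hor_grad q' ((1 / conorm q' (differential \<phi> q')) *\<^sub>R differential \<phi> q')))" .
    have sc: "vol0 (c *\<^sub>R w # vs) = c * vol0 (w # vs)" for c w
    proof (cases "length vs = 2 * CARD('n)")
      case True
      then show ?thesis using linear_scale[OF alt_forms_Cons_linear[OF vol0_alt True], of c w] by simp
    next
      case False
      then show ?thesis
        using alt_forms_length[OF vol0_alt, of "c *\<^sub>R w # vs"] alt_forms_length[OF vol0_alt, of "w # vs"] by simp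
    qed
    show "contract_dV q' ((1 / conorm q' (differential \<phi> q')) *\<^sub>R differential \<phi> q') vs = vol0 (Y q' # vs)"
      by (simp only: contract_dV_eq[OF q'(2)] dV_eq Yq sc)
  qed
  have "\<forall>\<^sub>F q' in nhds q. q' \<in> W - {0}"
    using D(3)[OF q(1)] q by (intro eventually_nhds_in_open open_delete) auto
  then have ev: "\<forall>\<^sub>F q' in nhds q. contract_dV q' ((1 / conorm q' (differential \<phi> q')) *\<^sub>R differential \<phi> q') =
      (\<lambda>vs. vol0 (Y q' # vs))"
    by eventually_elim (use contract in auto)
  have vol: "(vol0 :: 'n heis list \<Rightarrow> real) \<in> alt_forms (DIM('n heis))"
    using vol0_alt by (simp only: DIM_heis)
  have pJ: "p q \<bullet> p' (lift q a) = b q (lift q (p q)) (lift q a) + d q (0, 1) * (p q \<bullet> Jp a)" for a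
    by (simp add: p'_def inner_add_right hor_grad_bilinear_inner[OF j q(1)] lift_def)
  have lin: "linear p'" "linear g'" "linear y'"
    using p g y by (auto intro: has_derivative_linear)
  have sum_p: "(\<Sum>I\<in>UNIV. f (lift q (axis I 1)) * p q $ I) = f (lift q (p q))" if "linear f" for f :: "'n heis \<Rightarrow> real"
    using hor_grad_inner[OF that, of q "p q"] by (simp add: hor_grad_def inner_vec_def)
  \<comment> \<open>The turning of the frame does not show up here: the diagonal entries of
    \<open>Jp\<close> are zero.\<close>
  have "(\<Sum>I\<in>UNIV. p' (lift q (axis I 1)) $ I) = hor_trace q (b q)"
    by (simp add: p'_def hor_trace_def hor_grad_def lift_def Jp_def axis_def split: sum.splits)
      (auto intro!: sum.cong simp: axis_def Jp_def split: sum.splits)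
  moreover have "(\<Sum>I\<in>UNIV. (p q \<bullet> p' (lift q (axis I 1))) * p q $ I) = b q (lift q (p q)) (lift q (p q))"
    using sum_p[of "\<lambda>v. p q \<bullet> p' v"] lin(1)
    by (simp add: pJ linear_iff inner_add_right)
  moreover have "(\<Sum>I\<in>UNIV. g' (lift q (axis I 1)) * p q $ I) = - ?m * g q / rho4 q * (p q \<bullet> Pt q)"
    unfolding sum_p[OF lin(2)]
    using S by (simp add: g'_def lift_def Pt_def inner_add_right inner_commute field_simps)
  ultimately have tr: "(\<Sum>I\<in>UNIV. y' (lift q (axis I 1)) $ I) =
     g q / norm (p q) * hor_trace q (b q) + (- ?m * g q / rho4 q * (p q \<bullet> Pt q)) / norm (p q)
       - g q * b q (lift q (p q)) (lift q (p q)) / norm (p q) ^ 3"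
    by (simp add: y'_def sum.distrib sum_subtractf sum_distrib_left[symmetric] sum_divide_distrib[symmetric]
        left_diff_distrib mult.assoc times_divide_eq_left)
  also have "\<dots> = g q * mean_op q (d q) (b q) / norm (p q) ^ 3"
  proof -
    have "p q \<bullet> p q = (norm (p q))\<^sup>2" by (simp add: power2_norm_eq_inner)
    then show ?thesis
      using pq S by (simp add: mean_op_def Let_def p_def[symmetric] power3_eq_cube power2_eq_square field_simps)
  qed
  finally have tr: "(\<Sum>c\<in>Basis. (y' c, y' c \<bullet> Jp (fst q) + y q \<bullet> Jp (fst c)) \<bullet> c) = g q * mean_op q (d q) (b q) / norm (p q) ^ 3"
    by (simp add: trace_horizontal[OF lin(3)])
  let ?h = "rho q * mean_op q (d q) (b q) / norm (p q) ^ 3"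
  have r: "rho q > 0" using rho_pos[OF q(2)] .
  have *: "ext_deriv (\<lambda>q'. contract_dV q' ((1 / conorm q' (differential \<phi> q')) *\<^sub>R differential \<phi> q')) q vs
       = ?h * dV q vs" for vs
    unfolding ext_deriv_Cons_form[OF vol Y ev] tr
    using r by (simp add: dV_eq rho_g[OF q(2)] field_simps)
  obtain vs where "vol0 vs \<noteq> (0::real)" "vs = (vs :: 'n heis list)" using vol0_nonzero by metis
  then have "dV q vs \<noteq> 0" using r by (simp add: dV_eq)
  then have "h = ?h" if "\<forall>vs. ext_deriv (\<lambda>q'. contract_dV q'
      ((1 / conorm q' (differential \<phi> q')) *\<^sub>R differential \<phi> q')) q vs = h * dV q vs" for h
    using trans[OF that[rule_format, of vs, symmetric] *[of vs]] by (metis mult_right_cancel)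
  then have "H_fun \<phi> q = ?h"
    unfolding H_fun_def using * by (intro the_equality) blast+
  then show ?thesis by (simp add: p_def)
qed

section \<open>Second order comparison\<close>

lemma second_derivative_local_max:
  fixes g :: "real \<Rightarrow> real"
  assumes g: "\<forall>\<^sub>F t in nhds 0. (g has_real_derivative g' t) (at t)"
    and g'': "(g' has_real_derivative c) (at 0)" and z: "g' 0 = 0"
    and max: "\<forall>\<^sub>F t in nhds 0. g t \<le> g 0"
  shows "c \<le> 0"
proof (rule ccontr)
  assume "\<not> c \<le> 0"
  then obtain e where e: "e > 0" "\<And>h. 0 < h \<Longrightarrow> h < e \<Longrightarrow> g' 0 < g' h"
    using DERIV_pos_inc_right[OF g''] by auto
  from g max obtain d where d: "d > 0"
    and gd: "\<And>t. \<bar>t\<bar> < d \<Longrightarrow> (g has_real_derivative g' t) (at t) \<and> g t \<le> g 0"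
    using eventually_conj[OF g max] unfolding eventually_nhds_metric by (auto simp: dist_real_def)
  define r where "r = min d e / 2"
  have r: "0 < r" "r < d" "r < e" using d e by (auto simp: r_def)
  have "g 0 < g r"
  proof (rule DERIV_pos_imp_increasing_open[OF r(1)])
    show "\<exists>y. (g has_real_derivative y) (at x) \<and> 0 < y" if "0 < x" "x < r" for x
      using gd[of x] e(2)[of x] that r z by auto
    show "continuous_on {0..r} g"
    proof (intro continuous_at_imp_continuous_on ballI)
      fix t assume "t \<in> {0..r}"
      then show "isCont g t" using gd[of t] r by (auto intro: DERIV_isCont)
    qed
  qed
  then show False using gd[of r] r by auto
qed

text \<open>Jets are differentiable only for each fixed direction. Expanding the moving direction in
  a basis reduces the product rule to finitely many scalar products.\<close>

lemma has_derivative_apply_linear: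
  fixes d :: "'a::real_normed_vector \<Rightarrow> 'b::euclidean_space \<Rightarrow> real"
  assumes d: "\<And>v. ((\<lambda>t. d t v) has_derivative d' v) (at t)"
    and y: "(y has_derivative y') (at t)"
    and lin: "\<forall>\<^sub>F s in nhds t. linear (d s)"
  shows "((\<lambda>s. d s (y s)) has_derivative (\<lambda>s. d t (y' s) + (\<Sum>c\<in>Basis. (y t \<bullet> c) * d' c s))) (at t)"
proof -
  have *: "((\<lambda>s. \<Sum>c\<in>Basis. (y s \<bullet> c) * d s c) has_derivative
      (\<lambda>s. \<Sum>c\<in>Basis. (y t \<bullet> c) * d' c s + (y' s \<bullet> c) * d t c)) (at t)"
    by (intro has_derivative_sum has_derivative_mult has_derivative_inner_left y d)
  have ex: "d s v = (\<Sum>c\<in>Basis. (v \<bullet> c) * d s c)" if "linear (d s)" for s v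
    by (subst euclidean_representation[of v, symmetric]) (simp add: linear_sum[OF that] linear_scale[OF that])
  have t: "linear (d t)" using eventually_nhds_x_imp_x[OF lin] .
  have "\<forall>\<^sub>F s in at t. (\<Sum>c\<in>Basis. (y s \<bullet> c) * d s c) = d s (y s)"
    using lin by (auto simp: eventually_at_filter ex elim: eventually_mono)
  from has_derivative_transform_eventually[OF * this] show ?thesis
    by (simp add: ex[OF t, symmetric] sum.distrib add.commute)
qed

text \<open>Along a line in the parameter space the second derivative is the Hessian on the velocity
  plus the differential on the acceleration. The full differential vanishes at the point, not merely
  its restriction to the image, so the curvature of \<open>F\<close> does not enter.\<close>

lemma second_order_local_max:
  fixes F :: "'e::real_normed_vector \<Rightarrow> 'b::euclidean_space"
  assumes j: "has_jet \<psi> W d b" and F: "\<forall>\<^sub>F z in nhds y. (F has_derivative F' z) (at z)"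
    and F'': "((\<lambda>z. F' z w) has_derivative F'') (at y)"
    and q: "F y \<in> W" and crit: "\<And>v. d (F y) v = 0"
    and max: "\<forall>\<^sub>F z in nhds y. \<psi> (F z) \<le> \<psi> (F y)"
  shows "b (F y) (F' y w) (F' y w) \<le> 0"
proof -
  note D = has_jetD[OF j]
  define l where "l t = y + t *\<^sub>R w" for t :: real
  have l: "(l has_derivative (\<lambda>s. s *\<^sub>R w)) (at t)" for t
    unfolding l_def[abs_def] by (auto intro!: derivative_eq_intros)
  have l0: "l 0 = y" by (simp add: l_def)
  have "(l \<longlongrightarrow> l 0) (nhds 0)"
    using has_derivative_continuous[OF l, of 0]
    unfolding isCont_def tendsto_at_iff_tendsto_nhds .
  then have cl: "(l \<longlongrightarrow> y) (nhds 0)" by (simp only: l0)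
  have Fy: "(F has_derivative F' y) (at y)" using eventually_nhds_x_imp_x[OF F] .
  have W: "\<forall>\<^sub>F z in nhds y. F z \<in> W"
  proof -
    have "(F \<longlongrightarrow> F y) (nhds y)"
      using has_derivative_continuous[OF Fy] by (simp add: isCont_def tendsto_at_iff_tendsto_nhds)
    then show ?thesis using topological_tendstoD D(3) q by metis
  qed
  have ev: "\<forall>\<^sub>F t in nhds 0. F (l t) \<in> W \<and> (F has_derivative F' (l t)) (at (l t)) \<and> \<psi> (F (l t)) \<le> \<psi> (F y)"
    using filterlim_iff[THEN iffD1, OF cl] eventually_conj[OF W eventually_conj[OF F max]] by blast
  define g where "g t = \<psi> (F (l t))" for t
  define g' where "g' t = d (F (l t)) (F' (l t) w)" for t
  have "(g has_real_derivative g' t) (at t)"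
    if "F (l t) \<in> W" "(F has_derivative F' (l t)) (at (l t))" for t
  proof -
    have "(g has_derivative (\<lambda>s. d (F (l t)) (F' (l t) (s *\<^sub>R w)))) (at t)"
      unfolding g_def[abs_def]
      by (rule has_derivative_compose[OF has_derivative_compose[OF l that(2)] D(1)[OF that(1)]])
    moreover have "d (F (l t)) (F' (l t) (s *\<^sub>R w)) = g' t * s" for s
      using linear_scale[OF has_derivative_linear[OF that(2)], of s w] linear_scale[OF D(4)[OF that(1)], of s]
      by (simp add: g'_def)
    ultimately show ?thesis by (simp add: has_field_derivative_def)
  qed
  then have g: "\<forall>\<^sub>F t in nhds 0. (g has_real_derivative g' t) (at t)"
    using ev by (auto elim: eventually_mono)
  have "(g' has_derivative (\<lambda>s. d (F (l 0)) (F'' (s *\<^sub>R w)) + (\<Sum>c\<in>Basis. (F' (l 0) w \<bullet> c) * b (F (l 0)) c (F' (l 0) (s *\<^sub>R w))))) (at 0)"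
    unfolding g'_def[abs_def]
  proof (rule has_derivative_apply_linear)
    show "((\<lambda>t. d (F (l t)) v) has_derivative (\<lambda>s. b (F (l 0)) v (F' (l 0) (s *\<^sub>R w)))) (at 0)" for v
      by (rule has_derivative_compose[OF has_derivative_compose[OF l] D(2)])
        (use Fy q in \<open>simp_all add: l0\<close>)
    show "((\<lambda>t. F' (l t) w) has_derivative (\<lambda>s. F'' (s *\<^sub>R w))) (at 0)"
      by (rule has_derivative_compose[OF l]) (use F'' in \<open>simp add: l0\<close>)
    show "\<forall>\<^sub>F s in nhds 0. linear (d (F (l s)))"
      using ev by eventually_elim (use D(4) in blast)
  qed
  moreover have "(\<Sum>c\<in>Basis. (F' y w \<bullet> c) * b (F y) c (F' y (s *\<^sub>R w))) = b (F y) (F' y w) (F' y w) * s" for s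
  proof -
    have lin: "linear (\<lambda>v. b (F y) v (F' y (s *\<^sub>R w)))" by (rule has_jet_linear_left[OF j q])
    have "(\<Sum>c\<in>Basis. (F' y w \<bullet> c) * b (F y) c (F' y (s *\<^sub>R w))) = b (F y) (F' y w) (F' y (s *\<^sub>R w))"
      using linear_sum[OF lin, of "\<lambda>c. (F' y w \<bullet> c) *\<^sub>R c" Basis]
      by (simp add: linear_scale[OF lin] euclidean_representation)
    then show ?thesis
      by (simp add: linear_scale[OF has_derivative_linear[OF Fy]] linear_scale[OF D(5)[OF q]])
  qed
  ultimately have "(g' has_real_derivative b (F y) (F' y w) (F' y w)) (at 0)"
    by (simp add: has_field_derivative_def l0 crit)
  then show ?thesis
  proof (rule second_derivative_local_max[OF g])
    show "g' 0 = 0" by (simp add: g'_def l0 crit)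
    show "\<forall>\<^sub>F t in nhds 0. g t \<le> g 0" using ev by eventually_elim (simp add: g_def l0)
  qed
qed

lemma has_jet_linear_comb:
  assumes "has_jet \<phi> W d b" "has_jet \<psi> V d' b'"
  shows "has_jet (\<lambda>q. c * \<phi> q + c' * \<psi> q) (W \<inter> V) (\<lambda>q v. c * d q v + c' * d' q v)
     (\<lambda>q v w. c * b q v w + c' * b' q v w)"
  using assms unfolding has_jet_def
  by (auto intro!: derivative_eq_intros continuous_intros) (blast intro: continuous_on_subset)+

text \<open>The expression is |p|^2 times the sum of \<open>b\<close> over the frame vectors
  projected along \<open>lift q p\<close> to the kernel of \<open>\<omega>\<close>.\<close>

lemma tangential_trace_nonneg:
  assumes ns: "hor_grad q \<omega> \<noteq> 0" and lin: "linear \<omega>"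
    and bl: "\<And>w. linear (\<lambda>v. b v w)" "\<And>v. linear (b v)"
    and psd: "\<And>\<tau>. \<omega> \<tau> = 0 \<Longrightarrow> b \<tau> \<tau> \<ge> 0"
  shows "(hor_grad q \<omega> \<bullet> hor_grad q \<omega>) * hor_trace q b - b (lift q (hor_grad q \<omega>)) (lift q (hor_grad q \<omega>)) \<ge> 0"
proof -
  define p where "p = hor_grad q \<omega>"
  define P where "P = lift q p"
  define E where "E I = lift q (axis I 1)" for I
  define \<tau> where "\<tau> I = E I - (p $ I / (p \<bullet> p)) *\<^sub>R P" for I
  have pp: "p \<bullet> p > 0" using ns by (simp add: p_def)
  have P: "\<omega> P = p \<bullet> p" unfolding P_def p_def hor_grad_inner[OF lin, symmetric] ..
  have E: "\<omega> (E I) = p $ I" for I by (simp add: E_def p_def hor_grad_def)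
  have "\<omega> (\<tau> I) = 0" for I
    using pp by (simp add: \<tau>_def linear_diff[OF lin] linear_scale[OF lin] P E)
  then have nonneg: "0 \<le> (\<Sum>I\<in>UNIV. b (\<tau> I) (\<tau> I))" by (intro sum_nonneg psd)
  have expand: "b (\<tau> I) (\<tau> I) = b (E I) (E I) - (p $ I * b (E I) P) / (p \<bullet> p) - (p $ I * b P (E I)) / (p \<bullet> p)
      + (p $ I * p $ I) * b P P / (p \<bullet> p)\<^sup>2" for I
    by (simp add: \<tau>_def linear_diff[OF bl(1)] linear_diff[OF bl(2)] linear_scale[OF bl(1)] linear_scale[OF bl(2)]
        power2_eq_square algebra_simps)
  have "(\<Sum>I\<in>UNIV. b (\<tau> I) (\<tau> I)) = hor_trace q b - (\<Sum>I\<in>UNIV. p $ I * b (E I) P) / (p \<bullet> p) - (\<Sum>I\<in>UNIV. p $ I * b P (E I)) / (p \<bullet> p)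
       + (\<Sum>I\<in>UNIV. p $ I * p $ I) * b P P / (p \<bullet> p)\<^sup>2"
    unfolding expand
    by (simp add: hor_trace_def E_def sum.distrib sum_subtractf sum_divide_distrib sum_distrib_right)
  also have "(\<Sum>I\<in>UNIV. p $ I * b (E I) P) = b P P"
    using hor_grad_inner[OF bl(1)[of P], of q p]
    by (simp add: hor_grad_def inner_vec_def E_def P_def[symmetric] mult.commute)
  also have "(\<Sum>I\<in>UNIV. p $ I * b P (E I)) = b P P"
    using hor_grad_inner[OF bl(2)[of P], of q p]
    by (simp add: hor_grad_def inner_vec_def E_def P_def[symmetric] mult.commute)
  also have "(\<Sum>I\<in>UNIV. p $ I * p $ I) = p \<bullet> p" by (simp add: inner_vec_def)
  also have "hor_trace q b - b P P / (p \<bullet> p) - b P P / (p \<bullet> p) + p \<bullet> p * b P P / (p \<bullet> p)\<^sup>2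
      = (p \<bullet> p * hor_trace q b - b P P) / (p \<bullet> p)"
    using pp by (simp add: power2_eq_square field_simps)
  finally have "0 \<le> (p \<bullet> p * hor_trace q b - b P P) / (p \<bullet> p)" using nonneg by simp
  then have "0 \<le> p \<bullet> p * hor_trace q b - b P P"
    using pp by (metis not_le zero_le_divide_iff)
  then show ?thesis by (simp add: p_def P_def)
qed

text \<open>Degenerate ellipticity: for fixed gradient, \<open>mean_op\<close> sees the Hessian only
  through its trace over horizontal vectors annihilated by \<open>\<omega>\<close>. All terms are
  homogeneous of degree three, so the difference equals \<open>l\<^sup>2\<close> times that trace
  for the form \<open>b' - l * b\<close>.\<close>

lemma mean_op_mono:
  assumes l: "l > 0" and lin: "linear \<omega>" and ns: "hor_grad q \<omega> \<noteq> 0"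
    and bl: "\<And>w. linear (\<lambda>v. b v w)" "\<And>v. linear (b v)"
    and bl': "\<And>w. linear (\<lambda>v. b' v w)" "\<And>v. linear (b' v)"
    and le: "\<And>\<tau>. \<omega> \<tau> = 0 \<Longrightarrow> b' \<tau> \<tau> \<ge> l * b \<tau> \<tau>"
  shows "mean_op q (\<lambda>v. l * \<omega> v) b' \<ge> l ^ 3 * mean_op q \<omega> b"
proof -
  define p where "p = hor_grad q \<omega>"
  define c where "c v w = b' v w - l * b v w" for v w
  have p: "hor_grad q (\<lambda>v. l * \<omega> v) = l *\<^sub>R p" by (simp add: hor_grad_def vec_eq_iff p_def)
  have "0 \<le> (p \<bullet> p) * hor_trace q c - c (lift q p) (lift q p)"
    unfolding p_def
  proof (rule tangential_trace_nonneg[OF ns lin])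
    show "linear (\<lambda>v. c v w)" for w
      unfolding c_def using linear_compose_sub[OF bl'(1)[of w] linear_compose_scale_right[OF bl(1)[of w], of l]] by simp
    show "linear (c v)" for v
      using linear_compose_sub[OF bl'(2)[of v] linear_compose_scale_right[OF bl(2)[of v], of l]]
      by (simp add: c_def[abs_def])
  qed (use le in \<open>simp add: c_def\<close>)
  moreover have "mean_op q (\<lambda>v. l * \<omega> v) b' - l ^ 3 * mean_op q \<omega> b
     = l\<^sup>2 * ((p \<bullet> p) * hor_trace q c - c (lift q p) (lift q p))"
    by (simp add: mean_op_def Let_def p p_def[symmetric] linear_scale[OF linear_lift] linear_scale[OF bl'(1)]
        linear_scale[OF bl'(2)] c_def hor_trace_def sum_subtractf sum_distrib_left[symmetric]
        power2_eq_square power3_eq_cube algebra_simps)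
  ultimately show ?thesis by (smt (verit) zero_le_mult_iff zero_le_power2)
qed

section \<open>Twice continuously differentiable functions\<close>

definition D1 :: "('a::real_normed_vector \<Rightarrow> real) \<Rightarrow> 'a \<Rightarrow> 'a \<Rightarrow> real" where
  "D1 f q = frechet_derivative f (at q)"

definition D2 :: "('a::real_normed_vector \<Rightarrow> real) \<Rightarrow> 'a \<Rightarrow> 'a \<Rightarrow> 'a \<Rightarrow> real" where
  "D2 f q v = frechet_derivative (\<lambda>q'. D1 f q' v) (at q)"

text \<open>Canonical derivatives let operators such as \<open>tan_lap\<close> take just a function
  as argument; explicit derivatives are fed in through \<open>has_jet_D1\<close> and
  \<open>has_jet_D2\<close>.\<close>

definition C2 :: "('a::real_normed_vector \<Rightarrow> real) \<Rightarrow> 'a set \<Rightarrow> bool" where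
  "C2 f W \<longleftrightarrow> has_jet f W (D1 f) (D2 f)"

lemma has_jet_D1: "has_jet f W d b \<Longrightarrow> q \<in> W \<Longrightarrow> D1 f q = d q"
  by (auto simp: D1_def has_jet_def frechet_derivative_at[symmetric])

lemma has_jet_D2:
  assumes j: "has_jet f W d b" and q: "q \<in> W"
  shows "D2 f q = b q"
proof
  fix v
  have "((\<lambda>q. D1 f q v) has_derivative b q v) (at q)"
    by (rule has_derivative_transform_within_open[OF has_jetD(2)[OF j q, of v] has_jetD(3)[OF j q] q])
      (simp add: has_jet_D1[OF j])
  then show "D2 f q v = b q v" by (simp add: D2_def frechet_derivative_at[symmetric])
qed

lemma has_jet_C2:
  assumes j: "has_jet f W d b"
  shows "C2 f W"
proof -
  have "((\<lambda>q. D1 f q v) has_derivative b q v) (at q)" if q: "q \<in> W" for q v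
    by (rule has_derivative_transform_within_open[OF has_jetD(2)[OF j q, of v] has_jetD(3)[OF j q] q])
      (simp add: has_jet_D1[OF j])
  moreover have "continuous_on W (\<lambda>q. D2 f q v w)" for v w
    using j by (subst continuous_on_cong[OF refl, of W _ "\<lambda>q. b q v w"]) (auto simp: has_jet_D2[OF j] has_jet_def)
  ultimately show ?thesis
    using j unfolding C2_def has_jet_def[of f W "D1 f"]
    by (auto simp: has_jet_D1[OF j] has_jet_D2[OF j] has_jet_def)
qed

lemma C2_jet: "C2 f W \<Longrightarrow> has_jet f W (D1 f) (D2 f)"
  by (simp add: C2_def)

lemmas C2D = has_jetD[OF C2_jet]

lemma C2_D1_continuous: "C2 f W \<Longrightarrow> continuous_on W (\<lambda>q. D1 f q v)"
  by (rule continuous_at_imp_continuous_on) (auto intro: has_derivative_continuous C2D(2))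

lemma C2_D2_continuous: "C2 f W \<Longrightarrow> continuous_on W (\<lambda>q. D2 f q v w)"
  by (simp add: C2_def has_jet_def)

lemma C2_continuous: "C2 f W \<Longrightarrow> continuous_on W f"
  by (rule continuous_at_imp_continuous_on) (auto intro: has_derivative_continuous C2D(1))

lemma C2_subset: "C2 f W \<Longrightarrow> open V \<Longrightarrow> V \<subseteq> W \<Longrightarrow> C2 f V"
  unfolding C2_def has_jet_def by (auto intro: continuous_on_subset[of W])

lemma jet_const: "open W \<Longrightarrow> has_jet (\<lambda>q. c) W (\<lambda>q v. 0) (\<lambda>q v w. 0)"
  by (simp add: has_jet_def)

lemma jet_linear:
  "bounded_linear l \<Longrightarrow> open W \<Longrightarrow> has_jet l W (\<lambda>q. l) (\<lambda>q v w. 0)"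
  by (simp add: has_jet_def bounded_linear_imp_has_derivative)

lemma jet_add:
  "C2 f W \<Longrightarrow> C2 g W \<Longrightarrow> has_jet (\<lambda>q. f q + g q) W (\<lambda>q v. D1 f q v + D1 g q v)
     (\<lambda>q v w. D2 f q v w + D2 g q v w)"
  unfolding C2_def has_jet_def by (auto intro!: derivative_eq_intros continuous_intros)

lemma jet_mult:
  assumes f: "C2 f W" and g: "C2 g W"
  shows "has_jet (\<lambda>q. f q * g q) W (\<lambda>q v. f q * D1 g q v + g q * D1 f q v)
     (\<lambda>q v w. f q * D2 g q v w + g q * D2 f q v w + (D1 f q w * D1 g q v + D1 f q v * D1 g q w))"
  using f g C2_continuous[OF f] C2_continuous[OF g] C2_D1_continuous[OF f] C2_D1_continuous[OF g]
  unfolding C2_def has_jet_def by (auto intro!: derivative_eq_intros continuous_intros simp: fun_eq_iff algebra_simps)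

lemma jet_compose:
  assumes f: "C2 f W"
    and h: "\<And>q. q \<in> W \<Longrightarrow> (h has_real_derivative h' (f q)) (at (f q))"
    and h': "\<And>q. q \<in> W \<Longrightarrow> (h' has_real_derivative h'' (f q)) (at (f q))"
    and h'': "continuous_on (f ` W) h''"
  shows "has_jet (\<lambda>q. h (f q)) W (\<lambda>q v. h' (f q) * D1 f q v)
     (\<lambda>q v w. h' (f q) * D2 f q v w + h'' (f q) * (D1 f q v * D1 f q w))"
proof -
  note F = C2D[OF f] C2_continuous[OF f] C2_D1_continuous[OF f]
  have c': "continuous_on (f ` W) h'"
    using h' by (intro continuous_at_imp_continuous_on) (auto intro: DERIV_isCont)
  have "((\<lambda>q. h' (f q) * D1 f q v) has_derivative (\<lambda>w. h' (f q) * D2 f q v w + h'' (f q) * (D1 f q v * D1 f q w))) (at q)"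
    if q: "q \<in> W" for q v
    using has_derivative_mult[OF has_derivative_compose[OF F(1)[OF q] h'[OF q, unfolded has_field_derivative_def]] F(2)[OF q, of v]]
    by (simp add: algebra_simps)
  moreover have "((\<lambda>q. h (f q)) has_derivative (\<lambda>v. h' (f q) * D1 f q v)) (at q)" if q: "q \<in> W" for q
    using has_derivative_compose[OF F(1)[OF q] h[OF q, unfolded has_field_derivative_def]] by simp
  moreover have "continuous_on W (\<lambda>q. h' (f q) * D2 f q v w + h'' (f q) * (D1 f q v * D1 f q w))" for v w
    using C2_D2_continuous[OF f]
    by (intro continuous_intros F continuous_on_compose2[OF c' F(6)] continuous_on_compose2[OF h'' F(6)]) auto
  ultimately show ?thesis
    using f unfolding has_jet_def C2_def by auto
qed

section \<open>Tangential operators of the Heisenberg spheres\<close>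

text \<open>
  The horizontal gradient of \<open>rho4\<close> is \<open>4 Pt\<close>, and \<open>\<bar>Pt\<bar>\<^sup>2 = \<bar>x\<bar>\<^sup>2 rho4\<close>. So \<open>tan_inner\<close> is the inner product of
  the horizontal gradients tangential to the Heisenberg spheres, and \<open>16 \<bar>x\<bar>\<^sup>2 rho4 tan_lap\<close> is the
  linearization of \<open>mean_op\<close> at \<open>rho4\<close>. Both are junk on the axis \<open>x = 0\<close>.
\<close>

definition tan_inner :: "'n::finite heis \<Rightarrow> ('n heis \<Rightarrow> real) \<Rightarrow> ('n heis \<Rightarrow> real) \<Rightarrow> real" where
  "tan_inner q f g = hor_grad q (D1 f q) \<bullet> hor_grad q (D1 g q)
     - D1 f q (lift q (Pt q)) * D1 g q (lift q (Pt q)) / ((fst q \<bullet> fst q) * rho4 q)"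

definition tan_lap :: "'n::finite heis \<Rightarrow> ('n heis \<Rightarrow> real) \<Rightarrow> real" where
  "tan_lap q f = hor_trace q (D2 f q) - D2 f q (lift q (Pt q)) (lift q (Pt q)) / ((fst q \<bullet> fst q) * rho4 q)
     - (2 * real CARD('n) + 1) * D1 f q (lift q (Pt q)) / rho4 q"

lemma hor_grad_comb: "hor_grad q (\<lambda>v. a * f v + b * g v) = a *\<^sub>R hor_grad q f + b *\<^sub>R hor_grad q g"
  by (simp add: hor_grad_def vec_eq_iff)

lemma hor_grad_cmult: "hor_grad q (\<lambda>v. a * f v) = a *\<^sub>R hor_grad q f"
  by (simp add: hor_grad_def vec_eq_iff)

lemma hor_trace_comb: "hor_trace q (\<lambda>v w. a * f v w + b * g v w) = a * hor_trace q f + b * hor_trace q g"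
  by (simp add: hor_trace_def sum.distrib sum_distrib_left)

lemma hor_trace_cmult: "hor_trace q (\<lambda>v w. a * f v w) = a * hor_trace q f"
  by (simp add: hor_trace_def sum_distrib_left)

lemma hor_trace_add: "hor_trace q (\<lambda>v w. f v w + g v w) = hor_trace q f + hor_trace q g"
  by (simp add: hor_trace_def sum.distrib)

lemma hor_trace_tensor: "hor_trace q (\<lambda>v w. f v * g w) = hor_grad q f \<bullet> hor_grad q g"
  by (simp add: hor_trace_def hor_grad_def inner_vec_def)

lemma tan_inner_commute: "tan_inner q f g = tan_inner q g f"
  by (simp add: tan_inner_def inner_commute mult.commute)

lemma tan_inner_mult:
  assumes "C2 f W" "C2 g W" "q \<in> W"
  shows "tan_inner q (\<lambda>q. f q * g q) h = f q * tan_inner q g h + g q * tan_inner q f h"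
  by (simp add: tan_inner_def has_jet_D1[OF jet_mult[OF assms(1,2)] assms(3)] hor_grad_comb inner_add_left
      add_divide_distrib algebra_simps)

lemma tan_inner_add:
  assumes "C2 f W" "C2 g W" "q \<in> W"
  shows "tan_inner q (\<lambda>q. f q + g q) h = tan_inner q f h + tan_inner q g h"
  using hor_grad_comb[of q 1 "D1 f q" 1 "D1 g q"]
  by (simp add: tan_inner_def has_jet_D1[OF jet_add[OF assms(1,2)] assms(3)] inner_add_left
      add_divide_distrib algebra_simps)

lemma tan_inner_const: "tan_inner q (\<lambda>q. c) h = 0"
  using has_jet_D1[OF jet_const[of UNIV c], of q] by (simp add: tan_inner_def hor_grad_def vec_eq_iff inner_vec_def)

lemma tan_inner_compose:
  assumes "has_jet (\<lambda>q. h (f q)) W (\<lambda>q v. h' (f q) * D1 f q v) b" "q \<in> W"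
  shows "tan_inner q (\<lambda>q. h (f q)) g = h' (f q) * tan_inner q f g"
  by (simp add: tan_inner_def has_jet_D1[OF assms] hor_grad_cmult algebra_simps)

text \<open>\<open>tan_lap\<close> is of second order without zeroth order term, and the bilinear
  form attached to its principal part is \<open>tan_inner\<close>. The calculus of products and
  compositions follows from these two facts, so explicit values are computed only on z, |x|^2 and
  linear functions.\<close>

lemma tan_lap_mult:
  assumes "C2 f W" "C2 g W" "q \<in> W"
  shows "tan_lap q (\<lambda>q. f q * g q) = f q * tan_lap q g + g q * tan_lap q f + 2 * tan_inner q f g"
  unfolding tan_lap_def tan_inner_def has_jet_D1[OF jet_mult[OF assms(1,2)] assms(3)] has_jet_D2[OF jet_mult[OF assms(1,2)] assms(3)]
    hor_trace_add hor_trace_cmult hor_trace_tensor hor_trace_tensor[of q "D1 g q" "D1 f q", unfolded mult.commute[of "D1 g q _"]]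
  by (simp add: inner_commute add_divide_distrib algebra_simps)

lemma tan_lap_add:
  assumes "C2 f W" "C2 g W" "q \<in> W"
  shows "tan_lap q (\<lambda>q. f q + g q) = tan_lap q f + tan_lap q g"
  by (simp add: tan_lap_def has_jet_D1[OF jet_add[OF assms(1,2)] assms(3)] has_jet_D2[OF jet_add[OF assms(1,2)] assms(3)]
      hor_trace_add add_divide_distrib algebra_simps)

lemma tan_lap_const: "tan_lap q (\<lambda>q. c) = 0"
  by (simp add: tan_lap_def has_jet_D1[OF jet_const[of UNIV c]] has_jet_D2[OF jet_const[of UNIV c]] hor_trace_def)

lemma tan_lap_compose:
  assumes "has_jet (\<lambda>q. h (f q)) W (\<lambda>q v. h' (f q) * D1 f q v)
     (\<lambda>q v w. h' (f q) * D2 f q v w + h'' (f q) * (D1 f q v * D1 f q w))" "q \<in> W"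
  shows "tan_lap q (\<lambda>q. h (f q)) = h' (f q) * tan_lap q f + h'' (f q) * tan_inner q f f"
  by (simp add: tan_lap_def tan_inner_def has_jet_D1[OF assms] has_jet_D2[OF assms]
      hor_trace_add hor_trace_cmult hor_trace_tensor add_divide_distrib algebra_simps)

section \<open>Tangential operators on |x|^2, z and linear functions\<close>

definition xsq :: "'n::finite heis \<Rightarrow> real" where
  "xsq q = fst q \<bullet> fst q"

abbreviation nonaxis :: "'n::finite heis set" where
  "nonaxis \<equiv> {q. fst q \<noteq> 0}"

lemma open_nonaxis: "open nonaxis"
  by (simp add: open_Collect_neq continuous_on_fst)

lemma xsq_pos: "q \<in> nonaxis \<Longrightarrow> xsq q > 0"
  by (simp add: xsq_def)

lemma rho4_nonaxis: "q \<in> nonaxis \<Longrightarrow> rho4 q > 0"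
  by (rule rho4_pos) auto

lemma rho4_xsq: "rho4 q = (xsq q)\<^sup>2 + 4 * (snd q)\<^sup>2"
  by (simp add: rho4_def xsq_def)

lemma Pt_inner_x: "fst q \<bullet> Pt q = (xsq q)\<^sup>2"
  by (simp add: Pt_def xsq_def inner_add_right power2_eq_square)

lemma Pt_inner_Jp: "Jp (fst q) \<bullet> Pt q = 2 * snd q * xsq q"
  by (simp add: Pt_def xsq_def inner_add_right inner_commute)

lemma Pt_inner_Pt: "Pt q \<bullet> Pt q = xsq q * rho4 q"
  by (simp add: Pt_def inner_add_left inner_add_right xsq_def[symmetric] rho4_xsq inner_commute power2_eq_square algebra_simps)

lemma jet_xsq: "has_jet xsq UNIV (\<lambda>q v. 2 * (fst q \<bullet> fst v)) (\<lambda>q v w. 2 * (fst v \<bullet> fst w))"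
  unfolding has_jet_def xsq_def
  by (auto intro!: derivative_eq_intros continuous_intros simp: inner_commute fun_eq_iff)

lemma C2_xsq: "C2 xsq UNIV"
  by (rule has_jet_C2[OF jet_xsq])

lemma bounded_linear_inner_fst: "bounded_linear (\<lambda>q. a \<bullet> fst q)"
  by (intro bounded_linear_compose[OF bounded_linear_inner_right] bounded_linear_fst)

lemmas jet_inner = jet_linear[OF bounded_linear_inner_fst open_UNIV]
lemmas jet_snd = jet_linear[OF bounded_linear_snd open_UNIV]
lemmas C2_inner = has_jet_C2[OF jet_inner]
lemmas C2_snd = has_jet_C2[OF jet_snd]

lemma hor_grad_inner_fst: "hor_grad q (\<lambda>v. a \<bullet> fst v) = a"
  by (simp add: hor_grad_def vec_eq_iff lift_def inner_axis)

lemma hor_grad_snd: "hor_grad q snd = Jp (fst q)"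
  by (simp add: hor_grad_def vec_eq_iff lift_def inner_axis')

lemma hor_trace_zero: "hor_trace q (\<lambda>v w. 0) = 0"
  by (simp add: hor_trace_def)

lemma tan_inner_inner_inner: "tan_inner q (\<lambda>q. a \<bullet> fst q) (\<lambda>q. b \<bullet> fst q) = a \<bullet> b - (a \<bullet> Pt q) * (b \<bullet> Pt q) / (xsq q * rho4 q)"
  by (simp add: tan_inner_def has_jet_D1[OF jet_inner] hor_grad_inner_fst xsq_def) (simp add: lift_def)

lemma tan_inner_inner_snd: "q \<in> nonaxis \<Longrightarrow> tan_inner q (\<lambda>q. a \<bullet> fst q) snd = a \<bullet> Jp (fst q) - 2 * snd q * (a \<bullet> Pt q) / rho4 q"
  using rho4_nonaxis[of q] xsq_pos[of q]
  by (simp add: tan_inner_def has_jet_D1[OF jet_inner] has_jet_D1[OF jet_snd] hor_grad_inner_fst hor_grad_snd xsq_def[symmetric])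
    (auto simp: lift_def inner_commute[of "Pt q" "Jp _"] Pt_inner_Jp field_simps)

lemma tan_inner_inner_xsq: "q \<in> nonaxis \<Longrightarrow> tan_inner q (\<lambda>q. a \<bullet> fst q) xsq = 2 * (a \<bullet> fst q) - 2 * xsq q * (a \<bullet> Pt q) / rho4 q"
  using hor_grad_cmult[of q 2 "\<lambda>v. fst q \<bullet> fst v"] rho4_nonaxis[of q] xsq_pos[of q]
  by (simp add: tan_inner_def has_jet_D1[OF jet_inner] has_jet_D1[OF jet_xsq] hor_grad_inner_fst xsq_def[symmetric])
    (auto simp: lift_def Pt_inner_x power2_eq_square field_simps)

lemma tan_inner_snd_snd: "q \<in> nonaxis \<Longrightarrow> tan_inner q snd snd = xsq q ^ 3 / rho4 q"
  using rho4_nonaxis[of q] xsq_pos[of q]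
  by (simp add: tan_inner_def has_jet_D1[OF jet_snd] hor_grad_snd xsq_def[symmetric])
    (simp add: lift_def inner_commute[of "Pt q" "Jp _"] Pt_inner_Jp field_simps power2_eq_square power3_eq_cube,
      simp add: rho4_xsq power2_eq_square power3_eq_cube algebra_simps)

lemma tan_inner_snd_xsq: "q \<in> nonaxis \<Longrightarrow> tan_inner q snd xsq = - 4 * snd q * (xsq q)\<^sup>2 / rho4 q"
  using hor_grad_cmult[of q 2 "\<lambda>v. fst q \<bullet> fst v"] rho4_nonaxis[of q] xsq_pos[of q]
  by (simp add: tan_inner_def has_jet_D1[OF jet_snd] has_jet_D1[OF jet_xsq] hor_grad_snd hor_grad_inner_fst xsq_def[symmetric])
    (auto simp: lift_def inner_commute[of "Pt q" "Jp _"] Pt_inner_Jp Pt_inner_x power2_eq_square field_simps)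

lemma tan_inner_xsq_xsq: "q \<in> nonaxis \<Longrightarrow> tan_inner q xsq xsq = 16 * (snd q)\<^sup>2 * xsq q / rho4 q"
  using hor_grad_cmult[of q 2 "\<lambda>v. fst q \<bullet> fst v"] rho4_nonaxis[of q] xsq_pos[of q]
  by (simp add: tan_inner_def has_jet_D1[OF jet_xsq] hor_grad_inner_fst xsq_def[symmetric])
    (simp add: lift_def Pt_inner_x power2_eq_square field_simps,
      simp add: rho4_xsq power2_eq_square power3_eq_cube algebra_simps)

lemma tan_lap_inner: "tan_lap q (\<lambda>q. a \<bullet> fst q) = - ((2 * real CARD('n) + 1) * (a \<bullet> Pt q) / rho4 q)" for q :: "'n::finite heis"
  by (simp add: tan_lap_def has_jet_D1[OF jet_inner] has_jet_D2[OF jet_inner] hor_trace_zero) (simp add: lift_def)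

lemma tan_lap_snd: "tan_lap q snd = - ((2 * real CARD('n) + 1) * (2 * snd q * xsq q) / rho4 q)" for q :: "'n::finite heis"
  by (simp add: tan_lap_def has_jet_D1[OF jet_snd] has_jet_D2[OF jet_snd] hor_trace_zero)
    (simp add: lift_def inner_commute[of "Pt q" "Jp _"] Pt_inner_Jp)

lemma tan_lap_xsq: "q \<in> nonaxis \<Longrightarrow> tan_lap q xsq = 4 * real CARD('n) - 2 - (2 * real CARD('n) + 1) * (2 * (xsq q)\<^sup>2) / rho4 q"
  for q :: "'n::finite heis"
  using rho4_nonaxis[of q] xsq_pos[of q]
  by (simp add: tan_lap_def has_jet_D1[OF jet_xsq] has_jet_D2[OF jet_xsq] hor_trace_def lift_def Pt_inner_Pt Pt_inner_x inner_axis_axis)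
    (simp add: xsq_def)

definition inv_xsq :: "'n::finite heis \<Rightarrow> real" where
  "inv_xsq q = inverse (xsq q)"

lemma jet_inv_xsq: "has_jet inv_xsq nonaxis (\<lambda>q v. - (inverse (xsq q))\<^sup>2 * D1 xsq q v)
  (\<lambda>q v w. - (inverse (xsq q))\<^sup>2 * D2 xsq q v w + 2 * (inverse (xsq q)) ^ 3 * (D1 xsq q v * D1 xsq q w))"
  unfolding inv_xsq_def[abs_def]
proof (rule jet_compose)
  show "C2 xsq nonaxis" by (rule C2_subset[OF C2_xsq open_nonaxis]) simp
  fix q :: "'a heis" assume "q \<in> nonaxis"
  from xsq_pos[OF this]
  show "(inverse has_real_derivative - (inverse (xsq q))\<^sup>2) (at (xsq q))"
    "((\<lambda>s. - (inverse s)\<^sup>2) has_real_derivative 2 * (inverse (xsq q)) ^ 3) (at (xsq q))"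
    by (auto intro!: derivative_eq_intros simp: power2_eq_square power3_eq_cube field_simps)
qed (auto intro!: continuous_intros simp: xsq_def)

lemmas C2_inv_xsq = has_jet_C2[OF jet_inv_xsq]

lemma tan_inner_inv_xsq: "q \<in> nonaxis \<Longrightarrow> tan_inner q inv_xsq g = - tan_inner q xsq g / (xsq q)\<^sup>2"
  using tan_inner_compose[of inverse xsq, OF jet_inv_xsq[unfolded inv_xsq_def[abs_def]]]
  by (simp add: inv_xsq_def[abs_def] power_inverse field_simps)

lemma tan_lap_inv_xsq: "q \<in> nonaxis \<Longrightarrow> tan_lap q inv_xsq = - tan_lap q xsq / (xsq q)\<^sup>2 + 2 * tan_inner q xsq xsq / (xsq q) ^ 3"
  using tan_lap_compose[of inverse xsq, OF jet_inv_xsq[unfolded inv_xsq_def[abs_def]]]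
  by (simp add: inv_xsq_def[abs_def] power_inverse field_simps)

text \<open>Twice this function is the tangent of the argument of |x|^2 + 2 i z, a complex number of
  modulus rho^2. It is invariant under the Heisenberg dilations.\<close>

definition slope :: "'n::finite heis \<Rightarrow> real" where
  "slope q = snd q * inv_xsq q"

lemma C2_nonaxis: "C2 f UNIV \<Longrightarrow> C2 f nonaxis"
  by (rule C2_subset[OF _ open_nonaxis]) auto

lemma C2_mult: "C2 f W \<Longrightarrow> C2 g W \<Longrightarrow> C2 (\<lambda>q. f q * g q) W"
  by (rule has_jet_C2[OF jet_mult])

lemma C2_add: "C2 f W \<Longrightarrow> C2 g W \<Longrightarrow> C2 (\<lambda>q. f q + g q) W"
  by (rule has_jet_C2[OF jet_add])

lemma C2_const: "open W \<Longrightarrow> C2 (\<lambda>q. c) W"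
  by (rule has_jet_C2[OF jet_const])

lemma C2_slope: "C2 slope nonaxis"
  unfolding slope_def[abs_def] by (intro C2_mult C2_nonaxis[OF C2_snd] C2_inv_xsq)

lemma tan_inner_slope:
  assumes "q \<in> nonaxis"
  shows "tan_inner q slope g = tan_inner q snd g / xsq q - snd q * tan_inner q xsq g / (xsq q)\<^sup>2"
  unfolding slope_def[abs_def] tan_inner_mult[OF C2_nonaxis[OF C2_snd] C2_inv_xsq assms]
  using xsq_pos[OF assms] by (simp add: tan_inner_inv_xsq[OF assms] inv_xsq_def field_simps)

lemma tan_inner_slope_snd: "q \<in> nonaxis \<Longrightarrow> tan_inner q slope snd = 1"
  using xsq_pos[of q] rho4_nonaxis[of q]
  by (simp add: tan_inner_slope tan_inner_snd_snd tan_inner_commute[of q xsq snd] tan_inner_snd_xsq power2_eq_square power3_eq_cube field_simps)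
    (simp add: rho4_xsq power2_eq_square power3_eq_cube algebra_simps)

lemma tan_inner_slope_xsq: "q \<in> nonaxis \<Longrightarrow> tan_inner q slope xsq = - 4 * slope q"
  using xsq_pos[of q] rho4_nonaxis[of q]
  by (auto simp: tan_inner_slope tan_inner_xsq_xsq tan_inner_snd_xsq slope_def inv_xsq_def power2_eq_square field_simps)
    (auto simp: rho4_xsq power2_eq_square field_simps)

lemma tan_inner_slope_slope: "q \<in> nonaxis \<Longrightarrow> tan_inner q slope slope = rho4 q / (xsq q) ^ 3"
  using xsq_pos[of q] rho4_nonaxis[of q]
  by (simp add: tan_inner_slope[of _ slope] tan_inner_commute[of q snd slope] tan_inner_slope_snd tan_inner_commute[of q xsq slope] tan_inner_slope_xsq
    slope_def inv_xsq_def power2_eq_square power3_eq_cube rho4_xsq field_simps)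

lemma tan_lap_slope:
  fixes q :: "'n::finite heis"
  assumes q: "q \<in> nonaxis"
  shows "tan_lap q slope = (10 - 4 * real CARD('n)) * slope q / xsq q"
proof -
  have "tan_lap q slope = snd q * tan_lap q inv_xsq + inv_xsq q * tan_lap q snd + 2 * tan_inner q snd inv_xsq"
    unfolding slope_def[abs_def] by (rule tan_lap_mult[OF C2_nonaxis[OF C2_snd] C2_inv_xsq q])
  also have "\<dots> = (10 - 4 * real CARD('n)) * slope q / xsq q"
    using xsq_pos[OF q] rho4_nonaxis[of q] q
    by (simp add: tan_lap_inv_xsq tan_lap_xsq tan_lap_snd tan_inner_xsq_xsq tan_inner_commute[of q snd inv_xsq] tan_inner_inv_xsq tan_inner_commute[of q xsq snd]
        tan_inner_snd_xsq slope_def inv_xsq_def power2_eq_square power3_eq_cube field_simps)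
      (auto simp: rho4_xsq power2_eq_square algebra_simps)
  finally show ?thesis .
qed

definition re :: "real ^ ('n::finite + 'n) \<Rightarrow> 'n heis \<Rightarrow> real" where
  "re e q = e \<bullet> fst q"

abbreviation im :: "real ^ ('n::finite + 'n) \<Rightarrow> 'n heis \<Rightarrow> real" where
  "im e \<equiv> re (- Jp e)"

text \<open>Replacing \<open>e\<close> by \<open>- Jp e\<close> turns the pair (re, im) into (im, -
  re), so a formula proved for \<open>re\<close> also covers \<open>im\<close>.\<close>

lemma re_Jp_im: "re (- Jp (- Jp e)) q = - re e q"
  by (simp add: re_def linear_neg[OF linear_Jp])

lemma C2_re: "C2 (re e) nonaxis"
  unfolding re_def[abs_def] by (rule C2_nonaxis[OF C2_inner])

lemma inner_Jp_im: "e \<bullet> Jp (fst q) = im e q"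
  using Jp_skew[of e "fst q"] by (simp add: re_def)

lemma inner_Pt: "e \<bullet> Pt q = xsq q * re e q + 2 * snd q * im e q"
  by (simp add: Pt_def inner_add_right xsq_def inner_Jp_im) (simp add: re_def)

lemma tan_inner_re_re: "tan_inner q (re a) (re b) = a \<bullet> b - (a \<bullet> Pt q) * (b \<bullet> Pt q) / (xsq q * rho4 q)"
  unfolding re_def[abs_def] by (rule tan_inner_inner_inner)

lemma tan_inner_snd_re: "q \<in> nonaxis \<Longrightarrow> tan_inner q snd (re e) = im e q - 2 * snd q * (e \<bullet> Pt q) / rho4 q"
  using tan_inner_inner_snd[of q e] unfolding tan_inner_commute[of q snd] inner_Jp_im by (simp add: re_def[abs_def])

lemma tan_inner_xsq_re: "q \<in> nonaxis \<Longrightarrow> tan_inner q xsq (re e) = 2 * re e q - 2 * xsq q * (e \<bullet> Pt q) / rho4 q"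
  using tan_inner_inner_xsq[of q e] unfolding tan_inner_commute[of q xsq] by (simp add: re_def[abs_def])

lemma tan_inner_slope_re:
  "q \<in> nonaxis \<Longrightarrow> tan_inner q slope (re e) = im e q / xsq q - 2 * snd q * re e q / (xsq q)\<^sup>2"
  using xsq_pos[of q] rho4_nonaxis[of q]
  by (simp add: tan_inner_slope tan_inner_snd_re tan_inner_xsq_re power2_eq_square field_simps)

lemma tan_lap_re: "tan_lap q (re e) = - ((2 * real CARD('n) + 1) * (e \<bullet> Pt q) / rho4 q)" for q :: "'n::finite heis"
  unfolding re_def[abs_def] by (rule tan_lap_inner)

text \<open>
  With the complex function \<open>w = re e + i im e\<close>, \<open>J1 + 2 i J2 = w\<^sup>2\<close> and \<open>T1 + i T2 = w\<^sup>2 (1 + 2 i z / \<bar>x\<bar>\<^sup>2)\<close>. The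
  factor is chosen such that \<open>T1\<close> and \<open>T2\<close> become \<open>tan_inner\<close>-orthogonal to \<open>z\<close> and to each other.
  Differences are written as sums because the calculus rules are stated for sums and products.
\<close>

definition J1 :: "real ^ ('n::finite + 'n) \<Rightarrow> 'n heis \<Rightarrow> real" where
  "J1 e q = re e q * re e q + (-1) * (im e q * im e q)"

definition J2 :: "real ^ ('n::finite + 'n) \<Rightarrow> 'n heis \<Rightarrow> real" where
  "J2 e q = re e q * im e q"

definition T1 :: "real ^ ('n::finite + 'n) \<Rightarrow> 'n heis \<Rightarrow> real" where
  "T1 e q = J1 e q + (-4) * (slope q * J2 e q)"

definition T2 :: "real ^ ('n::finite + 'n) \<Rightarrow> 'n heis \<Rightarrow> real" where
  "T2 e q = 2 * J2 e q + 2 * (slope q * J1 e q)"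

lemmas C2_rules = C2_mult C2_add C2_const[OF open_nonaxis] C2_re C2_slope C2_nonaxis[OF C2_snd]

lemma C2_J1: "C2 (J1 e) nonaxis" and C2_J2: "C2 (J2 e) nonaxis"
  unfolding J1_def[abs_def] J2_def[abs_def] by (intro C2_rules)+

lemma C2_T1: "C2 (T1 e) nonaxis" and C2_T2: "C2 (T2 e) nonaxis"
  unfolding T1_def[abs_def] T2_def[abs_def] by (intro C2_rules C2_J1 C2_J2)+

context
  fixes q :: "'n::finite heis"
  assumes q: "q \<in> nonaxis"
begin

lemma tan_inner_J1: "tan_inner q (J1 e) h = 2 * re e q * tan_inner q (re e) h - 2 * im e q * tan_inner q (im e) h"
  unfolding J1_def[abs_def]
  by (subst tan_inner_add[OF _ _ q], (intro C2_rules)+,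
      subst tan_inner_mult[OF _ _ q], (intro C2_rules)+, subst tan_inner_mult[OF _ _ q], (intro C2_rules)+,
      subst tan_inner_mult[OF _ _ q], (intro C2_rules)+) (simp add: tan_inner_const)

lemma tan_inner_J2: "tan_inner q (J2 e) h = re e q * tan_inner q (im e) h + im e q * tan_inner q (re e) h"
  unfolding J2_def[abs_def] by (rule tan_inner_mult[OF _ _ q]) (intro C2_rules)+

lemma tan_inner_T1: "tan_inner q (T1 e) h = tan_inner q (J1 e) h - 4 * slope q * tan_inner q (J2 e) h - 4 * J2 e q * tan_inner q slope h"
  unfolding T1_def[abs_def]
  by (subst tan_inner_add[OF _ _ q], (intro C2_rules C2_J1 C2_J2)+,
      subst tan_inner_mult[OF _ _ q], (intro C2_rules C2_J1 C2_J2)+,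
      subst tan_inner_mult[OF _ _ q], (intro C2_rules C2_J1 C2_J2)+) (simp add: tan_inner_const)

lemma tan_inner_T2: "tan_inner q (T2 e) h = 2 * tan_inner q (J2 e) h + 2 * slope q * tan_inner q (J1 e) h + 2 * J1 e q * tan_inner q slope h"
  unfolding T2_def[abs_def]
  by (subst tan_inner_add[OF _ _ q], (intro C2_rules C2_J1 C2_J2)+,
      subst tan_inner_mult[OF _ _ q], (intro C2_rules C2_J1 C2_J2)+,
      subst tan_inner_mult[OF _ _ q], (intro C2_rules C2_J1 C2_J2)+,
      subst tan_inner_mult[OF _ _ q], (intro C2_rules C2_J1 C2_J2)+) (simp add: tan_inner_const)

lemma tan_lap_J1: "tan_lap q (J1 e) = 2 * re e q * tan_lap q (re e) + 2 * tan_inner q (re e) (re e)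
    - 2 * im e q * tan_lap q (im e) - 2 * tan_inner q (im e) (im e)"
  unfolding J1_def[abs_def]
  by (subst tan_lap_add[OF _ _ q], (intro C2_rules)+,
      subst tan_lap_mult[OF _ _ q], (intro C2_rules)+, subst tan_lap_mult[OF _ _ q], (intro C2_rules)+,
      subst tan_lap_mult[OF _ _ q], (intro C2_rules)+) (simp add: tan_inner_const tan_lap_const)

lemma tan_lap_J2: "tan_lap q (J2 e) = re e q * tan_lap q (im e) + im e q * tan_lap q (re e) + 2 * tan_inner q (re e) (im e)"
  unfolding J2_def[abs_def] by (rule tan_lap_mult[OF _ _ q]) (intro C2_rules)+

lemma tan_lap_T1: "tan_lap q (T1 e) = tan_lap q (J1 e) - 4 * (slope q * tan_lap q (J2 e) + J2 e q * tan_lap q slope + 2 * tan_inner q slope (J2 e))"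
  unfolding T1_def[abs_def]
  by (subst tan_lap_add[OF _ _ q], (intro C2_rules C2_J1 C2_J2)+,
      subst tan_lap_mult[OF _ _ q], (intro C2_rules C2_J1 C2_J2)+,
      subst tan_lap_mult[OF _ _ q], (intro C2_rules C2_J1 C2_J2)+) (simp add: tan_inner_const tan_lap_const)

lemma tan_lap_T2: "tan_lap q (T2 e) = 2 * tan_lap q (J2 e) + 2 * (slope q * tan_lap q (J1 e) + J1 e q * tan_lap q slope + 2 * tan_inner q slope (J1 e))"
  unfolding T2_def[abs_def]
  by (subst tan_lap_add[OF _ _ q], (intro C2_rules C2_J1 C2_J2)+,
      subst tan_lap_mult[OF _ _ q], (intro C2_rules C2_J1 C2_J2)+,
      subst tan_lap_mult[OF _ _ q], (intro C2_rules C2_J1 C2_J2)+,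
      subst tan_lap_mult[OF _ _ q], (intro C2_rules C2_J1 C2_J2)+) (simp add: tan_inner_const tan_lap_const)

end

section \<open>Orthogonality and eigenvalue relation of \<open>T1\<close> and
  \<open>T2\<close>\<close>

context
  fixes e :: "real ^ ('n::finite + 'n)" and q :: "'n heis" and v k D w c1 c2 j1 j2 X Y E m :: real
  assumes q: "q \<in> nonaxis"
    and v: "v = 1 / xsq q" and k: "k = snd q / xsq q" and D: "D = 1 + 4 * (k * k)" and w: "w = v / D"
    and c: "c1 = re e q" "c2 = im e q" and j: "j1 = c1 * c1 - c2 * c2" "j2 = c1 * c2"
    and X: "X = j1 + 4 * k * j2" and Y: "Y = j2 - k * j1" and E: "E = e \<bullet> e" and m: "m = c1 * c1 + c2 * c2"
begin

text \<open>In these parameters the operators become polynomials. The quotient \<open>w\<close> is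
  kept as a variable of its own, so that a rational identity becomes a polynomial one followed by
  the substitution \<open>w * D = v\<close>.\<close>

lemma conformal_parameters: "D > 0" "v > 0" "w * D = v" "rho4 q = D / (v * v)" "snd q * v = k" "xsq q = 1 / v"
proof -
  show "D > 0" by (simp add: D add_pos_nonneg)
  show v0: "v > 0" using xsq_pos[OF q] by (simp add: v)
  show "w * D = v" using \<open>D > 0\<close> by (simp add: w)
  show x: "xsq q = 1 / v" by (simp add: v)
  show "snd q * v = k" by (simp add: v k)
  then have "snd q = k / v" using v0 by (simp add: field_simps)
  then show "rho4 q = D / (v * v)"
    using v0 unfolding rho4_xsq x D by (simp add: power2_eq_square add_divide_distrib)
qed

lemma slope_k: "slope q = k"
  by (simp add: slope_def inv_xsq_def divide_inverse k)

lemma snd_k: "snd q = k / v"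
  using conformal_parameters by (simp add: field_simps)

lemma Pt_k: "e \<bullet> Pt q = (c1 + 2 * k * c2) / v" "- Jp e \<bullet> Pt q = (c2 - 2 * k * c1) / v"
  unfolding inner_Pt re_Jp_im snd_k using conformal_parameters by (simp_all add: c field_simps)

lemma tan_inner_re_k:
  "tan_inner q (re e) (re e) = E - w * (c1 + 2 * k * c2)\<^sup>2"
  "tan_inner q (im e) (im e) = E - w * (c2 - 2 * k * c1)\<^sup>2"
  "tan_inner q (re e) (im e) = - (w * ((c1 + 2 * k * c2) * (c2 - 2 * k * c1)))"
  "tan_inner q (im e) (re e) = - (w * ((c1 + 2 * k * c2) * (c2 - 2 * k * c1)))"
  unfolding tan_inner_re_re Pt_k conformal_parameters(4) conformal_parameters(6) using conformal_parameters(1,2)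
  by (simp_all add: E w power2_eq_square mult.commute)

lemma tan_inner_slope_k:
  "tan_inner q slope (re e) = v * (c2 - 2 * k * c1)" "tan_inner q slope (im e) = - (v * (c1 + 2 * k * c2))"
  "tan_inner q (re e) slope = v * (c2 - 2 * k * c1)" "tan_inner q (im e) slope = - (v * (c1 + 2 * k * c2))"
  "tan_inner q slope slope = D * v"
  unfolding tan_inner_commute[of q "re _" slope] tan_inner_slope_re[OF q] tan_inner_slope_slope[OF q] re_Jp_im conformal_parameters(4,6) snd_k
  using conformal_parameters(1,2) by (simp_all add: c power2_eq_square power3_eq_cube field_simps)

lemma tan_inner_snd_k:
  "tan_inner q (re e) snd = c2 - 2 * k * w * (c1 + 2 * k * c2) / v"
  "tan_inner q (im e) snd = - c1 - 2 * k * w * (c2 - 2 * k * c1) / v"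
  unfolding tan_inner_commute[of q "re _" snd] tan_inner_snd_re[OF q] re_Jp_im Pt_k conformal_parameters(4) snd_k
  using conformal_parameters(1,2) by (simp_all add: c w power2_eq_square)

lemma J_k: "J1 e q = j1" "J2 e q = j2"
  by (simp_all add: J1_def J2_def j c)

lemma tan_inner_J_J:
  "tan_inner q (J1 e) (J1 e) = 4 * m * E - 4 * w * (X * X)"
  "tan_inner q (J1 e) (J2 e) = - 4 * w * (X * Y)"
  "tan_inner q (J2 e) (J1 e) = - 4 * w * (X * Y)"
  "tan_inner q (J2 e) (J2 e) = m * E - 4 * w * (Y * Y)"
  unfolding tan_inner_J1[OF q] tan_inner_J2[OF q] tan_inner_commute[of q "re _" "J1 e"] tan_inner_commute[of q "re _" "J2 e"] tan_inner_re_k c[symmetric]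
  by (simp_all add: X Y j m power2_eq_square algebra_simps)

lemma tan_inner_J_slope:
  "tan_inner q (J1 e) slope = 4 * v * Y" "tan_inner q (J2 e) slope = - v * X"
  "tan_inner q slope (J1 e) = 4 * v * Y" "tan_inner q slope (J2 e) = - v * X"
  unfolding tan_inner_commute[of q slope "J1 e"] tan_inner_commute[of q slope "J2 e"] tan_inner_J1[OF q] tan_inner_J2[OF q] tan_inner_slope_k c[symmetric]
  by (simp_all add: X Y j algebra_simps)

text \<open>In complex notation X + 2 i Y = (j1 + 2 i j2) (1 - 2 i k), and D = (1 + 2 i k) (1 - 2 i
  k). The first two identities are multiplication by 1 + 2 i k; the last one is the modulus of a
  square.\<close>

lemma XY: "X - 4 * k * Y = j1 * D" "Y + k * X = j2 * D" "j1 * j1 + 4 * (j2 * j2) = m * m"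
  by (simp_all add: X Y D j m algebra_simps)

lemma tan_inner_T_T:
  "tan_inner q (T1 e) (T2 e) = 0"
  "tan_inner q (T1 e) (T1 e) = 4 * D * m * (E - v * m)"
  "tan_inner q (T2 e) (T2 e) = 4 * D * m * (E - v * m)"
proof -
  note com = tan_inner_commute[of q "J1 e" "T1 e"] tan_inner_commute[of q "J1 e" "T2 e"] tan_inner_commute[of q "J2 e" "T1 e"] tan_inner_commute[of q "J2 e" "T2 e"]
    tan_inner_commute[of q slope "T1 e"] tan_inner_commute[of q slope "T2 e"]
  have TJ: "tan_inner q (T1 e) (J1 e) = 4 * m * E - 4 * w * X * (X - 4 * k * Y) - 16 * v * j2 * Y"
    "tan_inner q (T1 e) (J2 e) = - 4 * k * m * E - 4 * w * Y * (X - 4 * k * Y) + 4 * v * j2 * X"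
    "tan_inner q (T1 e) slope = 4 * v * (Y + k * X) - 4 * j2 * D * v"
    "tan_inner q (T2 e) (J1 e) = 8 * k * m * E - 8 * w * X * (Y + k * X) + 8 * v * j1 * Y"
    "tan_inner q (T2 e) (J2 e) = 2 * m * E - 8 * w * Y * (Y + k * X) - 2 * v * j1 * X"
    "tan_inner q (T2 e) slope = - 2 * v * (X - 4 * k * Y) + 2 * j1 * D * v"
    unfolding tan_inner_T1[OF q] tan_inner_T2[OF q] tan_inner_J_J tan_inner_J_slope tan_inner_slope_k J_k slope_k
    by (simp_all add: algebra_simps)

  \<comment> \<open>Through \<open>XY\<close> every factor \<open>w\<close> meets a factor
    \<open>D\<close> and becomes \<open>v\<close>. The products with \<open>slope\<close> then
    cancel, so only the derivatives along \<open>J1\<close> and \<open>J2\<close> remain for the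
    products of \<open>T1\<close> and \<open>T2\<close>.\<close>
  have TJ': "tan_inner q (T1 e) (J1 e) = 4 * m * E - 4 * v * j1 * X - 16 * v * j2 * Y"
    "tan_inner q (T1 e) (J2 e) = - 4 * k * m * E - 4 * v * j1 * Y + 4 * v * j2 * X"
    "tan_inner q (T1 e) slope = 0"
    "tan_inner q (T2 e) (J1 e) = 8 * k * m * E - 8 * v * j2 * X + 8 * v * j1 * Y"
    "tan_inner q (T2 e) (J2 e) = 2 * m * E - 8 * v * j2 * Y - 2 * v * j1 * X"
    "tan_inner q (T2 e) slope = 0"
    unfolding TJ XY(1,2) conformal_parameters(3)[symmetric] by (simp_all add: algebra_simps)
  have "tan_inner q (T1 e) (T1 e) = 4 * m * E * D - 4 * v * j1 * (X - 4 * k * Y) - 16 * v * j2 * (Y + k * X)"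
    by (subst tan_inner_T1[OF q]) (simp add: com TJ' slope_k, simp add: D algebra_simps)
  then have "tan_inner q (T1 e) (T1 e) = 4 * m * E * D - 4 * v * D * (j1 * j1 + 4 * (j2 * j2))"
    unfolding XY(1,2) by (simp add: algebra_simps)
  then show "tan_inner q (T1 e) (T1 e) = 4 * D * m * (E - v * m)"
    unfolding XY(3) by (simp add: algebra_simps)
  have "tan_inner q (T2 e) (T2 e) = 4 * m * E * D - 4 * v * j1 * (X - 4 * k * Y) - 16 * v * j2 * (Y + k * X)"
    by (subst tan_inner_T2[OF q]) (simp add: com TJ' slope_k, simp add: D algebra_simps)
  then have "tan_inner q (T2 e) (T2 e) = 4 * m * E * D - 4 * v * D * (j1 * j1 + 4 * (j2 * j2))"
    unfolding XY(1,2) by (simp add: algebra_simps)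
  then show "tan_inner q (T2 e) (T2 e) = 4 * D * m * (E - v * m)"
    unfolding XY(3) by (simp add: algebra_simps)
  have "tan_inner q (T1 e) (T2 e) = - 8 * v * j2 * (X - 4 * k * Y) + 8 * v * j1 * (Y + k * X)"
    by (subst tan_inner_T1[OF q]) (simp add: com TJ' slope_k, simp add: D algebra_simps)
  then show "tan_inner q (T1 e) (T2 e) = 0"
    unfolding XY(1,2) by (simp add: algebra_simps)
qed

lemma tan_inner_T_snd: "tan_inner q (T1 e) snd = 0" "tan_inner q (T2 e) snd = 0"
proof -
  have s: "tan_inner q (J1 e) snd = 4 * j2 - 4 * k * w * X / v" "tan_inner q (J2 e) snd = - j1 - 4 * k * w * Y / v"
    unfolding tan_inner_J1[OF q] tan_inner_J2[OF q] tan_inner_snd_k c[symmetric]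
    using conformal_parameters(2) by (simp_all add: X Y j field_simps)
  have wv: "w / v * D = 1" using conformal_parameters(1-3) by (simp add: field_simps)
  have "tan_inner q (T1 e) snd = - 4 * k * (w / v) * (X - 4 * k * Y) + 4 * k * j1"
    unfolding tan_inner_T1[OF q] s tan_inner_slope_snd[OF q] slope_k J_k using conformal_parameters(2) by (simp add: field_simps)
  then have "tan_inner q (T1 e) snd = 4 * k * j1 * (1 - w / v * D)"
    unfolding XY by (simp add: algebra_simps)
  then show "tan_inner q (T1 e) snd = 0" by (simp only: wv) simp
  have "tan_inner q (T2 e) snd = - 8 * k * (w / v) * (Y + k * X) + 8 * k * j2"
    unfolding tan_inner_T2[OF q] s tan_inner_slope_snd[OF q] slope_k J_k using conformal_parameters(2) by (simp add: field_simps)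
  then have "tan_inner q (T2 e) snd = 8 * k * j2 * (1 - w / v * D)"
    unfolding XY by (simp add: algebra_simps)
  then show "tan_inner q (T2 e) snd = 0" by (simp only: wv) simp
qed

text \<open>\<open>T1\<close> and \<open>T2\<close> are the real and imaginary part of one complex
  function, so they share the same real factor. The terms in n come from the first order part of
  \<open>tan_lap\<close>; their sum with the curvature of the phase is proportional to n -
  1.\<close>

lemma tan_lap_T:
  "tan_lap q (T1 e) = - 4 * (real CARD('n) - 1) * v * T1 e q"
  "tan_lap q (T2 e) = - 4 * (real CARD('n) - 1) * v * T2 e q"
proof -
  define N where "N = real CARD('n)"
  have wv: "w * v / v = w" using conformal_parameters(2) by simp
  have re: "tan_lap q (re e) = - ((2 * N + 1) * w * (c1 + 2 * k * c2))"
    "tan_lap q (im e) = - ((2 * N + 1) * w * (c2 - 2 * k * c1))"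
    unfolding tan_lap_re Pt_k conformal_parameters(4) using conformal_parameters(1,2) by (simp_all add: N_def w field_simps)
  \<comment> \<open>The brackets are the real part and half the imaginary part of (c1 + i c2)^2 (1 -
    2 i k)^2. Multiplication by 1 + 2 i k, which passes from the J to the T, extracts the factor
    \<open>D\<close>.\<close>
  have J: "tan_lap q (J1 e) = - (4 * N + 2) * w * X - 2 * w * ((1 - 4 * (k * k)) * j1 + 8 * k * j2)"
    "tan_lap q (J2 e) = - (4 * N + 2) * w * Y - 2 * w * ((1 - 4 * (k * k)) * j2 - 2 * k * j1)"
    unfolding tan_lap_J1[OF q] tan_lap_J2[OF q] re tan_inner_re_k c[symmetric]
    by (simp_all add: X Y j power2_eq_square algebra_simps)
  have s: "tan_lap q slope = (10 - 4 * N) * k * v"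
    unfolding tan_lap_slope[OF q] slope_k conformal_parameters(6) by (simp add: N_def)
  have T: "T1 e q = j1 - 4 * k * j2" "T2 e q = 2 * j2 + 2 * k * j1"
    by (simp_all add: T1_def T2_def slope_k J_k)
  have "tan_lap q (T1 e) = - (4 * N + 2) * w * (X - 4 * k * Y)
     - 2 * w * ((1 - 4 * (k * k)) * j1 + 8 * k * j2 - 4 * k * ((1 - 4 * (k * k)) * j2 - 2 * k * j1))
     - 4 * j2 * ((10 - 4 * N) * k * v) + 8 * v * X"
    unfolding tan_lap_T1[OF q] J s tan_inner_J_slope slope_k J_k by (simp add: algebra_simps)
  also have "(1 - 4 * (k * k)) * j1 + 8 * k * j2 - 4 * k * ((1 - 4 * (k * k)) * j2 - 2 * k * j1) = D * (j1 + 4 * k * j2)"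
    by (simp add: D algebra_simps)
  also have "- (4 * N + 2) * w * (X - 4 * k * Y) = - (4 * N + 2) * (w * D) * j1"
    unfolding XY by (simp add: algebra_simps)
  also have "2 * w * (D * (j1 + 4 * k * j2)) = 2 * (w * D) * (j1 + 4 * k * j2)"
    by (simp add: algebra_simps)
  also have "- (4 * N + 2) * (w * D) * j1 - 2 * (w * D) * (j1 + 4 * k * j2) - 4 * j2 * ((10 - 4 * N) * k * v) + 8 * v * X
     = - 4 * (N - 1) * v * T1 e q"
    unfolding conformal_parameters(3) T X by (simp add: algebra_simps)
  finally show "tan_lap q (T1 e) = - 4 * (real CARD('n) - 1) * v * T1 e q" by (simp add: N_def)
  have "tan_lap q (T2 e) = - (8 * N + 4) * w * (Y + k * X)
     - 4 * w * ((1 - 4 * (k * k)) * j2 - 2 * k * j1 + k * ((1 - 4 * (k * k)) * j1 + 8 * k * j2))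
     + 2 * j1 * ((10 - 4 * N) * k * v) + 16 * v * Y"
    unfolding tan_lap_T2[OF q] J s tan_inner_J_slope slope_k J_k by (simp add: algebra_simps)
  also have "(1 - 4 * (k * k)) * j2 - 2 * k * j1 + k * ((1 - 4 * (k * k)) * j1 + 8 * k * j2) = D * (j2 - k * j1)"
    by (simp add: D algebra_simps)
  also have "- (8 * N + 4) * w * (Y + k * X) = - (8 * N + 4) * (w * D) * j2"
    unfolding XY by (simp add: algebra_simps)
  also have "4 * w * (D * (j2 - k * j1)) = 4 * (w * D) * (j2 - k * j1)"
    by (simp add: algebra_simps)
  also have "- (8 * N + 4) * (w * D) * j2 - 4 * (w * D) * (j2 - k * j1) + 2 * j1 * ((10 - 4 * N) * k * v) + 16 * v * Y
     = - 4 * (N - 1) * v * T2 e q"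
    unfolding conformal_parameters(3) T Y by (simp add: algebra_simps)
  finally show "tan_lap q (T2 e) = - 4 * (real CARD('n) - 1) * v * T2 e q" by (simp add: N_def)
qed

lemma T_norm: "(T1 e q)\<^sup>2 + (T2 e q)\<^sup>2 = D * (m * m)"
proof -
  have "(T1 e q)\<^sup>2 + (T2 e q)\<^sup>2 = D * (j1 * j1 + 4 * (j2 * j2))"
    by (simp add: T1_def T2_def slope_k J_k D power2_eq_square algebra_simps)
  then show ?thesis by (simp add: XY)
qed

end

definition modsq :: "real ^ ('n::finite + 'n) \<Rightarrow> 'n heis \<Rightarrow> real" where
  "modsq e q = re e q * re e q + im e q * im e q"

lemma conformal_factor: "q \<in> nonaxis \<Longrightarrow> 1 + 4 * (snd q / xsq q * (snd q / xsq q)) = rho4 q / (xsq q)\<^sup>2"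
  using xsq_pos[of q] by (simp add: rho4_xsq power2_eq_square field_simps)

lemma tan_inner_T:
  assumes "q \<in> nonaxis"
  shows "tan_inner q (T1 e) (T2 e) = 0" "tan_inner q (T1 e) snd = 0" "tan_inner q (T2 e) snd = 0"
    "tan_inner q (T1 e) (T1 e) = 4 * (rho4 q / (xsq q)\<^sup>2) * modsq e q * (e \<bullet> e - modsq e q / xsq q)"
    "tan_inner q (T2 e) (T2 e) = 4 * (rho4 q / (xsq q)\<^sup>2) * modsq e q * (e \<bullet> e - modsq e q / xsq q)"
  using tan_inner_T_T[OF assms refl refl refl refl refl refl refl refl refl refl refl refl, of e]
    tan_inner_T_snd[OF assms refl refl refl refl refl refl refl refl refl refl refl refl, of e]
  unfolding conformal_factor[OF assms] modsq_def[symmetric] by simp_all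

lemmas tan_lap_T' = tan_lap_T[OF _ refl refl refl refl refl refl refl refl refl refl refl refl]

lemma T_norm':
  assumes "q \<in> nonaxis"
  shows "(T1 e q)\<^sup>2 + (T2 e q)\<^sup>2 = rho4 q / (xsq q)\<^sup>2 * (modsq e q * modsq e q)"
  using T_norm[OF assms refl refl refl refl refl refl refl refl refl refl refl refl, of e]
  unfolding conformal_factor[OF assms] modsq_def[symmetric] .

section \<open>Derivatives of the gauge\<close>

lemma jet_rho4: "has_jet rho4 UNIV (\<lambda>q v. 4 * (fst q \<bullet> fst q) * (fst q \<bullet> fst v) + 8 * snd q * snd v)
   (\<lambda>q v w. 8 * (fst q \<bullet> fst v) * (fst q \<bullet> fst w) + 4 * (fst q \<bullet> fst q) * (fst v \<bullet> fst w) + 8 * snd v * snd w)"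
  unfolding has_jet_def
proof (intro conjI ballI allI)
  show "((\<lambda>q. 4 * (fst q \<bullet> fst q) * (fst q \<bullet> fst v) + 8 * snd q * snd v) has_derivative
    (\<lambda>w. 8 * (fst q \<bullet> fst v) * (fst q \<bullet> fst w) + 4 * (fst q \<bullet> fst q) * (fst v \<bullet> fst w) + 8 * snd v * snd w)) (at q)"
    for q v :: "'a heis"
    by (auto intro!: derivative_eq_intros simp: inner_commute fun_eq_iff algebra_simps)
qed (auto intro!: continuous_intros has_derivative_rho4)

lemma C2_rho4: "C2 rho4 UNIV"
  by (rule has_jet_C2[OF jet_rho4])

lemma D1_rho4_lift: "D1 rho4 q (lift q a) = 4 * (Pt q \<bullet> a)"
  by (simp add: has_jet_D1[OF jet_rho4] lift_def Pt_def inner_add_left inner_commute algebra_simps)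

lemma hor_grad_rho4: "hor_grad q (D1 rho4 q) = 4 *\<^sub>R Pt q"
  by (simp add: hor_grad_def vec_eq_iff D1_rho4_lift inner_axis)

lemma D2_rho4_lift: "D2 rho4 q (lift q a) (lift q b) =
    8 * (fst q \<bullet> a) * (fst q \<bullet> b) + 4 * xsq q * (a \<bullet> b) + 8 * (a \<bullet> Jp (fst q)) * (b \<bullet> Jp (fst q))"
  by (simp add: has_jet_D2[OF jet_rho4] lift_def xsq_def)

lemma hor_trace_rho4: "hor_trace q (D2 rho4 q) = (8 * real CARD('n) + 16) * xsq q" for q :: "'n::finite heis"
proof -
  have 1: "(\<Sum>I\<in>UNIV. (fst q $ I) * (fst q $ I)) = xsq q"
    by (simp add: xsq_def inner_vec_def)
  have 2: "(\<Sum>I\<in>UNIV. (Jp (fst q) $ I) * (Jp (fst q) $ I)) = xsq q"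
    using Jp_inner_Jp[of "fst q" "fst q"] by (simp add: xsq_def inner_vec_def)
  have "hor_trace q (D2 rho4 q) =
      (\<Sum>I\<in>UNIV. 8 * ((fst q $ I) * (fst q $ I)) + 4 * xsq q + 8 * ((Jp (fst q) $ I) * (Jp (fst q) $ I)))"
    unfolding hor_trace_def D2_rho4_lift by (simp add: inner_axis inner_axis' inner_axis_axis mult.assoc)
  also have "\<dots> = 8 * xsq q + 4 * xsq q * (2 * real CARD('n)) + 8 * xsq q"
    unfolding sum.distrib sum_distrib_left[symmetric] 1 2 by simp
  finally show ?thesis by (simp add: algebra_simps)
qed

section \<open>Perturbations of the gauge\<close>

text \<open>Together with \<open>perturb3\<close>, the coefficients of the second and third power of
  the perturbation parameter when \<open>mean_op\<close> is expanded at the gauge; the sign of the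
  gauge is split off from the quadratic one.\<close>

definition perturb2 :: "('n::finite heis \<Rightarrow> real) \<Rightarrow> 'n heis \<Rightarrow> real" where
  "perturb2 h q = (let G = hor_grad q (D1 h q); P = Pt q in
     (G \<bullet> G) * ((8 * real CARD('n) + 16) * xsq q) + 8 * (P \<bullet> G) * hor_trace q (D2 h q)
     - (8 * (fst q \<bullet> G)\<^sup>2 + 4 * xsq q * (G \<bullet> G) + 8 * (G \<bullet> Jp (fst q))\<^sup>2)
     - 4 * (D2 h q (lift q P) (lift q G) + D2 h q (lift q G) (lift q P))
     - (2 * real CARD('n) + 1) * (8 * (P \<bullet> G)\<^sup>2 / rho4 q + 4 * (G \<bullet> G) * xsq q))"

definition perturb3 :: "('n::finite heis \<Rightarrow> real) \<Rightarrow> 'n heis \<Rightarrow> real" where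
  "perturb3 h q = (let G = hor_grad q (D1 h q); P = Pt q in
     (G \<bullet> G) * hor_trace q (D2 h q) - D2 h q (lift q G) (lift q G)
     - (2 * real CARD('n) + 1) * (G \<bullet> G) * (P \<bullet> G) / rho4 q)"

text \<open>\<open>mean_op\<close> is cubic in the derivatives, hence cubic in
  \<open>\<epsilon>\<close>. The constant term vanishes because 8 n + 16 = 12 + 4 (2 n + 1), which
  is the minimality of the Heisenberg spheres. In the linear term the signs combine to
  \<open>s * s = 1\<close>, so it is the same for touching from either side.\<close>

lemma mean_op_perturb:
  fixes q :: "'n::finite heis"
  assumes h: "C2 h W" "q \<in> W" and q: "q \<in> nonaxis" and s: "s * s = 1"
  shows "mean_op q (\<lambda>v. s * D1 rho4 q v + \<epsilon> * D1 h q v) (\<lambda>v w. s * D2 rho4 q v w + \<epsilon> * D2 h q v w)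
     = \<epsilon> * (16 * xsq q * rho4 q * tan_lap q h + s * \<epsilon> * perturb2 h q + \<epsilon>\<^sup>2 * perturb3 h q)"
proof -
  define N A S where "N = real CARD('n)" and "A = xsq q" and "S = rho4 q"
  have p: "A > 0" "S > 0" using xsq_pos[OF q] rho4_nonaxis[OF q] by (auto simp: A_def S_def)
  define G where "G = hor_grad q (D1 h q)"
  define P where "P = Pt q"
  define a where "a = P \<bullet> G"
  define g where "g = G \<bullet> G"
  define t where "t = hor_trace q (D2 h q)"
  define b where "b u v = D2 h q (lift q u) (lift q v)" for u v
  note lin = has_jet_linear_left[OF C2_jet[OF h(1)] h(2)] has_jetD(5)[OF C2_jet[OF h(1)] h(2)]
  have bl: "b (u + u') v = b u v + b u' v" "b v (u + u') = b v u + b v u'" "b (c *\<^sub>R u) v = c * b u v" "b v (c *\<^sub>R u) = c * b v u"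
    for u u' v c
    by (simp_all add: b_def linear_add[OF linear_lift] linear_scale[OF linear_lift]
        linear_add[OF lin(1)] linear_scale[OF lin(1)] linear_add[OF lin(2)] linear_scale[OF lin(2)])
  have PP: "P \<bullet> P = A * S" using Pt_inner_Pt[of q] by (simp add: P_def A_def S_def)
  have x: "fst q \<bullet> P = A * A" "P \<bullet> Jp (fst q) = 2 * snd q * A"
    using Pt_inner_x[of q] Pt_inner_Jp[of q] by (simp_all add: P_def A_def power2_eq_square inner_commute)
  have S: "S = A * A + 4 * (snd q * snd q)" by (simp add: S_def A_def rho4_xsq power2_eq_square)
  have aP: "a = A * (fst q \<bullet> G) + 2 * snd q * (G \<bullet> Jp (fst q))"
    by (simp add: a_def P_def Pt_def inner_add_left A_def xsq_def inner_commute[of G "Jp (fst q)"])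
  define B where "B u v = 8 * (fst q \<bullet> u) * (fst q \<bullet> v) + 4 * A * (u \<bullet> v) + 8 * (u \<bullet> Jp (fst q)) * (v \<bullet> Jp (fst q))" for u v
  have Bl: "B (u + u') v = B u v + B u' v" "B v (u + u') = B v u + B v u'" "B (c *\<^sub>R u) v = c * B u v" "B v (c *\<^sub>R u) = c * B v u"
    for u u' v c
    by (simp_all add: B_def inner_add_left inner_add_right algebra_simps)
  have BPP: "B P P = 12 * A * A * S"
    unfolding B_def x PP by (simp add: S algebra_simps)
  \<comment> \<open>\<open>Pt\<close> is an eigenvector of the horizontal Hessian of the gauge with
    eigenvalue 12 |x|^2. This turns all mixed terms into multiples of the single number
    \<open>a\<close>.\<close>
  have BPG: "B P G = 12 * A * a" "B G P = 12 * A * a"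
    unfolding B_def x by (simp_all add: inner_commute[of G P] a_def[symmetric], simp_all add: aP algebra_simps)
  have Bdef: "D2 rho4 q (lift q u) (lift q v) = B u v" for u v
    by (simp add: D2_rho4_lift B_def A_def)
  have hg: "hor_grad q (\<lambda>v. s * D1 rho4 q v + \<epsilon> * D1 h q v) = (4 * s) *\<^sub>R P + \<epsilon> *\<^sub>R G"
    by (simp add: hor_grad_comb hor_grad_rho4 P_def G_def)
  define p where "p = (4 * s) *\<^sub>R P + \<epsilon> *\<^sub>R G"
  have pp: "p \<bullet> p = 16 * (A * S) + 8 * s * \<epsilon> * a + \<epsilon> * \<epsilon> * g"
    using s by (simp add: p_def inner_add_left inner_add_right PP a_def g_def inner_commute[of G P])
      (simp add: algebra_simps)
  have pP: "p \<bullet> P = 4 * s * (A * S) + \<epsilon> * a"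
    by (simp add: p_def inner_add_left PP a_def inner_commute[of G P])
  have bpp: "b p p = 16 * b P P + 4 * s * \<epsilon> * (b P G + b G P) + \<epsilon> * \<epsilon> * b G G"
    using s by (simp add: p_def bl) (simp add: algebra_simps)
  have Bpp: "B p p = 16 * (12 * A * A * S) + 8 * s * \<epsilon> * (12 * A * a) + \<epsilon> * \<epsilon> * B G G"
    using s by (simp add: p_def Bl BPP BPG) (simp add: algebra_simps)
  have "mean_op q (\<lambda>v. s * D1 rho4 q v + \<epsilon> * D1 h q v) (\<lambda>v w. s * D2 rho4 q v w + \<epsilon> * D2 h q v w)
    = (p \<bullet> p) * (s * ((8 * N + 16) * A) + \<epsilon> * t) - (s * B p p + \<epsilon> * b p p) - (2 * N + 1) * (p \<bullet> p) * (p \<bullet> P) / S"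
    unfolding mean_op_def Let_def hg p_def[symmetric] hor_trace_comb hor_trace_rho4 Bdef
    by (simp add: N_def A_def t_def b_def P_def S_def)
  also have "\<dots> = \<epsilon> * (16 * A * S * (t - b P P / (A * S) - (2 * N + 1) * a / S)
     + s * \<epsilon> * (g * ((8 * N + 16) * A) + 8 * a * t - B G G - 4 * (b P G + b G P)
         - (2 * N + 1) * (8 * a\<^sup>2 / S + 4 * g * A))
     + \<epsilon>\<^sup>2 * (g * t - b G G - (2 * N + 1) * g * a / S))"
  proof -
    have ss: "s * (s * r) = r" for r using s by (metis mult.assoc mult_1)
    show ?thesis
      unfolding pp pP bpp Bpp using p
      by (simp add: field_simps power2_eq_square ss)
  qed
  also have "t - b P P / (A * S) - (2 * N + 1) * a / S = tan_lap q h"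
  proof -
    have "D1 h q (lift q P) = a"
      using hor_grad_inner[OF has_jetD(4)[OF C2_jet[OF h(1)] h(2)], of q P] by (simp add: a_def G_def inner_commute)
    then show ?thesis
      by (simp add: tan_lap_def t_def b_def P_def[symmetric] A_def S_def xsq_def N_def)
  qed
  finally show ?thesis
    by (simp add: perturb2_def perturb3_def Let_def A_def S_def N_def B_def a_def g_def t_def b_def P_def G_def power2_eq_square mult.assoc)
qed

section \<open>Continuity of the expansion coefficients off the axis\<close>

lemma continuous_hor_grad: "C2 h W \<Longrightarrow> continuous_on W (\<lambda>q. hor_grad q (D1 h q))"
  by (rule continuous_at_imp_continuous_on) (auto intro: has_derivative_continuous has_derivative_hor_grad C2_jet)

lemma continuous_lift: "continuous_on W y \<Longrightarrow> continuous_on W (\<lambda>q. lift q (y q))"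
  unfolding lift_def
  by (intro continuous_intros linear_continuous_on_compose[OF _ linear_Jp])

lemma continuous_D2:
  fixes h :: "'a::euclidean_space \<Rightarrow> real"
  assumes h: "C2 h W" and u: "continuous_on W u" and v: "continuous_on W v"
  shows "continuous_on W (\<lambda>q. D2 h q (u q) (v q))"
proof -
  have ex: "D2 h q (u q) (v q) = (\<Sum>c\<in>Basis. \<Sum>d\<in>Basis. (u q \<bullet> c) * ((v q \<bullet> d) * D2 h q c d))" if q: "q \<in> W" for q
  proof -
    note lin = has_jet_linear_left[OF C2_jet[OF h] q] has_jetD(5)[OF C2_jet[OF h] q]
    have "D2 h q (u q) (v q) = D2 h q (\<Sum>c\<in>Basis. (u q \<bullet> c) *\<^sub>R c) (\<Sum>d\<in>Basis. (v q \<bullet> d) *\<^sub>R d)"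
      by (simp add: euclidean_representation)
    also have "\<dots> = (\<Sum>c\<in>Basis. \<Sum>d\<in>Basis. (u q \<bullet> c) * ((v q \<bullet> d) * D2 h q c d))"
      by (simp only: linear_sum[OF lin(1)] linear_scale[OF lin(1)] linear_sum[OF lin(2)] linear_scale[OF lin(2)]
        real_scaleR_def sum_distrib_left, subst sum.swap) (simp only: mult.left_commute)
    finally show ?thesis .
  qed
  have "continuous_on W (\<lambda>q. \<Sum>c\<in>Basis. \<Sum>d\<in>Basis. (u q \<bullet> c) * ((v q \<bullet> d) * D2 h q c d))"
    by (intro continuous_intros u v C2_D2_continuous[OF h])
  then show ?thesis using ex by (simp cong: continuous_on_cong)
qed

lemma continuous_Pt: "continuous_on W Pt"
  unfolding Pt_def by (intro continuous_intros linear_continuous_on_compose[OF _ linear_Jp])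

lemma continuous_rho4: "continuous_on W rho4"
  unfolding rho4_def by (intro continuous_intros)

lemma continuous_xsq: "continuous_on W xsq"
  unfolding xsq_def by (intro continuous_intros)

lemma continuous_hor_trace: "C2 h W \<Longrightarrow> continuous_on W (\<lambda>q. hor_trace q (D2 h q))"
  unfolding hor_trace_def by (intro continuous_intros continuous_D2 continuous_lift)

lemma continuous_perturbation:
  assumes h: "C2 h W" and W: "W \<subseteq> nonaxis"
  shows "continuous_on W (\<lambda>q. tan_lap q h)" "continuous_on W (perturb2 h)" "continuous_on W (perturb3 h)"
proof -
  have D1: "continuous_on W (\<lambda>q. D1 h q (lift q (Pt q)))"
  proof -
    have "continuous_on W (\<lambda>q. hor_grad q (D1 h q) \<bullet> Pt q)"
      by (intro continuous_intros continuous_hor_grad h continuous_Pt)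
    then show ?thesis
      by (subst continuous_on_cong[OF refl]) (auto simp: hor_grad_inner[OF has_jetD(4)[OF C2_jet[OF h]]])
  qed
  have nz: "rho4 q \<noteq> 0" "xsq q \<noteq> 0" if "q \<in> W" for q
    using that W rho4_nonaxis[of q] xsq_pos[of q] by auto
  have Jp: "continuous_on W (\<lambda>q. Jp (fst q))"
    by (intro continuous_intros linear_continuous_on_compose[OF _ linear_Jp])
  show "continuous_on W (\<lambda>q. tan_lap q h)"
    unfolding tan_lap_def xsq_def[symmetric]
    by (intro continuous_intros continuous_hor_trace h continuous_D2 continuous_lift continuous_Pt continuous_rho4 continuous_xsq D1)
      (use nz in auto)
  show "continuous_on W (perturb2 h)" "continuous_on W (perturb3 h)"
    unfolding perturb2_def[abs_def] perturb3_def[abs_def] Let_def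
    by (intro continuous_intros continuous_hor_trace h continuous_D2 continuous_lift continuous_Pt continuous_rho4
        continuous_xsq continuous_hor_grad Jp; use nz in auto)+
qed

text \<open>Bessel's inequality for the orthogonal vectors \<open>e\<close> and
  \<open>- Jp e\<close> of equal length. Equality means that x lies in the complex line of
  \<open>e\<close>.\<close>

lemma modsq_le: "modsq e q \<le> xsq q * (e \<bullet> e)"
proof -
  define y where "y = re e q *\<^sub>R e + im e q *\<^sub>R (- Jp e)"
  have yx: "y \<bullet> fst q = modsq e q"
    by (simp add: y_def inner_diff_left modsq_def) (simp add: re_def)
  have yy: "y \<bullet> y = modsq e q * (e \<bullet> e)"
    by (simp add: y_def inner_diff_left inner_diff_right modsq_def algebra_simps)
  have "(modsq e q)\<^sup>2 \<le> (modsq e q * (e \<bullet> e)) * xsq q"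
    using Cauchy_Schwarz_ineq[of y "fst q"] unfolding yx yy xsq_def .
  moreover have "modsq e q \<ge> 0" by (simp add: modsq_def)
  ultimately show ?thesis
    by (cases "modsq e q = 0") (auto simp: power2_eq_square xsq_def mult.commute mult.left_commute)
qed

text \<open>The fourth power in \<open>z\<close> makes the last summand drop out of \<open>tan_lap\<close> wherever its derivative vanishes.\<close>

definition sep :: "real ^ ('n::finite + 'n) \<Rightarrow> real \<Rightarrow> real \<Rightarrow> real \<Rightarrow> 'n heis \<Rightarrow> real" where
  "sep e k1 k2 z q = ((T1 e q + (- k1)) * (T1 e q + (- k1)) + (T2 e q + (- k2)) * (T2 e q + (- k2)))
     + ((snd q + (- z)) * (snd q + (- z))) * ((snd q + (- z)) * (snd q + (- z)))"

lemma C2_sep: "C2 (sep e k1 k2 z) nonaxis"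
  unfolding sep_def[abs_def] by (intro C2_rules C2_T1 C2_T2)

context
  fixes q :: "'n::finite heis"
  assumes q: "q \<in> nonaxis"
begin

lemma tan_inner_shift: "C2 f nonaxis \<Longrightarrow> tan_inner q (\<lambda>q. f q + c) h = tan_inner q f h"
  by (subst tan_inner_add[OF _ C2_const[OF open_nonaxis] q]) (auto simp: tan_inner_const)

lemma tan_lap_shift: "C2 f nonaxis \<Longrightarrow> tan_lap q (\<lambda>q. f q + c) = tan_lap q f"
  by (subst tan_lap_add[OF _ C2_const[OF open_nonaxis] q]) (auto simp: tan_lap_const)

lemma tan_inner_square: "C2 f nonaxis \<Longrightarrow> tan_inner q (\<lambda>q. f q * f q) h = 2 * f q * tan_inner q f h"
  by (subst tan_inner_mult[OF _ _ q]) auto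

lemma tan_lap_square: "C2 f nonaxis \<Longrightarrow> tan_lap q (\<lambda>q. f q * f q) = 2 * f q * tan_lap q f + 2 * tan_inner q f f"
  by (subst tan_lap_mult[OF _ _ q]) auto

lemma tan_inner_square_shift: "C2 f nonaxis \<Longrightarrow> tan_inner q (\<lambda>q. (f q + c) * (f q + c)) h = 2 * (f q + c) * tan_inner q f h"
  by (subst tan_inner_square) (auto intro: C2_rules simp: tan_inner_shift)

lemma tan_lap_square_shift:
  assumes f: "C2 f nonaxis"
  shows "tan_lap q (\<lambda>q. (f q + c) * (f q + c)) = 2 * (f q + c) * tan_lap q f + 2 * tan_inner q f f"
proof -
  have "tan_inner q (\<lambda>q. f q + c) (\<lambda>q. f q + c) = tan_inner q f f"
    by (subst tan_inner_shift[OF f], subst tan_inner_commute, subst tan_inner_shift[OF f]) simp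
  then show ?thesis
    by (subst tan_lap_square) (auto intro: C2_rules f simp: tan_lap_shift[OF f])
qed

lemmas C2_snd_nonaxis = C2_nonaxis[OF C2_snd]

lemma tan_inner_quart: "tan_inner q (\<lambda>q. ((snd q + c) * (snd q + c)) * ((snd q + c) * (snd q + c))) h = 4 * (snd q + c) ^ 3 * tan_inner q snd h"
proof -
  have "C2 (\<lambda>q. (snd q + c) * (snd q + c)) (nonaxis :: 'n heis set)" by (intro C2_rules)
  from tan_inner_square[OF this] show ?thesis
    by (simp add: tan_inner_square_shift[OF C2_snd_nonaxis] power3_eq_cube)
qed

lemma tan_lap_quart: "tan_lap q (\<lambda>q. ((snd q + c) * (snd q + c)) * ((snd q + c) * (snd q + c)))
    = 4 * (snd q + c) ^ 3 * tan_lap q snd + 12 * (snd q + c)\<^sup>2 * tan_inner q snd snd"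
proof -
  have *: "C2 (\<lambda>q. (snd q + c) * (snd q + c)) (nonaxis :: 'n heis set)" by (intro C2_rules)
  show ?thesis
    unfolding tan_lap_square[OF *] tan_lap_square_shift[OF C2_snd_nonaxis] tan_inner_square_shift[OF C2_snd_nonaxis]
    by (subst tan_inner_commute, subst tan_inner_square_shift[OF C2_snd_nonaxis]) (simp add: power2_eq_square power3_eq_cube algebra_simps)
qed

lemma tan_inner_sep_left: "tan_inner q (sep e k1 k2 z) h =
    2 * (T1 e q - k1) * tan_inner q (T1 e) h + 2 * (T2 e q - k2) * tan_inner q (T2 e) h + 4 * (snd q - z) ^ 3 * tan_inner q snd h"
  unfolding sep_def[abs_def]
  by (subst tan_inner_add[OF _ _ q], (intro C2_rules C2_T1 C2_T2)+, subst tan_inner_add[OF _ _ q], (intro C2_rules C2_T1 C2_T2)+)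
    (simp only: tan_inner_square_shift[OF C2_T1] tan_inner_square_shift[OF C2_T2] tan_inner_quart, simp)

text \<open>\<open>T1\<close>, \<open>T2\<close> and z are mutually orthogonal, and
  \<open>T1\<close> and \<open>T2\<close> have equal square norms, so there are no mixed terms. What
  is left is a sum of nonnegative terms, whose vanishing can be read off termwise.\<close>

lemma tan_inner_sep: "tan_inner q (sep e k1 k2 z) (sep e k1 k2 z) =
    16 * (rho4 q / (xsq q)\<^sup>2 * modsq e q * (e \<bullet> e - modsq e q / xsq q)) * ((T1 e q - k1)\<^sup>2 + (T2 e q - k2)\<^sup>2)
    + 16 * (snd q - z) ^ 6 * (xsq q ^ 3 / rho4 q)"
proof -
  have T: "tan_inner q (T1 e) (sep e k1 k2 z) = 2 * (T1 e q - k1) * tan_inner q (T1 e) (T1 e)"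
    "tan_inner q (T2 e) (sep e k1 k2 z) = 2 * (T2 e q - k2) * tan_inner q (T2 e) (T2 e)"
    "tan_inner q snd (sep e k1 k2 z) = 4 * (snd q - z) ^ 3 * tan_inner q snd snd"
    unfolding tan_inner_commute[of q _ "sep e k1 k2 z"] tan_inner_sep_left
    by (simp_all add: tan_inner_T[OF q] tan_inner_commute[of q snd "T1 e"] tan_inner_commute[of q snd "T2 e"] tan_inner_commute[of q "T2 e" "T1 e"])
  have 6: "t ^ 3 * (t ^ 3 * r) = t ^ 6 * r" for t r :: real
    by (simp add: power_add[symmetric] mult.assoc[symmetric])
  define Q0 where "Q0 = rho4 q / (xsq q)\<^sup>2 * modsq e q * (e \<bullet> e - modsq e q / xsq q)"
  have "tan_inner q (T1 e) (T1 e) = 4 * Q0" "tan_inner q (T2 e) (T2 e) = 4 * Q0"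
    unfolding tan_inner_T(4,5)[OF q] Q0_def by simp_all
  then show ?thesis
    unfolding tan_inner_sep_left T tan_inner_snd_snd[OF q] Q0_def[symmetric]
    by (simp add: 6 power2_eq_square algebra_simps)
qed

lemma tan_lap_sep: "tan_lap q (sep e k1 k2 z) =
    2 * (T1 e q - k1) * tan_lap q (T1 e) + 2 * (T2 e q - k2) * tan_lap q (T2 e)
    + 16 * (rho4 q / (xsq q)\<^sup>2 * modsq e q * (e \<bullet> e - modsq e q / xsq q))
    + 4 * (snd q - z) ^ 3 * tan_lap q snd + 12 * (snd q - z)\<^sup>2 * tan_inner q snd snd"
  unfolding sep_def[abs_def]
  by (subst tan_lap_add[OF _ _ q], (intro C2_rules C2_T1 C2_T2)+, subst tan_lap_add[OF _ _ q], (intro C2_rules C2_T1 C2_T2)+)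
    (simp only: tan_lap_square_shift[OF C2_T1] tan_lap_square_shift[OF C2_T2] tan_lap_quart tan_inner_T[OF q], simp)

lemma tan_inner_sep_nonneg: "tan_inner q (sep e k1 k2 z) (sep e k1 k2 z) \<ge> 0"
proof -
  have "modsq e q / xsq q \<le> e \<bullet> e"
    using modsq_le[of e q] xsq_pos[OF q] by (simp add: field_simps)
  moreover have "modsq e q \<ge> 0" by (simp add: modsq_def)
  moreover have "0 \<le> (snd q - z) ^ 6" by simp
  ultimately show ?thesis
    unfolding tan_inner_sep using xsq_pos[OF q] rho4_nonaxis[OF q]
    by (intro add_nonneg_nonneg mult_nonneg_nonneg divide_nonneg_nonneg) auto
qed

text \<open>Uses \<open>n \<ge> 2\<close>: the sign comes from \<open>tan_lap T = - 4 (n - 1) T / \<bar>x\<bar>\<^sup>2\<close> for \<open>T = T1, T2\<close>.\<close>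

lemma tan_lap_sep_neg:
  assumes n: "CARD('n) \<ge> 2" and Q: "tan_inner q (sep e k1 k2 z) (sep e k1 k2 z) = 0"
    and m: "modsq e q > 0" and pos: "sep e k1 k2 z q > 0"
    and S: "rho4 q * (e \<bullet> e)\<^sup>2 > k1\<^sup>2 + k2\<^sup>2"
  shows "tan_lap q (sep e k1 k2 z) < 0"
proof -
  define Q0 where "Q0 = rho4 q / (xsq q)\<^sup>2 * modsq e q * (e \<bullet> e - modsq e q / xsq q)"
  note p = xsq_pos[OF q] rho4_nonaxis[OF q]
  have "modsq e q / xsq q \<le> e \<bullet> e"
    using modsq_le[of e q] p by (simp add: field_simps)
  then have Q0: "Q0 \<ge> 0" unfolding Q0_def using m p by (intro mult_nonneg_nonneg) auto
  have "16 * Q0 * ((T1 e q - k1)\<^sup>2 + (T2 e q - k2)\<^sup>2) + 16 * (snd q - z) ^ 6 * (xsq q ^ 3 / rho4 q) = 0"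
    using Q by (simp add: tan_inner_sep Q0_def)
  moreover have "16 * Q0 * ((T1 e q - k1)\<^sup>2 + (T2 e q - k2)\<^sup>2) \<ge> 0" using Q0 by simp
  moreover have "16 * (snd q - z) ^ 6 * (xsq q ^ 3 / rho4 q) \<ge> 0" using p by (simp add: zero_le_even_power)
  ultimately have "Q0 * ((T1 e q - k1)\<^sup>2 + (T2 e q - k2)\<^sup>2) = 0" "(snd q - z) ^ 6 * (xsq q ^ 3 / rho4 q) = 0"
    by linarith+
  then have z: "snd q = z" and "Q0 = 0 \<or> (T1 e q - k1)\<^sup>2 + (T2 e q - k2)\<^sup>2 = 0"
    using p by auto
  moreover have "(T1 e q - k1)\<^sup>2 + (T2 e q - k2)\<^sup>2 > 0"
    using pos z by (simp add: sep_def power2_eq_square)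
  ultimately have Q00: "Q0 = 0" by auto
  \<comment> \<open>This is the equality case of Bessel's inequality; there |T| attains the largest
    value allowed on the sphere, rho^2 |e|^2.\<close>
  then have mE: "modsq e q = xsq q * (e \<bullet> e)" unfolding Q0_def using m p by (auto simp: field_simps)
  have "(T1 e q)\<^sup>2 + (T2 e q)\<^sup>2 = rho4 q * (e \<bullet> e)\<^sup>2"
    unfolding T_norm'[OF q] mE using p by (simp add: power2_eq_square)
  then have "k1\<^sup>2 + k2\<^sup>2 < (T1 e q)\<^sup>2 + (T2 e q)\<^sup>2" using S by simp
  \<comment> \<open>Since |T| > |k|, the real part of (T - k) times the conjugate of T is positive:
    twice it equals |T - k|^2 + |T|^2 - |k|^2.\<close>
  then have "(T1 e q - k1) * T1 e q + (T2 e q - k2) * T2 e q > 0"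
    using sum_squares_ge_zero[of "T1 e q - k1" "T2 e q - k2"] by (simp add: power2_eq_square algebra_simps)
  then have "0 < (8 * (real CARD('n) - 1) / xsq q) * ((T1 e q - k1) * T1 e q + (T2 e q - k2) * T2 e q)"
    using n p by (intro mult_pos_pos divide_pos_pos) auto
  moreover have "tan_lap q (sep e k1 k2 z) = - ((8 * (real CARD('n) - 1) / xsq q) * ((T1 e q - k1) * T1 e q + (T2 e q - k2) * T2 e q))"
    unfolding tan_lap_sep Q0_def[symmetric] Q00 z tan_lap_T'[OF q] using p by (simp add: field_simps)
  ultimately show ?thesis by simp
qed

end

text \<open>Where \<open>P\<close> is nonnegative, \<open>Q\<close> is positive, hence bounded below
  there by compactness. The multiplier becomes the exponent of Hopf's barrier: it makes the gradient
  term dominate the operator on all of a compact set.\<close>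

lemma exists_multiplier:
  fixes P Q :: "'a::metric_space \<Rightarrow> real"
  assumes F: "compact F" and c: "continuous_on F P" "continuous_on F Q"
    and Q: "\<And>x. x \<in> F \<Longrightarrow> Q x \<ge> 0" and P: "\<And>x. x \<in> F \<Longrightarrow> Q x = 0 \<Longrightarrow> P x < 0"
  obtains l :: real where "l > 0" "\<And>x. x \<in> F \<Longrightarrow> l * Q x - P x > 0"
proof -
  define K where "K = {x \<in> F. P x \<ge> 0}"
  have cK: "compact K"
  proof -
    have "closedin (top_of_set F) (F \<inter> P -` {0..})"
      by (intro continuous_closedin_preimage c) auto
    then have "compact (F \<inter> P -` {0..})" using F closedin_compact by blast
    moreover have "F \<inter> P -` {0..} = K" by (auto simp: K_def)
    ultimately show ?thesis by simp
  qed
  show ?thesis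
  proof (cases "K = {}")
    case True
    show ?thesis
    proof (rule that[of 1])
      fix x assume "x \<in> F"
      then show "1 * Q x - P x > 0" using True Q[of x] by (force simp: K_def)
    qed simp
  next
    case False
    have KF: "K \<subseteq> F" by (auto simp: K_def)
    obtain a where a: "a \<in> K" "\<And>x. x \<in> K \<Longrightarrow> Q a \<le> Q x"
      using continuous_attains_inf[OF cK False continuous_on_subset[OF c(2) KF]] by blast
    obtain b where b: "b \<in> K" "\<And>x. x \<in> K \<Longrightarrow> P x \<le> P b"
      using continuous_attains_sup[OF cK False continuous_on_subset[OF c(1) KF]] by blast
    have Qa: "Q a > 0" using a(1) P[of a] Q[of a] by (force simp: K_def)
    have Pb: "P b \<ge> 0" using b(1) by (simp add: K_def)
    define l where "l = (P b + 1) / Q a"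
    have l: "l > 0" using Pb Qa by (simp add: l_def)
    show ?thesis
    proof (rule that[OF l])
      fix x assume x: "x \<in> F"
      show "l * Q x - P x > 0"
      proof (cases "P x \<ge> 0")
        case True
        then have xK: "x \<in> K" using x by (simp add: K_def)
        have "P b + 1 = l * Q a" using Qa by (simp add: l_def)
        also have "\<dots> \<le> l * Q x" using a(2)[OF xK] l by simp
        finally show ?thesis using b(2)[OF xK] by simp
      next
        case False
        then show ?thesis using Q[OF x] l by (smt (verit) mult_nonneg_nonneg)
      qed
    qed
  qed
qed

lemma continuous_tan_inner:
  assumes h: "C2 h W" and W: "W \<subseteq> nonaxis"
  shows "continuous_on W (\<lambda>q. tan_inner q h h)"
proof -
  have "continuous_on W (\<lambda>q. D1 h q (lift q (Pt q)))"
  proof -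
    have "continuous_on W (\<lambda>q. hor_grad q (D1 h q) \<bullet> Pt q)"
      by (intro continuous_intros continuous_hor_grad h continuous_Pt)
    then show ?thesis
      by (subst continuous_on_cong[OF refl]) (auto simp: hor_grad_inner[OF has_jetD(4)[OF C2_jet[OF h]]])
  qed
  moreover have "rho4 q \<noteq> 0" "xsq q \<noteq> 0" if "q \<in> W" for q
    using that W rho4_nonaxis[of q] xsq_pos[of q] by auto
  ultimately show ?thesis
    unfolding tan_inner_def xsq_def[symmetric]
    by (intro continuous_intros continuous_hor_grad h continuous_rho4 continuous_xsq) auto
qed

lemma exp_barrier:
  assumes g: "C2 g W"
  shows "C2 (\<lambda>q. exp (- l * g q)) W"
    and "q \<in> W \<Longrightarrow> tan_lap q (\<lambda>q. exp (- l * g q)) = l * exp (- l * g q) * (l * tan_inner q g g - tan_lap q g)"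
proof -
  have j: "has_jet (\<lambda>q. exp (- l * g q)) W (\<lambda>q v. (- l * exp (- l * g q)) * D1 g q v)
     (\<lambda>q v w. (- l * exp (- l * g q)) * D2 g q v w + (l * l * exp (- l * g q)) * (D1 g q v * D1 g q w))"
    by (rule jet_compose[OF g, where h = "\<lambda>s. exp (- l * s)" and h' = "\<lambda>s. - l * exp (- l * s)" and h'' = "\<lambda>s. l * l * exp (- l * s)"])
      (auto intro!: derivative_eq_intros continuous_intros)
  show "C2 (\<lambda>q. exp (- l * g q)) W" by (rule has_jet_C2[OF j])
  show "q \<in> W \<Longrightarrow> tan_lap q (\<lambda>q. exp (- l * g q)) = l * exp (- l * g q) * (l * tan_inner q g g - tan_lap q g)"
    using tan_lap_compose[where h = "\<lambda>s. exp (- l * s)" and h' = "\<lambda>s. - l * exp (- l * s)" and h'' = "\<lambda>s. l * l * exp (- l * s)" and f = g, OF j]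
    by (simp add: algebra_simps)
qed

lemma smooth_on_C2:
  assumes s: "smooth_on W \<phi>" and W: "open W"
  shows "C2 \<phi> W"
proof -
  from s have "Ck_on (Suc (Suc 0)) W \<phi>" unfolding smooth_on_def by blast
  then have "\<forall>x\<in>W. \<phi> differentiable (at x)"
    "\<forall>v. (\<forall>x\<in>W. (\<lambda>x. D1 \<phi> x v) differentiable (at x)) \<and> (\<forall>w. continuous_on W (\<lambda>x. D2 \<phi> x v w))"
    by (simp_all add: D1_def D2_def)
  then show ?thesis
    unfolding C2_def has_jet_def using W
    by (auto simp: D1_def[of \<phi>, symmetric] D2_def[symmetric] frechet_derivative_works)
qed

section \<open>Comparison along immersed hypersurfaces\<close>

lemma complement_of_range:
  fixes L :: "'e::euclidean_space \<Rightarrow> 'b::euclidean_space"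
  assumes L: "linear L" "inj L" and D: "DIM('b) = Suc (DIM('e))" and n: "n \<notin> range L"
  obtains w s where "v = L w + s *\<^sub>R n"
proof -
  define M where "M = (\<lambda>(w, s). L w + s *\<^sub>R n)"
  have lM: "linear M"
    unfolding M_def by (rule linearI) (auto simp: linear_add[OF L(1)] linear_scale[OF L(1)] algebra_simps)
  have "M x = 0 \<Longrightarrow> x = 0" for x
  proof (cases x)
    case (Pair w s)
    assume "M x = 0"
    then have eq: "L w + s *\<^sub>R n = 0" by (simp add: M_def Pair)
    have "s = 0"
    proof (rule ccontr)
      assume "s \<noteq> 0"
      have "L ((- inverse s) *\<^sub>R w) = (- inverse s) *\<^sub>R L w" by (rule linear_scale[OF L(1)])
      also have "L w = (- s) *\<^sub>R n" using eq by (simp add: eq_neg_iff_add_eq_0)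
      finally have "L ((- inverse s) *\<^sub>R w) = n" using \<open>s \<noteq> 0\<close> by simp
      then show False using n by blast
    qed
    then have "L w = L 0" using eq by (simp add: linear_0[OF L(1)])
    then show "x = 0" using L(2) \<open>s = 0\<close> by (simp add: Pair inj_eq zero_prod_def)
  qed
  then have "inj M" using linear_injective_0[OF lM] by blast
  have "dim (range M) = DIM('b)"
    using dim_image_eq[OF lM, of UNIV] \<open>inj M\<close> D by (simp add: dim_UNIV)
  then have "range M = UNIV"
    using dim_eq_full[of "range M"] span_linear_image[OF lM, of UNIV] by (metis span_UNIV)
  then obtain x where "v = M x" by (metis rangeE UNIV_I)
  then show ?thesis using that by (cases x) (auto simp: M_def)
qed

text \<open>Both differentials vanish on the tangent space, so they are proportional, and
  \<open>u\<close> shows the factor to be positive. The combination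
  \<open>l * \<Phi> - \<phi>\<close> then has zero full differential and a maximum along
  \<open>F\<close>, which orders the two Hessians on all of the common kernel.\<close>

lemma mean_op_comparison:
  fixes F :: "'e::euclidean_space \<Rightarrow> 'n::finite heis"
  assumes D: "DIM('n heis) = Suc (DIM('e))"
    and j: "has_jet \<phi> W d b" "has_jet \<Phi> V d' b'" and q: "F y \<in> W" "F y \<in> V"
    and F: "\<forall>\<^sub>F z in nhds y. (F has_derivative F' z) (at z)"
    and F'': "\<And>w. ((\<lambda>z. F' z w) has_derivative F'' w) (at y)"
    and inj: "inj (F' y)" and n: "n \<notin> range (F' y)"
    and const: "\<forall>\<^sub>F z in nhds y. \<phi> (F z) = \<phi> (F y)"
    and max: "\<forall>\<^sub>F z in nhds y. \<Phi> (F z) \<le> \<Phi> (F y)"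
    and pos: "d (F y) u > 0" "d' (F y) u > 0"
    and ns: "hor_grad (F y) (d' (F y)) \<noteq> 0"
  obtains l where "l > 0" "d (F y) = (\<lambda>v. l * d' (F y) v)"
    "mean_op (F y) (d (F y)) (b (F y)) \<ge> l ^ 3 * mean_op (F y) (d' (F y)) (b' (F y))"
proof -
  let ?q = "F y"
  have Fy: "(F has_derivative F' y) (at y)" using eventually_nhds_x_imp_x[OF F] .
  have lin: "linear (F' y)" using Fy by (rule has_derivative_linear)
  note J = has_jetD[OF j(1) q(1)] and J' = has_jetD[OF j(2) q(2)]
  have crit': "d' ?q (F' y w) = 0" for w
  proof -
    obtain S where S: "open S" "y \<in> S" "\<forall>z\<in>S. \<Phi> (F z) \<le> \<Phi> (F y)"
      using max unfolding eventually_nhds by blast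
    have "(\<lambda>w. d' ?q (F' y w)) = (\<lambda>v. 0)"
      using differential_zero_maxmin[OF S(2,1) has_derivative_compose[OF Fy J'(1)]] S(3) by blast
    then show ?thesis by meson
  qed
  have crit: "d ?q (F' y w) = 0" for w
  proof -
    obtain S where S: "open S" "y \<in> S" "\<forall>z\<in>S. \<phi> (F z) = \<phi> (F y)"
      using const unfolding eventually_nhds by blast
    have "(\<lambda>w. d ?q (F' y w)) = (\<lambda>v. 0)"
      using differential_zero_maxmin[OF S(2,1) has_derivative_compose[OF Fy J(1)]] S(3) by auto
    then show ?thesis by meson
  qed
  have dec: "\<exists>w s. v = F' y w + s *\<^sub>R n" for v
    by (rule complement_of_range[OF lin inj D n, of v]) blast
  have dv: "d ?q (F' y w + s *\<^sub>R n) = s * d ?q n" "d' ?q (F' y w + s *\<^sub>R n) = s * d' ?q n" for w s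
    by (simp_all add: linear_add[OF J(4)] linear_scale[OF J(4)] crit linear_add[OF J'(4)] linear_scale[OF J'(4)] crit')
  have n': "d' ?q n \<noteq> 0"
  proof
    assume "d' ?q n = 0"
    then have "d' ?q u = 0" using dec[of u] dv by auto
    then show False using pos by simp
  qed
  define l where "l = d ?q n / d' ?q n"
  have dl: "d ?q = (\<lambda>v. l * d' ?q v)"
  proof
    fix v
    obtain w s where v: "v = F' y w + s *\<^sub>R n" using dec by blast
    show "d ?q v = l * d' ?q v" unfolding v dv using n' by (simp add: l_def)
  qed
  have l: "l > 0" using pos unfolding fun_cong[OF dl, of u] by (simp add: zero_less_mult_iff)
  have le: "b ?q \<tau> \<tau> \<ge> l * b' ?q \<tau> \<tau>" if \<tau>: "d' ?q \<tau> = 0" for \<tau>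
  proof -
    obtain w s where v: "\<tau> = F' y w + s *\<^sub>R n" using dec by blast
    have "s = 0" using \<tau> n' unfolding v dv by simp
    then have v: "\<tau> = F' y w" using v by simp
    \<comment> \<open>Subtracting \<open>\<phi>\<close>, constant along the surface, cancels the
      differential in the normal direction too; the second fundamental form of the surface is
      thereby accounted for.\<close>
    have "l * b' ?q (F' y w) (F' y w) + (- 1) * b ?q (F' y w) (F' y w) \<le> 0"
    proof (rule second_order_local_max[OF has_jet_linear_comb[OF j(2) j(1)] F F''[of w]])
      show "F y \<in> V \<inter> W" using q by blast
      show "l * d' ?q v + (- 1) * d ?q v = 0" for v by (simp add: dl)
      show "\<forall>\<^sub>F z in nhds y. l * \<Phi> (F z) + (- 1) * \<phi> (F z) \<le> l * \<Phi> (F y) + (- 1) * \<phi> (F y)"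
        using max const by eventually_elim (use l in simp)
    qed
    then show ?thesis by (simp add: v)
  qed
  have "mean_op ?q (d ?q) (b ?q) \<ge> l ^ 3 * mean_op ?q (d' ?q) (b' ?q)"
    unfolding dl
    by (rule mean_op_mono[OF l J'(4) ns has_jet_linear_left[OF j(2) q(2)] J'(5) has_jet_linear_left[OF j(1) q(1)] J(5) le])
  with l dl show ?thesis by (rule that)
qed

text \<open>The surface is studied through an inverse chart. The clause on images of open sets
  carries neighbourhoods in the parameter space over to the manifold.\<close>

lemma chart_at:
  fixes A :: "('m::t2_space set \<times> ('m \<Rightarrow> 'e::euclidean_space)) set"
    and f N :: "'m \<Rightarrow> 'b::euclidean_space"
  assumes atlas: "smooth_atlas A" and imm: "smooth_immersion A f" and co: "coorientation A f N"
  shows "\<exists>(V :: 'e set) y h. open V \<and> y \<in> V \<and> continuous_on V h \<and> h y = p \<and>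
    (\<forall>B. open B \<longrightarrow> B \<subseteq> V \<longrightarrow> open (h ` B)) \<and>
    smooth_on V (f \<circ> h) \<and> (\<forall>z\<in>V. inj (frechet_derivative (f \<circ> h) (at z))) \<and>
    N p \<notin> range (frechet_derivative (f \<circ> h) (at y))"
proof -
  have "p \<in> (\<Union>(U, \<psi>)\<in>A. U)" using atlas unfolding smooth_atlas_def by auto
  then obtain U \<psi> where U: "(U, \<psi>) \<in> A" "p \<in> U" by auto
  let ?h = "inv_into U \<psi>"
  have o: "open U" "open (\<psi> ` U)" and hom: "homeomorphism U (\<psi> ` U) \<psi> ?h"
    using atlas U(1) unfolding smooth_atlas_def by auto
  have hp: "?h (\<psi> p) = p" using hom U(2) by (auto simp: homeomorphism_def)
  show ?thesis
  proof (intro exI[of _ "\<psi> ` U"] exI[of _ "\<psi> p"] exI[of _ ?h] conjI)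
    show "\<forall>B. open B \<longrightarrow> B \<subseteq> \<psi> ` U \<longrightarrow> open (?h ` B)"
    proof (intro allI impI)
      fix B assume that: "open B" "B \<subseteq> \<psi> ` U"
      have "?h ` B = U \<inter> \<psi> -` B"
        using hom that(2) unfolding homeomorphism_def by (auto simp: image_iff) metis+
      moreover have "open (U \<inter> \<psi> -` B)"
        using hom o(1) that(1) by (metis homeomorphism_def continuous_open_preimage)
      ultimately show "open (?h ` B)" by simp
    qed
    show "smooth_on (\<psi> ` U) (f \<circ> ?h)" "\<forall>z\<in>\<psi> ` U. inj (frechet_derivative (f \<circ> ?h) (at z))"
      using imm U(1) unfolding smooth_immersion_def by auto
    show "N p \<notin> range (frechet_derivative (f \<circ> ?h) (at (\<psi> p)))"
      using bspec[OF conjunct2[OF co[unfolded coorientation_def]] U(1)] U(2) by simp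
    show "continuous_on (\<psi> ` U) ?h" using hom by (simp add: homeomorphism_def)
  qed (use o U hp in auto)
qed

lemma smooth_on_derivatives:
  fixes F :: "'a::real_normed_vector \<Rightarrow> 'b::real_normed_vector"
  assumes "smooth_on V F" "z \<in> V"
  shows "(F has_derivative frechet_derivative F (at z)) (at z)"
    "((\<lambda>z. frechet_derivative F (at z) w) has_derivative
      frechet_derivative (\<lambda>z. frechet_derivative F (at z) w) (at z)) (at z)"
proof -
  from assms have "Ck_on (Suc (Suc 0)) V F" unfolding smooth_on_def by blast
  then show "(F has_derivative frechet_derivative F (at z)) (at z)"
    "((\<lambda>z. frechet_derivative F (at z) w) has_derivative
      frechet_derivative (\<lambda>z. frechet_derivative F (at z) w) (at z)) (at z)"
    using assms(2) by (auto simp: frechet_derivative_works)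
qed

lemma differential_apply:
  fixes \<phi> :: "'a::euclidean_space \<Rightarrow> real"
  assumes "C2 \<phi> W" "q \<in> W"
  shows "blinfun_apply (differential \<phi> q) = D1 \<phi> q"
  using has_jetD(4)[OF C2_jet[OF assms(1)] assms(2)]
  by (simp add: differential_def D1_def[symmetric] bounded_linear_Blinfun_apply linear_conv_bounded_linear)

context
  fixes A :: "('m::t2_space set \<times> ('m \<Rightarrow> real ^ ('n::{finite,linorder} + 'n))) set"
    and f N :: "'m \<Rightarrow> 'n heis"
  assumes atlas: "smooth_atlas A" and imm: "smooth_immersion A f" "0 \<notin> range f"
    and co: "coorientation A f N"
begin

lemma surface_comparison:
  assumes j: "has_jet \<phi> W d b" "has_jet \<Phi> V d' b'" and q: "f p \<in> W" "f p \<in> V"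
    and const: "\<forall>\<^sub>F p' in nhds p. \<phi> (f p') = \<phi> (f p)"
    and max: "\<forall>\<^sub>F p' in nhds p. \<Phi> (f p') \<le> \<Phi> (f p)"
    and pos: "d (f p) u > 0" "d' (f p) u > 0"
    and ns: "hor_grad (f p) (d' (f p)) \<noteq> 0"
  obtains l where "l > 0" "d (f p) = (\<lambda>v. l * d' (f p) v)"
    "mean_op (f p) (d (f p)) (b (f p)) \<ge> l ^ 3 * mean_op (f p) (d' (f p)) (b' (f p))"
proof -
  obtain V0 :: "(real ^ ('n + 'n)) set" and y h where h: "open V0" "y \<in> V0" "continuous_on V0 h" "h y = p"
    and h5: "smooth_on V0 (f \<circ> h)" and h6: "\<forall>z\<in>V0. inj (frechet_derivative (f \<circ> h) (at z))"
    and h7: "N p \<notin> range (frechet_derivative (f \<circ> h) (at y))"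
    using chart_at[OF atlas imm(1) co, of p] by metis
  have lim: "filterlim h (nhds p) (nhds y)"
    using h(1-4) by (metis continuous_on_eq_continuous_at isCont_def tendsto_at_iff_tendsto_nhds)
  show ?thesis
  proof (rule mean_op_comparison[where F = "f \<circ> h" and y = y and F' = "\<lambda>z. frechet_derivative (f \<circ> h) (at z)" and n = "N p" and u = u,
        OF _ j])
    show "DIM('n heis) = Suc DIM(real ^ ('n + 'n))" by simp
    show "\<forall>\<^sub>F z in nhds y. ((f \<circ> h) has_derivative frechet_derivative (f \<circ> h) (at z)) (at z)"
      using eventually_nhds_in_open[OF h(1,2)] by eventually_elim (rule smooth_on_derivatives(1)[OF h5])
    show "((\<lambda>z. frechet_derivative (f \<circ> h) (at z) w) has_derivative
        frechet_derivative (\<lambda>z. frechet_derivative (f \<circ> h) (at z) w) (at y)) (at y)" for w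
      by (rule smooth_on_derivatives(2)[OF h5 h(2)])
    show "\<forall>\<^sub>F z in nhds y. \<phi> ((f \<circ> h) z) = \<phi> ((f \<circ> h) y)"
      using eventually_compose_filterlim[OF const lim] by (simp add: h(4))
    show "\<forall>\<^sub>F z in nhds y. \<Phi> ((f \<circ> h) z) \<le> \<Phi> ((f \<circ> h) y)"
      using eventually_compose_filterlim[OF max lim] by (simp add: h(4))
  qed (use q h h6 h7 pos ns that in \<open>simp_all add: h(4)\<close>)
qed

end

text \<open>The same function is a defining function at all nearby parameters. This matters because
  a perturbed maximum is attained at a different parameter from the one at which the sheet was
  chosen.\<close>

lemma local_defining_functionE:
  assumes "local_defining_function f N p \<phi>"
  obtains U W where "open U" "p \<in> U" "open W" "0 \<notin> W" "C2 \<phi> W" "f ` U = {q \<in> W. \<phi> q = 0}"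
    "\<forall>p'\<in>U. f p' \<in> W \<and> \<phi> (f p') = 0 \<and> D1 \<phi> (f p') (N p') > 0"
    "\<forall>p'\<in>U. local_defining_function f N p' \<phi>"
proof -
  from assms obtain U W where U: "open U" "p \<in> U" "open W" "0 \<notin> W" "smooth_on W \<phi>"
    "\<forall>q\<in>W. differential \<phi> q \<noteq> 0" "f ` U = {q \<in> W. \<phi> q = 0}"
    "\<forall>p'\<in>U. blinfun_apply (differential \<phi> (f p')) (N p') > 0"
    unfolding local_defining_function_def by blast
  have c: "C2 \<phi> W" by (rule smooth_on_C2[OF U(5,3)])
  show ?thesis
  proof (rule that[OF U(1-4) c U(7)])
    show "\<forall>p'\<in>U. f p' \<in> W \<and> \<phi> (f p') = 0 \<and> D1 \<phi> (f p') (N p') > 0"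
    proof
      fix p' assume that: "p' \<in> U"
      have "f p' \<in> W \<and> \<phi> (f p') = 0" using U(7) that by blast
      then show "f p' \<in> W \<and> \<phi> (f p') = 0 \<and> D1 \<phi> (f p') (N p') > 0"
        using U(8) that by (auto simp: differential_apply[OF c])
    qed
    show "\<forall>p'\<in>U. local_defining_function f N p' \<phi>"
      using U unfolding local_defining_function_def by blast
  qed
qed

lemma conorm_D1:
  assumes "C2 \<phi> W" "q \<in> W" "q \<noteq> 0"
  shows "conorm q (differential \<phi> q) = rho q * norm (hor_grad q (D1 \<phi> q))"
  using assms by (simp add: conorm_eq differential_apply)

context
  fixes A :: "('m::t2_space set \<times> ('m \<Rightarrow> real ^ ('n::{finite,linorder} + 'n))) set"
    and f N :: "'m \<Rightarrow> 'n heis"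
  assumes atlas: "smooth_atlas A" and imm: "smooth_immersion A f" "0 \<notin> range f"
    and co: "coorientation A f N"
begin

text \<open>Two defining functions with the same coorientation can be compared in either direction,
  as each is constant along the surface. The two inequalities give equality, and the quotient is
  homogeneous of degree zero, so the value is independent of the choice.\<close>

lemma H_surf_eq:
  assumes l: "local_defining_function f N p \<phi>" and ns: "hor_grad (f p) (D1 \<phi> (f p)) \<noteq> 0"
  shows "nonsingular_at f N p"
    "H_surf f N p = rho (f p) * mean_op (f p) (D1 \<phi> (f p)) (D2 \<phi> (f p)) / norm (hor_grad (f p) (D1 \<phi> (f p))) ^ 3"
proof -
  have q0: "f p \<noteq> 0" using imm(2) by (metis rangeI)
  obtain U W where U: "open U" "p \<in> U" and "open W" "0 \<notin> W" and U3: "C2 \<phi> W" and "f ` U = {q \<in> W. \<phi> q = 0}"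
    and U4: "\<forall>p'\<in>U. f p' \<in> W \<and> \<phi> (f p') = 0 \<and> D1 \<phi> (f p') (N p') > 0"
    and "\<forall>p'\<in>U. local_defining_function f N p' \<phi>"
    by (rule local_defining_functionE[OF l])
  note p = bspec[OF U4 U(2)]
  show "nonsingular_at f N p"
    unfolding nonsingular_at_def using l ns rho_pos[OF q0] p by (auto simp: conorm_D1[OF U3 _ q0])
  let ?h = "\<lambda>\<phi>. rho (f p) * mean_op (f p) (D1 \<phi> (f p)) (D2 \<phi> (f p)) / norm (hor_grad (f p) (D1 \<phi> (f p))) ^ 3"
  have H: "H_fun \<phi> (f p) = ?h \<phi>"
    by (rule H_fun_eq[OF C2_jet[OF U3] _ q0 ns]) (use p in blast)
  have unique: "H_fun \<phi>' (f p) = ?h \<phi>" if l': "local_defining_function f N p \<phi>'" for \<phi>'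
  proof -
    obtain U' W' where U': "open U'" "p \<in> U'" and "open W'" "0 \<notin> W'" and U3': "C2 \<phi>' W'" and "f ` U' = {q \<in> W'. \<phi>' q = 0}"
      and U4': "\<forall>p'\<in>U'. f p' \<in> W' \<and> \<phi>' (f p') = 0 \<and> D1 \<phi>' (f p') (N p') > 0"
      and "\<forall>p'\<in>U'. local_defining_function f N p' \<phi>'"
      by (rule local_defining_functionE[OF l'])
    note p' = bspec[OF U4' U'(2)]
    have ev: "\<forall>\<^sub>F p' in nhds p. \<phi> (f p') = \<phi> (f p)"
      using eventually_nhds_in_open[OF U(1,2)] by eventually_elim (use U4 p in simp)
    have ev': "\<forall>\<^sub>F p' in nhds p. \<phi>' (f p') = \<phi>' (f p)"
      using eventually_nhds_in_open[OF U'(1,2)] by eventually_elim (use U4' p' in simp)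
    have le: "\<forall>\<^sub>F p' in nhds p. \<phi> (f p') \<le> \<phi> (f p)" "\<forall>\<^sub>F p' in nhds p. \<phi>' (f p') \<le> \<phi>' (f p)"
      using ev ev' by (auto elim: eventually_mono)
    obtain c where c: "c > 0" "D1 \<phi>' (f p) = (\<lambda>v. c * D1 \<phi> (f p) v)"
      "mean_op (f p) (D1 \<phi>' (f p)) (D2 \<phi>' (f p)) \<ge> c ^ 3 * mean_op (f p) (D1 \<phi> (f p)) (D2 \<phi> (f p))"
      using surface_comparison[OF atlas imm co C2_jet[OF U3'] C2_jet[OF U3] _ _ ev' le(1), of "N p"] p p' ns by metis
    have g: "hor_grad (f p) (D1 \<phi>' (f p)) = c *\<^sub>R hor_grad (f p) (D1 \<phi> (f p))"
      unfolding c(2) by (rule hor_grad_cmult)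
    then have ns': "hor_grad (f p) (D1 \<phi>' (f p)) \<noteq> 0" using ns c(1) by simp
    obtain c' where c': "c' > 0" "D1 \<phi> (f p) = (\<lambda>v. c' * D1 \<phi>' (f p) v)"
      "mean_op (f p) (D1 \<phi> (f p)) (D2 \<phi> (f p)) \<ge> c' ^ 3 * mean_op (f p) (D1 \<phi>' (f p)) (D2 \<phi>' (f p))"
      using surface_comparison[OF atlas imm co C2_jet[OF U3] C2_jet[OF U3'] _ _ ev le(2), of "N p"] p p' ns' by metis
    \<comment> \<open>The two proportionality factors are reciprocal, since the derivative along the
      coorientation is not zero.\<close>
    have "D1 \<phi> (f p) (N p) = (c * c') * D1 \<phi> (f p) (N p)"
      using fun_cong[OF c(2), of "N p"] fun_cong[OF c'(2), of "N p"] by (simp add: mult.commute mult.left_commute)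
    then have "c * c' = 1" using p by simp
    then have "c ^ 3 * c' ^ 3 = 1" by (metis power_mult_distrib power_one)
    then have "c ^ 3 * mean_op (f p) (D1 \<phi> (f p)) (D2 \<phi> (f p)) \<ge> mean_op (f p) (D1 \<phi>' (f p)) (D2 \<phi>' (f p))"
      using mult_left_mono[OF c'(3), of "c ^ 3"] c(1) by (simp add: mult.assoc[symmetric])
    then have M: "mean_op (f p) (D1 \<phi>' (f p)) (D2 \<phi>' (f p)) = c ^ 3 * mean_op (f p) (D1 \<phi> (f p)) (D2 \<phi> (f p))"
      using c(3) by simp
    have "H_fun \<phi>' (f p) = ?h \<phi>'"
      by (rule H_fun_eq[OF C2_jet[OF U3'] _ q0 ns']) (use p' in blast)
    also have "\<dots> = ?h \<phi>"
      unfolding M g using c(1) by (simp add: power_mult_distrib)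
    finally show ?thesis .
  qed
  show "H_surf f N p = ?h \<phi>"
    unfolding H_surf_def using l H unique by (intro the_equality) auto
qed

text \<open>A strict subsolution cannot attain a local maximum along the surface. The sign
  \<open>\<sigma>\<close> covers touching from inside and outside at once: \<open>mean_op\<close> is
  odd under a change of sign of the function, so the comparison is made with
  \<open>\<sigma> * \<phi>\<close> and the direction \<open>\<sigma> *\<^sub>R u\<close>.\<close>

lemma no_touching:
  fixes \<sigma> :: real
  assumes l: "local_defining_function f N p \<phi>" and \<sigma>: "\<sigma> * \<sigma> = 1"
    and H: "nonsingular_at f N p \<Longrightarrow> \<sigma> * H_surf f N p \<le> 0"
    and j: "has_jet \<Phi> V d b" "f p \<in> V" and max: "\<forall>\<^sub>F p' in nhds p. \<Phi> (f p') \<le> \<Phi> (f p)"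
    and pos: "D1 \<phi> (f p) u > 0" "\<sigma> * d (f p) u > 0"
    and ns: "hor_grad (f p) (d (f p)) \<noteq> 0"
    and M: "mean_op (f p) (d (f p)) (b (f p)) > 0"
  shows False
proof -
  have q0: "f p \<noteq> 0" using imm(2) by (metis rangeI)
  obtain U W where U: "open U" "p \<in> U" and "open W" "0 \<notin> W" and U3: "C2 \<phi> W" and "f ` U = {q \<in> W. \<phi> q = 0}"
    and U4: "\<forall>p'\<in>U. f p' \<in> W \<and> \<phi> (f p') = 0 \<and> D1 \<phi> (f p') (N p') > 0"
    and "\<forall>p'\<in>U. local_defining_function f N p' \<phi>"
    by (rule local_defining_functionE[OF l])
  note p = bspec[OF U4 U(2)]
  note jet = C2_jet[OF U3]
  have "has_jet (\<lambda>q. \<sigma> * \<phi> q + 0 * \<phi> q) (W \<inter> W) (\<lambda>q v. \<sigma> * D1 \<phi> q v + 0 * D1 \<phi> q v)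
     (\<lambda>q v w. \<sigma> * D2 \<phi> q v w + 0 * D2 \<phi> q v w)"
    by (rule has_jet_linear_comb[OF jet jet])
  then have js: "has_jet (\<lambda>q. \<sigma> * \<phi> q) W (\<lambda>q v. \<sigma> * D1 \<phi> q v) (\<lambda>q v w. \<sigma> * D2 \<phi> q v w)" by simp
  have ev: "\<forall>\<^sub>F p' in nhds p. \<sigma> * \<phi> (f p') = \<sigma> * \<phi> (f p)"
    using eventually_nhds_in_open[OF U(1,2)] by eventually_elim (use U4 p in simp)
  have pW: "f p \<in> W" using p by blast
  have "\<sigma> * D1 \<phi> (f p) (\<sigma> *\<^sub>R u) = D1 \<phi> (f p) u" "d (f p) (\<sigma> *\<^sub>R u) = \<sigma> * d (f p) u"
    using \<sigma> by (simp_all add: linear_scale[OF has_jetD(4)[OF j]] linear_scale[OF has_jetD(4)[OF jet pW]] mult.assoc[symmetric])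
  then have pos': "\<sigma> * D1 \<phi> (f p) (\<sigma> *\<^sub>R u) > 0" "d (f p) (\<sigma> *\<^sub>R u) > 0" using pos by simp_all
  obtain c where c: "c > 0" "(\<lambda>v. \<sigma> * D1 \<phi> (f p) v) = (\<lambda>v. c * d (f p) v)"
    "mean_op (f p) (\<lambda>v. \<sigma> * D1 \<phi> (f p) v) (\<lambda>v w. \<sigma> * D2 \<phi> (f p) v w) \<ge> c ^ 3 * mean_op (f p) (d (f p)) (b (f p))"
    by (rule surface_comparison[OF atlas imm co js j(1) pW j(2) ev max pos' ns])
  have g: "\<sigma> *\<^sub>R hor_grad (f p) (D1 \<phi> (f p)) = c *\<^sub>R hor_grad (f p) (d (f p))"
    using arg_cong[OF c(2), of "hor_grad (f p)"] by (simp add: hor_grad_cmult)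
  then have ns': "hor_grad (f p) (D1 \<phi> (f p)) \<noteq> 0" using ns c(1) by auto
  have s: "\<sigma> = 1 \<or> \<sigma> = -1" using \<sigma> by (simp add: square_eq_1_iff)
  have "mean_op (f p) (\<lambda>v. \<sigma> * D1 \<phi> (f p) v) (\<lambda>v w. \<sigma> * D2 \<phi> (f p) v w) = \<sigma> * mean_op (f p) (D1 \<phi> (f p)) (D2 \<phi> (f p))"
  proof -
    note bl = has_jet_linear_left[OF jet pW] has_jetD(5)[OF jet pW]
    have hg: "hor_grad (f p) (\<lambda>v. \<sigma> * D1 \<phi> (f p) v) = \<sigma> *\<^sub>R hor_grad (f p) (D1 \<phi> (f p))"
      by (rule hor_grad_cmult)
    have ss: "\<sigma> * (\<sigma> * r) = r" for r using \<sigma> by (metis mult.assoc mult_1)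
    show ?thesis
      unfolding mean_op_def Let_def hg hor_trace_cmult linear_scale[OF linear_lift] linear_scale[OF bl(1)] linear_scale[OF bl(2)]
      by (simp add: ss algebra_simps)
  qed
  moreover have "c ^ 3 * mean_op (f p) (d (f p)) (b (f p)) > 0" using c(1) M by simp
  ultimately have "\<sigma> * mean_op (f p) (D1 \<phi> (f p)) (D2 \<phi> (f p)) > 0" using c(3) by simp
  then have "(rho (f p) / norm (hor_grad (f p) (D1 \<phi> (f p))) ^ 3) * (\<sigma> * mean_op (f p) (D1 \<phi> (f p)) (D2 \<phi> (f p))) > 0"
    using rho_pos[OF q0] ns' by (intro mult_pos_pos[OF _ \<open>\<sigma> * mean_op _ _ _ > 0\<close>] divide_pos_pos) auto
  then have "\<sigma> * H_surf f N p > 0"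
    unfolding H_surf_eq(2)[OF l ns'] by (simp add: mult_ac)
  then show False using H H_surf_eq(1)[OF l ns'] by simp
qed

end

section \<open>Smooth local inverses and local defining functions\<close>

lemma Ck_on_cong:
  fixes f g :: "'a::real_normed_vector \<Rightarrow> 'b::real_normed_vector"
  assumes S: "open S"
  shows "Ck_on k S f \<Longrightarrow> (\<And>x. x \<in> S \<Longrightarrow> f x = g x) \<Longrightarrow> Ck_on k S g"
proof (induction k arbitrary: f g)
  case 0
  then show ?case using continuous_on_cong[of S S f g] by simp
next
  case (Suc k)
  have D: "(f has_derivative frechet_derivative f (at x)) (at x)" if "x \<in> S" for x
    using Suc.prems(1) that by (simp add: frechet_derivative_works)
  have D': "(g has_derivative frechet_derivative f (at x)) (at x)" if x: "x \<in> S" for x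
    by (rule has_derivative_transform_within_open[OF D[OF x] S x]) (rule Suc.prems(2))
  have eq: "frechet_derivative f (at x) v = frechet_derivative g (at x) v" if "x \<in> S" for x v
    using frechet_derivative_at[OF D'[OF that]] by simp
  have "Ck_on k S (\<lambda>x. frechet_derivative g (at x) v)" for v
    by (rule Suc.IH[of "\<lambda>x. frechet_derivative f (at x) v"]) (use Suc.prems(1) eq in auto)
  then show ?case using D' by (auto simp: differentiable_def)
qed

lemma Ck_on_SucI:
  fixes f :: "'a::real_normed_vector \<Rightarrow> 'b::real_normed_vector"
  assumes S: "open S" and D: "\<And>x. x \<in> S \<Longrightarrow> (f has_derivative D x) (at x)" and k: "\<And>v. Ck_on k S (\<lambda>x. D x v)"
  shows "Ck_on (Suc k) S f"
proof -
  have eq: "D x v = frechet_derivative f (at x) v" if "x \<in> S" for x v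
    using frechet_derivative_at[OF D[OF that]] by simp
  have "Ck_on k S (\<lambda>x. frechet_derivative f (at x) v)" for v
    by (rule Ck_on_cong[OF S k[of v] eq])
  then show ?thesis using D by (auto simp: differentiable_def)
qed

lemma Ck_on_SucD:
  assumes "Ck_on (Suc k) S f"
  shows "x \<in> S \<Longrightarrow> (f has_derivative frechet_derivative f (at x)) (at x)"
    "Ck_on k S (\<lambda>x. frechet_derivative f (at x) v)"
  using assms by (auto simp: frechet_derivative_works)

lemma Ck_on_lower: "Ck_on (Suc k) S f \<Longrightarrow> Ck_on k S f"
proof (induction k arbitrary: f)
  case 0
  then show ?case
    by (auto intro!: continuous_at_imp_continuous_on differentiable_imp_continuous_within)
next
  case (Suc k)
  then show ?case by (metis Ck_on.simps(2))
qed

lemma Ck_on_const: "open S \<Longrightarrow> Ck_on k S (\<lambda>x. c)"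
  by (induction k arbitrary: c) (auto intro!: Ck_on_SucI)

lemma Ck_on_add:
  assumes S: "open S"
  shows "Ck_on k S f \<Longrightarrow> Ck_on k S g \<Longrightarrow> Ck_on k S (\<lambda>x. f x + g x)"
proof (induction k arbitrary: f g)
  case 0
  then show ?case by (simp add: continuous_on_add)
next
  case (Suc k)
  show ?case
    by (rule Ck_on_SucI[OF S has_derivative_add[OF Ck_on_SucD(1)[OF Suc.prems(1)] Ck_on_SucD(1)[OF Suc.prems(2)]]])
      (auto intro: Suc.IH Ck_on_SucD(2)[OF Suc.prems(1)] Ck_on_SucD(2)[OF Suc.prems(2)])
qed

lemma Ck_on_mult:
  fixes f g :: "'a::real_normed_vector \<Rightarrow> real"
  assumes S: "open S"
  shows "Ck_on k S f \<Longrightarrow> Ck_on k S g \<Longrightarrow> Ck_on k S (\<lambda>x. f x * g x)"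
proof (induction k arbitrary: f g)
  case 0
  then show ?case by (simp add: continuous_on_mult)
next
  case (Suc k)
  show ?case
    by (rule Ck_on_SucI[OF S has_derivative_mult[OF Ck_on_SucD(1)[OF Suc.prems(1)] Ck_on_SucD(1)[OF Suc.prems(2)]]])
      (auto intro!: Ck_on_add[OF S] Suc.IH Ck_on_SucD(2)[OF Suc.prems(1)] Ck_on_SucD(2)[OF Suc.prems(2)]
        Ck_on_lower[OF Suc.prems(1)] Ck_on_lower[OF Suc.prems(2)])
qed

lemma Ck_on_sum:
  assumes "open S" "\<And>i. i \<in> I \<Longrightarrow> Ck_on k S (f i)"
  shows "Ck_on k S (\<lambda>x. \<Sum>i\<in>I. f i x)"
proof (cases "finite I")
  case True
  from True assms(2) show ?thesis
    by (induction I) (auto intro!: Ck_on_const Ck_on_add assms(1))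
qed (simp add: Ck_on_const assms(1))

lemma Ck_on_inner:
  assumes S: "open S"
  shows "Ck_on k S f \<Longrightarrow> Ck_on k S (\<lambda>x. f x \<bullet> c)"
proof (induction k arbitrary: f)
  case 0
  then show ?case by (simp add: continuous_on_inner)
next
  case (Suc k)
  show ?case
    by (rule Ck_on_SucI[OF S has_derivative_inner_left[OF Ck_on_SucD(1)[OF Suc.prems]]])
      (auto intro: Suc.IH Ck_on_SucD(2)[OF Suc.prems])
qed

lemma smooth_on_deriv: "smooth_on S f \<Longrightarrow> smooth_on S (\<lambda>x. frechet_derivative f (at x) v)"
  unfolding smooth_on_def by (metis Ck_on.simps(2))

lemma smooth_on_inner: "open S \<Longrightarrow> smooth_on S f \<Longrightarrow> smooth_on S (\<lambda>x. f x \<bullet> c)"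
  unfolding smooth_on_def by (auto intro: Ck_on_inner)

lemma smooth_on_has_derivative:
  "smooth_on S f \<Longrightarrow> x \<in> S \<Longrightarrow> (f has_derivative frechet_derivative f (at x)) (at x)"
  unfolding smooth_on_def using Ck_on_SucD(1) by blast

lemma smooth_on_continuous: "smooth_on S f \<Longrightarrow> continuous_on S f"
  unfolding smooth_on_def by (metis Ck_on.simps(1))

text \<open>A factor that is merely continuous suffices where the other factor vanishes. In
  \<open>smooth_inverse\<close> this differentiates the derivative of the inverse map when only its
  continuity is known.\<close>

lemma has_derivative_continuous_scaleR:
  fixes a :: "'a::real_normed_vector \<Rightarrow> real"
  assumes a: "isCont a x" and u: "(u has_derivative u') (at x)" and z: "u x = 0"
  shows "((\<lambda>y. a y *\<^sub>R u y) has_derivative (\<lambda>h. a x *\<^sub>R u' h)) (at x)"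
proof -
  have bl: "bounded_linear u'" using u by (rule has_derivative_bounded_linear)
  have 1: "((\<lambda>y. norm (u y - u x - u' (y - x)) / norm (y - x)) \<longlongrightarrow> 0) (at x)"
    using u unfolding has_derivative_iff_norm by simp
  obtain K where K: "\<And>h. norm (u' h) \<le> norm h * K" using bounded_linear.bounded[OF bl] by blast
  have 2: "((\<lambda>y. a y) \<longlongrightarrow> a x) (at x)" using a by (simp add: isCont_def)
  have "((\<lambda>y. \<bar>a y\<bar> * (norm (u y - u x - u' (y - x)) / norm (y - x)) + \<bar>a y - a x\<bar> * K) \<longlongrightarrow> \<bar>a x\<bar> * 0 + \<bar>a x - a x\<bar> * K) (at x)"
    by (intro tendsto_intros 1 2)
  then have lim: "((\<lambda>y. \<bar>a y\<bar> * (norm (u y - u x - u' (y - x)) / norm (y - x)) + \<bar>a y - a x\<bar> * K) \<longlongrightarrow> 0) (at x)" by simp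
  have "((\<lambda>y. norm (a y *\<^sub>R u y - a x *\<^sub>R u x - a x *\<^sub>R u' (y - x)) / norm (y - x)) \<longlongrightarrow> 0) (at x)"
  proof (rule tendsto_sandwich[OF _ _ tendsto_const lim])
    show "\<forall>\<^sub>F y in at x. 0 \<le> norm (a y *\<^sub>R u y - a x *\<^sub>R u x - a x *\<^sub>R u' (y - x)) / norm (y - x)" by simp
    show "\<forall>\<^sub>F y in at x. norm (a y *\<^sub>R u y - a x *\<^sub>R u x - a x *\<^sub>R u' (y - x)) / norm (y - x)
      \<le> \<bar>a y\<bar> * (norm (u y - u x - u' (y - x)) / norm (y - x)) + \<bar>a y - a x\<bar> * K"
      unfolding eventually_at_filter
    proof (intro always_eventually allI impI)
      fix y assume "y \<noteq> x"
      then have pos: "norm (y - x) > 0" by simp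
      have "a y *\<^sub>R u y - a x *\<^sub>R u x - a x *\<^sub>R u' (y - x) = a y *\<^sub>R (u y - u x - u' (y - x)) + (a y - a x) *\<^sub>R u' (y - x)"
        by (simp add: z algebra_simps)
      then have "norm (a y *\<^sub>R u y - a x *\<^sub>R u x - a x *\<^sub>R u' (y - x))
         \<le> \<bar>a y\<bar> * norm (u y - u x - u' (y - x)) + \<bar>a y - a x\<bar> * norm (u' (y - x))"
        using norm_triangle_ineq by (metis norm_scaleR)
      also have "\<dots> \<le> \<bar>a y\<bar> * norm (u y - u x - u' (y - x)) + \<bar>a y - a x\<bar> * (norm (y - x) * K)"
        using K by (intro add_left_mono mult_left_mono) auto
      finally show "norm (a y *\<^sub>R u y - a x *\<^sub>R u x - a x *\<^sub>R u' (y - x)) / norm (y - x)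
      \<le> \<bar>a y\<bar> * (norm (u y - u x - u' (y - x)) / norm (y - x)) + \<bar>a y - a x\<bar> * K"
        using pos by (simp add: field_simps)
    qed
  qed
  then show ?thesis
    unfolding has_derivative_iff_norm using bounded_linear_const_scaleR[OF bl] by simp
qed

text \<open>Differentiating \<open>DG (g q) (w q) = v\<close> shows that the derivatives of the components of \<open>Dg\<close> are polynomials
  in these components and in the second derivatives of \<open>G\<close> along \<open>g\<close>; induction on \<open>k\<close> does the rest.\<close>

lemma smooth_inverse:
  fixes G :: "'a::euclidean_space \<Rightarrow> 'a"
  assumes U: "open U" and V: "open V" and G: "smooth_on U G"
    and g: "\<And>q. q \<in> V \<Longrightarrow> g q \<in> U" "\<And>q. q \<in> V \<Longrightarrow> (g has_derivative g' q) (at q)"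
    and inv: "\<And>q v. q \<in> V \<Longrightarrow> frechet_derivative G (at (g q)) (g' q v) = v"
      "\<And>q v. q \<in> V \<Longrightarrow> g' q (frechet_derivative G (at (g q)) v) = v"
  shows "smooth_on V (\<lambda>q. g q \<bullet> c)"
proof -
  define L where "L z v = frechet_derivative G (at z) v" for z v
  \<comment> \<open>Here the name is local: it denotes the second derivative of \<open>G\<close>,
    not the tangential operator of the spheres.\<close>
  define tan_lap where "tan_lap z v = frechet_derivative (\<lambda>z. L z v) (at z)" for z v
  have Lsm: "smooth_on U (\<lambda>z. L z v)" for v unfolding L_def by (rule smooth_on_deriv[OF G])
  have LD: "((\<lambda>z. L z v) has_derivative tan_lap z v) (at z)" if "z \<in> U" for z v
    unfolding tan_lap_def by (rule smooth_on_has_derivative[OF Lsm that])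
  have LLsm: "smooth_on U (\<lambda>z. tan_lap z v u)" for v u unfolding tan_lap_def by (rule smooth_on_deriv[OF Lsm])
  have Llin: "bounded_linear (L z)" if "z \<in> U" for z
    unfolding L_def using has_derivative_bounded_linear[OF smooth_on_has_derivative[OF G that]] .
  have glin: "bounded_linear (g' q)" if "q \<in> V" for q
    using has_derivative_bounded_linear[OF g(2)[OF that]] .
  have gcont: "isCont g q" if "q \<in> V" for q using has_derivative_continuous[OF g(2)[OF that]] .
  have inv': "L (g q) (g' q v) = v" "g' q (L (g q) v) = v" if "q \<in> V" for q v
    using inv that by (simp_all add: L_def)
  have Lg: "((\<lambda>q. L (g q) v) has_derivative (\<lambda>u. tan_lap (g q) v (g' q u))) (at q)" if "q \<in> V" for q v
    by (rule has_derivative_compose[OF g(2)[OF that] LD[OF g(1)[OF that]]])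
  have Lexp: "L z v = (\<Sum>c\<in>Basis. (v \<bullet> c) *\<^sub>R L z c)" if "z \<in> U" for z v
    using linear_sum[OF bounded_linear.linear[OF Llin[OF that]], of "\<lambda>c. (v \<bullet> c) *\<^sub>R c" Basis]
      linear_scale[OF bounded_linear.linear[OF Llin[OF that]]] by (simp add: euclidean_representation)
  \<comment> \<open>The resolvent identity for the inverses of the linear maps
    \<open>L (g q)\<close> and \<open>L (g q0)\<close>. It yields first the continuity and then the
    derivative of \<open>g'\<close>.\<close>
  have diff: "g' q v = g' q0 v - g' q0 (\<Sum>c\<in>Basis. (g' q v \<bullet> c) *\<^sub>R (L (g q) c - L (g q0) c))"
    if q: "q \<in> V" "q0 \<in> V" for q q0 v
  proof -
    have "(\<Sum>c\<in>Basis. (g' q v \<bullet> c) *\<^sub>R (L (g q) c - L (g q0) c)) = L (g q) (g' q v) - L (g q0) (g' q v)"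
      using Lexp[OF g(1)[OF q(1)], of "g' q v"] Lexp[OF g(1)[OF q(2)], of "g' q v"]
      by (simp add: scaleR_diff_right sum_subtractf)
    then show ?thesis
      using inv'(1)[OF q(1)] inv'(2)[OF q(2)] linear_diff[OF bounded_linear.linear[OF glin[OF q(2)]]] by simp
  qed
  have wcont: "isCont (\<lambda>q. g' q v) q0" if q0: "q0 \<in> V" for q0 v
  proof -
    obtain K where K: "K > 0" "\<And>h. norm (g' q0 h) \<le> norm h * K" using bounded_linear.pos_bounded[OF glin[OF q0]] by blast
    define e where "e q = K * (\<Sum>c\<in>Basis. norm (L (g q) c - L (g q0) c))" for q
    have "((\<lambda>q. L (g q) c) \<longlongrightarrow> L (g q0) c) (at q0)" for c
      using has_derivative_continuous[OF Lg[OF q0]] by (simp add: isCont_def)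
    then have "(e \<longlongrightarrow> K * (\<Sum>c\<in>(Basis::'a set). norm (L (g q0) c - L (g q0) c))) (at q0)"
      unfolding e_def by (intro tendsto_intros)
    then have e0: "(e \<longlongrightarrow> 0) (at q0)" by simp
    have bnd: "norm (g' q v - g' q0 v) \<le> e q * norm (g' q v)" if "q \<in> V" for q
    proof -
      have "norm (g' q v - g' q0 v) = norm (g' q0 (\<Sum>c\<in>Basis. (g' q v \<bullet> c) *\<^sub>R (L (g q) c - L (g q0) c)))"
        by (subst diff[OF that q0]) simp
      also have "\<dots> \<le> norm (\<Sum>c\<in>Basis. (g' q v \<bullet> c) *\<^sub>R (L (g q) c - L (g q0) c)) * K" by (rule K(2))
      also have "\<dots> \<le> (\<Sum>c\<in>Basis. norm (g' q v) * norm (L (g q) c - L (g q0) c)) * K"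
        using K(1) by (intro mult_right_mono order.trans[OF norm_sum] sum_mono)
          (auto intro!: mult_right_mono Basis_le_norm)
      finally show ?thesis by (simp add: e_def sum_distrib_left[symmetric] mult_ac)
    qed
    \<comment> \<open>Once the factor is below one half, the right-hand side of \<open>bnd\<close>
      can be absorbed, which bounds \<open>g' q v\<close> locally before continuity is
      established.\<close>
    have ev: "\<forall>\<^sub>F q in at q0. q \<in> V \<and> e q < 1/2"
      using eventually_at_in_open'[OF V q0] order_tendstoD(2)[OF e0, of "1/2"] by (auto elim: eventually_elim2)
    have "((\<lambda>q. norm (g' q v - g' q0 v)) \<longlongrightarrow> 0) (at q0)"
    proof (rule tendsto_sandwich[OF _ _ tendsto_const])
      show "\<forall>\<^sub>F q in at q0. norm (g' q v - g' q0 v) \<le> e q * (2 * norm (g' q0 v))"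
        using ev
      proof eventually_elim
        case (elim q)
        have e: "0 \<le> e q" using K(1) by (auto simp: e_def intro!: mult_nonneg_nonneg sum_nonneg)
        have "norm (g' q v) \<le> norm (g' q0 v) + norm (g' q v - g' q0 v)" by (metis norm_triangle_sub add.commute)
        also have "\<dots> \<le> norm (g' q0 v) + e q * norm (g' q v)" using bnd[of q] elim by simp
        also have "\<dots> \<le> norm (g' q0 v) + 1/2 * norm (g' q v)" using elim by (intro add_left_mono mult_right_mono) auto
        finally have "norm (g' q v) \<le> 2 * norm (g' q0 v)" by simp
        then show ?case using bnd[of q] elim e by (meson mult_left_mono order.trans)
      qed
      show "((\<lambda>q. e q * (2 * norm (g' q0 v))) \<longlongrightarrow> 0) (at q0)"
        using tendsto_mult_right[OF e0, of "2 * norm (g' q0 v)"] by simp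
    qed simp
    then show ?thesis unfolding isCont_def by (simp add: tendsto_norm_zero_iff LIM_zero_iff)
  qed
  define H where "H b c d z = tan_lap z c d \<bullet> b" for b c d z
  have wD: "((\<lambda>q. g' q v \<bullet> a) has_derivative
      (\<lambda>u. - (\<Sum>b\<in>Basis. \<Sum>c\<in>Basis. \<Sum>d\<in>Basis. (g' q v \<bullet> c) * ((g' q u \<bullet> d) * (H b c d (g q) * (g' q b \<bullet> a)))))) (at q)"
    if q: "q \<in> V" for q v a
  proof -
    have lin: "linear (g' q)" "linear (tan_lap (g q) c)" for c
      using bounded_linear.linear[OF glin[OF q]] has_derivative_linear[OF LD[OF g(1)[OF q]]] by auto
    \<comment> \<open>The first factor is only continuous at \<open>q\<close>, but the difference it
      multiplies is differentiable and zero there.\<close>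
    have "((\<lambda>q'. \<Sum>c\<in>Basis. (g' q' v \<bullet> c) *\<^sub>R (L (g q') c - L (g q) c)) has_derivative
        (\<lambda>u. \<Sum>c\<in>Basis. (g' q v \<bullet> c) *\<^sub>R tan_lap (g q) c (g' q u))) (at q)"
      by (intro has_derivative_sum has_derivative_continuous_scaleR isCont_inner wcont[OF q] continuous_const)
        (auto intro!: derivative_eq_intros Lg[OF q])
    then have "((\<lambda>q'. g' q v - g' q (\<Sum>c\<in>Basis. (g' q' v \<bullet> c) *\<^sub>R (L (g q') c - L (g q) c))) has_derivative
        (\<lambda>u. 0 - g' q (\<Sum>c\<in>Basis. (g' q v \<bullet> c) *\<^sub>R tan_lap (g q) c (g' q u)))) (at q)"
      by (intro has_derivative_diff has_derivative_const bounded_linear.has_derivative[OF glin[OF q]])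
    then have "((\<lambda>q'. g' q' v) has_derivative
        (\<lambda>u. 0 - g' q (\<Sum>c\<in>Basis. (g' q v \<bullet> c) *\<^sub>R tan_lap (g q) c (g' q u)))) (at q)"
      by (rule has_derivative_transform_within_open[OF _ V q]) (use diff q in metis)
    then have "((\<lambda>q'. g' q' v \<bullet> a) has_derivative
        (\<lambda>u. (0 - g' q (\<Sum>c\<in>Basis. (g' q v \<bullet> c) *\<^sub>R tan_lap (g q) c (g' q u))) \<bullet> a)) (at q)"
      by (rule has_derivative_inner_left)
    moreover have "(0 - g' q (\<Sum>c\<in>Basis. (g' q v \<bullet> c) *\<^sub>R tan_lap (g q) c (g' q u))) \<bullet> a
      = - (\<Sum>b\<in>Basis. \<Sum>c\<in>Basis. \<Sum>d\<in>Basis. (g' q v \<bullet> c) * ((g' q u \<bullet> d) * (H b c d (g q) * (g' q b \<bullet> a))))" for u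
    proof -
      have 1: "tan_lap (g q) c (g' q u) = (\<Sum>d\<in>Basis. (g' q u \<bullet> d) *\<^sub>R tan_lap (g q) c d)" for c
        using linear_sum[OF lin(2)[of c], of "\<lambda>d. (g' q u \<bullet> d) *\<^sub>R d" Basis] linear_scale[OF lin(2)[of c]]
        by (simp add: euclidean_representation)
      have 2: "g' q x \<bullet> a = (\<Sum>b\<in>Basis. (x \<bullet> b) * (g' q b \<bullet> a))" for x
        using linear_sum[OF lin(1), of "\<lambda>d. (x \<bullet> d) *\<^sub>R d" Basis] linear_scale[OF lin(1)]
        by (simp add: euclidean_representation inner_sum_left)
      define x where "x = (\<Sum>c\<in>Basis. (g' q v \<bullet> c) *\<^sub>R tan_lap (g q) c (g' q u))"
      have "x \<bullet> b = (\<Sum>c\<in>Basis. \<Sum>d\<in>Basis. (g' q v \<bullet> c) * ((g' q u \<bullet> d) * H b c d (g q)))" for b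
        by (simp add: x_def 1 inner_sum_left H_def sum_distrib_left)
      then have "g' q x \<bullet> a = (\<Sum>b\<in>Basis. \<Sum>c\<in>Basis. \<Sum>d\<in>Basis. (g' q v \<bullet> c) * ((g' q u \<bullet> d) * (H b c d (g q) * (g' q b \<bullet> a))))"
        by (subst 2) (simp add: sum_distrib_right mult.assoc)
      then show ?thesis unfolding x_def[symmetric] by (simp add: inner_diff_left)
    qed
    ultimately show ?thesis by simp
  qed
  have hD: "((\<lambda>q. h (g q)) has_derivative (\<lambda>u. \<Sum>d\<in>Basis. (g' q u \<bullet> d) * frechet_derivative h (at (g q)) d)) (at q)"
    if h: "smooth_on U h" and q: "q \<in> V" for h :: "'a \<Rightarrow> real" and q
  proof -
    have D: "(h has_derivative frechet_derivative h (at (g q))) (at (g q))"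
      by (rule smooth_on_has_derivative[OF h g(1)[OF q]])
    have "frechet_derivative h (at (g q)) x = (\<Sum>d\<in>Basis. (x \<bullet> d) * frechet_derivative h (at (g q)) d)" for x
      using linear_sum[OF has_derivative_linear[OF D], of "\<lambda>d. (x \<bullet> d) *\<^sub>R d" Basis] linear_scale[OF has_derivative_linear[OF D]]
      by (simp add: euclidean_representation)
    then have "(\<lambda>u. frechet_derivative h (at (g q)) (g' q u))
        = (\<lambda>u. \<Sum>d\<in>Basis. (g' q u \<bullet> d) * frechet_derivative h (at (g q)) d)" by blast
    then show ?thesis using has_derivative_compose[OF g(2)[OF q] D] by (simp only:)
  qed
  \<comment> \<open>Both statements go through the induction together, because the derivative of
    either kind of function contains factors of both kinds.\<close>
  have main: "(\<forall>v a. Ck_on k V (\<lambda>q. g' q v \<bullet> a)) \<and> (\<forall>h::'a \<Rightarrow> real. smooth_on U h \<longrightarrow> Ck_on k V (\<lambda>q. h (g q)))" for k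
  proof (induction k)
    case 0
    have "continuous_on V (\<lambda>q. g' q v \<bullet> a)" for v a
      by (intro continuous_at_imp_continuous_on ballI isCont_inner wcont continuous_const)
    moreover have "continuous_on V (\<lambda>q. h (g q))" if "smooth_on U h" for h :: "'a \<Rightarrow> real"
      by (rule continuous_on_compose2[OF smooth_on_continuous[OF that]])
        (auto intro!: continuous_at_imp_continuous_on gcont g)
    ultimately show ?case by simp
  next
    case (Suc k)
    have Hsm: "smooth_on U (H b c d)" for b c d
      unfolding H_def by (rule smooth_on_inner[OF U LLsm])
    have "Ck_on (Suc k) V (\<lambda>q. g' q v \<bullet> a)" for v a
    proof (rule Ck_on_SucI[OF V wD])
      have "Ck_on k V (\<lambda>q. (-1) * (\<Sum>b\<in>Basis. \<Sum>c\<in>Basis. \<Sum>d\<in>Basis. (g' q v \<bullet> c) * ((g' q u \<bullet> d) * (H b c d (g q) * (g' q b \<bullet> a)))))" for u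
        using Suc Hsm by (intro Ck_on_mult[OF V] Ck_on_sum[OF V] Ck_on_const[OF V]) auto
      then show "Ck_on k V (\<lambda>q. - (\<Sum>b\<in>Basis. \<Sum>c\<in>Basis. \<Sum>d\<in>Basis. (g' q v \<bullet> c) * ((g' q u \<bullet> d) * (H b c d (g q) * (g' q b \<bullet> a)))))" for u
        by simp
    qed
    moreover have "Ck_on (Suc k) V (\<lambda>q. h (g q))" if "smooth_on U h" for h :: "'a \<Rightarrow> real"
      by (rule Ck_on_SucI[OF V hD[OF that]])
        (use Suc smooth_on_deriv[OF that] in \<open>auto intro!: Ck_on_mult[OF V] Ck_on_sum[OF V]\<close>)
    ultimately show ?case by blast
  qed
  have "Ck_on (Suc k) V (\<lambda>q. g q \<bullet> c)" for k
    by (rule Ck_on_SucI[OF V has_derivative_inner_left[OF g(2)]]) (use main in auto)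
  then show ?thesis
    unfolding smooth_on_def using Ck_on_lower by blast
qed

section \<open>Collars and the existence of defining functions\<close>

lemma linear_injective_surjective_pair:
  fixes L :: "'e::euclidean_space \<Rightarrow> 'b::euclidean_space"
  assumes L: "linear L" "inj L" and D: "DIM('b) = Suc (DIM('e))" and n: "n \<notin> range L"
  shows "bij (\<lambda>(w, s). L w + s *\<^sub>R n)"
proof (rule bijI)
  show "surj (\<lambda>(w, s). L w + s *\<^sub>R n)"
  proof (rule surjI)
    fix v
    have "\<exists>ws. (case ws of (w, s) \<Rightarrow> L w + s *\<^sub>R n) = v"
      by (rule complement_of_range[OF L D n, of v]) auto
    then show "(\<lambda>(w, s). L w + s *\<^sub>R n) (SOME ws. (case ws of (w, s) \<Rightarrow> L w + s *\<^sub>R n) = v) = v"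
      by (rule someI_ex)
  qed
  show "inj (\<lambda>(w, s). L w + s *\<^sub>R n)"
  proof (rule injI, clarsimp)
    fix w s w' s'
    assume eq: "L w + s *\<^sub>R n = L w' + s' *\<^sub>R n"
    have "s = s'"
    proof (rule ccontr)
      assume ne: "s \<noteq> s'"
      have "L (w' - w) = (s - s') *\<^sub>R n" using eq by (simp add: linear_diff[OF L(1)] algebra_simps)
      then have "L (inverse (s - s') *\<^sub>R (w' - w)) = n" using ne by (simp add: linear_scale[OF L(1)])
      then show False using n by blast
    qed
    then show "w = w' \<and> s = s'" using eq L(2) by (simp add: inj_eq)
  qed
qed

lemma Ck_on_subset: "Ck_on k V F \<Longrightarrow> W \<subseteq> V \<Longrightarrow> Ck_on k W F"
  by (induction k arbitrary: F) (auto intro: continuous_on_subset)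

lemma Ck_on_fst:
  fixes F :: "'a::real_normed_vector \<Rightarrow> 'c::real_normed_vector"
  assumes V: "open V" and F: "Ck_on k V F"
  shows "Ck_on k (V \<times> (UNIV :: 'b::real_normed_vector set)) (\<lambda>x. F (fst x))"
  using F
proof (induction k arbitrary: F)
  case 0
  then show ?case by (auto intro!: continuous_on_compose2[OF _ continuous_on_fst] continuous_intros)
next
  case (Suc k)
  have oV: "open (V \<times> UNIV :: ('a \<times> 'b) set)" by (simp add: V open_Times)
  show ?case
  proof (rule Ck_on_SucI[OF oV])
    fix x :: "'a \<times> 'b" assume "x \<in> V \<times> UNIV"
    then show "((\<lambda>x. F (fst x)) has_derivative (\<lambda>h. frechet_derivative F (at (fst x)) (fst h))) (at x)"
      by (intro has_derivative_compose[OF has_derivative_fst[OF has_derivative_ident] Ck_on_SucD(1)[OF Suc.prems]]) auto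
  next
    fix v :: "'a \<times> 'b"
    show "Ck_on k (V \<times> (UNIV :: 'b set)) (\<lambda>x. frechet_derivative F (at (fst x)) (fst v))"
      using Suc.IH[OF Ck_on_SucD(2)[OF Suc.prems, of "fst v"]] .
  qed
qed

lemma Ck_on_linear: "bounded_linear l \<Longrightarrow> open S \<Longrightarrow> Ck_on k S l"
proof (cases k)
  case 0
  assume "bounded_linear l" then show ?thesis by (simp add: 0 linear_continuous_on)
next
  case (Suc j)
  assume "bounded_linear l" "open S"
  then show ?thesis unfolding Suc
    by (intro Ck_on_SucI[where D = "\<lambda>x. l"] bounded_linear_imp_has_derivative Ck_on_const)
qed

lemma smooth_local_inverse:
  fixes G :: "'a::euclidean_space \<Rightarrow> 'a"
  assumes U: "open U" and Gsm: "smooth_on U G" and z0: "z0 \<in> U" and inj: "inj (frechet_derivative G (at z0))"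
  shows "\<exists>U' V g g'. open U' \<and> U' \<subseteq> U \<and> z0 \<in> U' \<and> open V \<and> homeomorphism U' V G g \<and>
    (\<forall>q\<in>V. (g has_derivative g' q) (at q) \<and>
      (\<forall>v. frechet_derivative G (at (g q)) (g' q v) = v \<and> g' q (frechet_derivative G (at (g q)) v) = v))"
proof -
  define G' where "G' z = Blinfun (frechet_derivative G (at z))" for z
  have G': "blinfun_apply (G' z) = frechet_derivative G (at z)" if "z \<in> U" for z
    unfolding G'_def
    by (rule bounded_linear_Blinfun_apply[OF has_derivative_bounded_linear[OF smooth_on_has_derivative[OF Gsm that]]])
  have cont: "continuous_on U G'"
  proof (rule continuous_on_blinfun_componentwise)
    fix i :: 'a
    have "continuous_on U (\<lambda>z. frechet_derivative G (at z) i)"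
      by (rule smooth_on_continuous[OF smooth_on_deriv[OF Gsm]])
    then show "continuous_on U (\<lambda>z. G' z i)" by (simp add: G' cong: continuous_on_cong)
  qed
  have inj': "inj (blinfun_apply (G' z0))" using inj by (simp add: G'[OF z0])
  define invf where "invf = Blinfun (inv (blinfun_apply (G' z0)))"
  have "linear (inv (blinfun_apply (G' z0)))"
    by (rule inj_linear_imp_inv_linear[OF bounded_linear.linear[OF blinfun.bounded_linear_right] inj'])
  then have invf: "blinfun_apply invf = inv (blinfun_apply (G' z0))"
    unfolding invf_def by (simp add: bounded_linear_Blinfun_apply linear_conv_bounded_linear)
  have "invf o\<^sub>L G' z0 = id_blinfun"
    by (rule blinfun_eqI) (simp add: invf inv_f_f[OF inj'])
  then obtain U' V g g' where U': "open U'" "U' \<subseteq> U" "z0 \<in> U'" and V: "open V" "G z0 \<in> V" and hom: "homeomorphism U' V G g"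
    and g1: "\<And>q. q \<in> V \<Longrightarrow> (g has_derivative g' q) (at q)"
    and g2: "\<And>q. q \<in> V \<Longrightarrow> g' q = inv (blinfun_apply (G' (g q)))"
    and g3: "\<And>q. q \<in> V \<Longrightarrow> bij (blinfun_apply (G' (g q)))"
    using inverse_function_theorem[OF U _ cont z0, of G invf] smooth_on_has_derivative[OF Gsm] G' by metis
  have gU: "g q \<in> U" if "q \<in> V" for q using hom that U'(2) by (auto simp: homeomorphism_def)
  have inv: "frechet_derivative G (at (g q)) (g' q v) = v \<and> g' q (frechet_derivative G (at (g q)) v) = v"
    if q: "q \<in> V" for q v
    unfolding g2[OF q] G'[OF gU[OF q], symmetric]
    using g3[OF q] by (simp add: bij_is_inj surj_f_inv_f bij_is_surj)
  show ?thesis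
    by (rule exI[of _ U'], rule exI[of _ V], rule exI[of _ g], rule exI[of _ g']) (simp add: U' V hom g1 inv)
qed

context
  fixes A :: "('m::t2_space set \<times> ('m \<Rightarrow> real ^ ('n::{finite,linorder} + 'n))) set"
    and f N :: "'m \<Rightarrow> 'n heis"
  assumes atlas: "smooth_atlas A" and imm: "smooth_immersion A f" "0 \<notin> range f"
    and co: "coorientation A f N"
begin

text \<open>The surface is thickened along the constant direction \<open>N p\<close>, and the
  defining function is the thickening coordinate of the inverse map. A constant direction keeps the
  thickening smooth although \<open>N\<close> is only continuous.\<close>

lemma exists_local_defining_function: "\<exists>\<phi>. local_defining_function f N p \<phi>"
proof -
  obtain V0 :: "(real ^ ('n + 'n)) set" and y h where V0: "open V0" "y \<in> V0" and h: "continuous_on V0 h" "h y = p"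
    and hop: "\<forall>B. open B \<longrightarrow> B \<subseteq> V0 \<longrightarrow> open (h ` B)"
    and sm: "smooth_on V0 (f \<circ> h)" and inj: "\<forall>z\<in>V0. inj (frechet_derivative (f \<circ> h) (at z))"
    and n: "N p \<notin> range (frechet_derivative (f \<circ> h) (at y))"
    using chart_at[OF atlas imm(1) co, of p] by metis
  define F where "F = f \<circ> h"
  define G where "G x = F (fst x) + snd x *\<^sub>R N p" for x :: "'n heis"
  define U where "U = V0 \<times> (UNIV :: real set)"
  have U: "open U" by (simp add: U_def V0 open_Times)
  have FD: "(F has_derivative frechet_derivative F (at z)) (at z)" if "z \<in> V0" for z
    unfolding F_def by (rule smooth_on_has_derivative[OF sm that])
  have smF: "Ck_on k V0 F" for k using sm by (simp add: F_def smooth_on_def)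
  have Gsm: "smooth_on U G"
    unfolding smooth_on_def
  proof
    fix k
    have "bounded_linear (\<lambda>x::'n heis. snd x *\<^sub>R N p)"
      by (intro bounded_linear_scaleR_const bounded_linear_snd)
    then show "Ck_on k U G"
      unfolding G_def[abs_def] U_def using V0
      by (intro Ck_on_add[OF _ Ck_on_fst[OF V0(1) smF] Ck_on_linear]) (auto simp: open_Times)
  qed
  have GD: "(G has_derivative (\<lambda>x. frechet_derivative F (at (fst z)) (fst x) + snd x *\<^sub>R N p)) (at z)" if "z \<in> U" for z
    unfolding G_def[abs_def] using that
    by (intro has_derivative_add has_derivative_compose[OF has_derivative_fst[OF has_derivative_ident] FD]
        has_derivative_scaleR_left has_derivative_snd has_derivative_ident) (auto simp: U_def)
  have Gfd: "frechet_derivative G (at z) = (\<lambda>x. frechet_derivative F (at (fst z)) (fst x) + snd x *\<^sub>R N p)" if "z \<in> U" for z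
    using frechet_derivative_at[OF GD[OF that]] by simp
  define z0 where "z0 = (y, 0 :: real)"
  have z0: "z0 \<in> U" by (simp add: z0_def U_def V0)
  have "bij (\<lambda>(w, s). frechet_derivative F (at y) w + s *\<^sub>R N p)"
    by (rule linear_injective_surjective_pair)
      (use has_derivative_linear[OF FD[OF V0(2)]] inj n V0 in \<open>auto simp: F_def\<close>)
  then have "inj (frechet_derivative G (at z0))"
    unfolding Gfd[OF z0] by (simp add: z0_def case_prod_unfold bij_is_inj)
  from smooth_local_inverse[OF U Gsm z0 this]
  obtain U' V g g' where U': "open U'" "U' \<subseteq> U" "z0 \<in> U'" and V: "open V" and hom: "homeomorphism U' V G g"
    and gD: "\<forall>q\<in>V. (g has_derivative g' q) (at q) \<and>
      (\<forall>v. frechet_derivative G (at (g q)) (g' q v) = v \<and> g' q (frechet_derivative G (at (g q)) v) = v)"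
    by blast
  have g1: "(g has_derivative g' q) (at q)" if "q \<in> V" for q using gD that by blast
  have gU: "g q \<in> U" if "q \<in> V" for q using hom that U'(2) by (auto simp: homeomorphism_def)
  have Gg: "G (g q) = q" if "q \<in> V" for q using hom that by (simp add: homeomorphism_def)
  have gG: "g (G z) = z" "G z \<in> V" if "z \<in> U'" for z using hom that by (auto simp: homeomorphism_def)
  define \<phi> where "\<phi> q = g q \<bullet> (0, 1)" for q :: "'n heis"
  have \<phi>: "smooth_on V \<phi>"
    unfolding \<phi>_def[abs_def]
    by (rule smooth_inverse[OF U V Gsm gU g1]) (use gD in auto)
  have C2: "C2 \<phi> V" by (rule smooth_on_C2[OF \<phi> V])
  have dN: "D1 \<phi> q (N p) = 1" if q: "q \<in> V" for q
  proof -
    have "(\<phi> has_derivative (\<lambda>v. g' q v \<bullet> (0, 1))) (at q)"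
      unfolding \<phi>_def[abs_def] by (rule has_derivative_inner_left[OF g1[OF q]])
    then have "D1 \<phi> q = (\<lambda>v. g' q v \<bullet> (0, 1))"
      using frechet_derivative_at by (metis D1_def)
    moreover have "frechet_derivative G (at (g q)) (0, 1) = N p"
      using has_derivative_linear[OF FD, of "fst (g q)"] gU[OF q]
      by (auto simp: Gfd[OF gU[OF q]] U_def linear_0)
    then have "g' q (N p) = (0, 1)" using gD q by metis
    ultimately show ?thesis by simp
  qed
  have Fz: "F z = G (z, 0)" for z by (simp add: G_def)
  define B0 where "B0 = {z \<in> V0. (z, 0) \<in> U'}"
  have B0: "B0 \<subseteq> V0" "y \<in> B0" "open B0"
  proof -
    have "open ((\<lambda>z. (z, 0::real)) -` U')" by (intro open_vimage U' continuous_intros)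
    moreover have "B0 = V0 \<inter> ((\<lambda>z. (z, 0::real)) -` U')" by (auto simp: B0_def)
    ultimately show "open B0" using open_Int[OF V0(1)] by metis
  qed (use V0 U'(3) in \<open>auto simp: B0_def z0_def\<close>)
  have FV: "F z \<in> V" if "z \<in> B0" for z using gG(2)[of "(z, 0)"] that by (simp add: Fz B0_def)
  have cF: "continuous_on V0 F" unfolding F_def by (rule smooth_on_continuous[OF sm])
  have cN: "continuous_on V0 (\<lambda>z. N (h z))"
    using co h(1) by (auto simp: coorientation_def intro: continuous_on_compose2)
  have "continuous_on B0 (\<lambda>z. \<Sum>b\<in>Basis. (N (h z) \<bullet> b) * D1 \<phi> (F z) b)"
    using FV B0 by (intro continuous_intros continuous_on_compose2[OF C2_D1_continuous[OF C2]]
        continuous_on_subset[OF cN] continuous_on_subset[OF cF]) auto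
  moreover have "(\<Sum>b\<in>Basis. (v \<bullet> b) * D1 \<phi> q b) = D1 \<phi> q v" if "q \<in> V" for q v
  proof -
    have l: "linear (D1 \<phi> q)" using has_jetD(4)[OF C2_jet[OF C2] that] .
    show ?thesis
      using linear_sum[OF l, of "\<lambda>b. (v \<bullet> b) *\<^sub>R b" Basis] by (simp add: linear_scale[OF l] euclidean_representation)
  qed
  ultimately have cD: "continuous_on B0 (\<lambda>z. D1 \<phi> (F z) (N (h z)))"
    using FV by (simp cong: continuous_on_cong)
  \<comment> \<open>The coorientation varies, while the thickening uses its value at
    \<open>p\<close>; the parameters are restricted to those where \<open>\<phi>\<close> still
    increases along \<open>N\<close>.\<close>
  define B1 where "B1 = {z \<in> B0. D1 \<phi> (F z) (N (h z)) > 0}"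
  have B1: "open B1" "y \<in> B1" "B1 \<subseteq> B0"
  proof -
    have "open (B0 \<inter> (\<lambda>z. D1 \<phi> (F z) (N (h z))) -` {0<..})"
      by (rule continuous_open_preimage[OF cD B0(3)]) simp
    moreover have "B1 = B0 \<inter> (\<lambda>z. D1 \<phi> (F z) (N (h z))) -` {0<..}" by (auto simp: B1_def)
    ultimately show "open B1" by simp
    show "y \<in> B1" using B0 FV dN h(2) by (simp add: B1_def)
  qed (auto simp: B1_def)
  \<comment> \<open>The domain shrinks together with the parameters: only points whose foot lies in
    \<open>B1\<close> are kept, so that the zero set in \<open>W\<close> is exactly the image of the
    smaller neighbourhood.\<close>
  define W where "W = {q \<in> V. q \<noteq> 0 \<and> fst (g q) \<in> B1}"
  have oW: "open W"
  proof -
    have "continuous_on V g" using hom by (simp add: homeomorphism_def)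
    then have "open (V \<inter> (\<lambda>q. fst (g q)) -` B1)"
      by (intro continuous_open_preimage V B1 continuous_intros)
    then have "open ((V \<inter> (\<lambda>q. fst (g q)) -` B1) - {0})" by (rule open_delete)
    moreover have "W = (V \<inter> (\<lambda>q. fst (g q)) -` B1) - {0}" by (auto simp: W_def)
    ultimately show ?thesis by simp
  qed
  have fh: "f (h z) = F z" for z by (simp add: F_def)
  have "local_defining_function f N p \<phi>"
    unfolding local_defining_function_def
  proof (intro exI[of _ "h ` B1"] exI[of _ W] conjI ballI)
    show "open (h ` B1)" using hop B1 B0 by blast
    show "p \<in> h ` B1" using B1 h(2) by blast
    show "open W" by (rule oW)
    show "0 \<notin> W" by (simp add: W_def)
    show "smooth_on W \<phi>"
      using \<phi> by (auto simp: smooth_on_def W_def intro: Ck_on_subset)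
    show "differential \<phi> q \<noteq> 0" if "q \<in> W" for q
    proof
      assume "differential \<phi> q = 0"
      then have "D1 \<phi> q (N p) = 0" using differential_apply[OF C2, of q] that by (auto simp: W_def dest: fun_cong)
      then show False using dN[of q] that by (simp add: W_def)
    qed
    show "f ` h ` B1 = {q \<in> W. \<phi> q = 0}"
    proof (intro set_eqI iffI)
      fix q assume "q \<in> f ` h ` B1"
      then obtain z where z: "z \<in> B1" "q = F z" by (auto simp: fh)
      then have zU: "(z, 0) \<in> U'" using B1 by (auto simp: B0_def)
      have "F z \<noteq> 0" using imm(2) by (metis fh rangeI)
      then show "q \<in> {q \<in> W. \<phi> q = 0}" using gG[OF zU] z by (simp add: W_def Fz \<phi>_def)
    next
      fix q assume q: "q \<in> {q \<in> W. \<phi> q = 0}"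
      then have "snd (g q) = 0" by (simp add: \<phi>_def inner_prod_def)
      then have "q = F (fst (g q))" using Gg[of q] q by (simp add: W_def G_def)
      then show "q \<in> f ` h ` B1" using q by (auto simp: W_def fh image_image)
    qed
    show "0 < blinfun_apply (differential \<phi> (f p')) (N p')" if "p' \<in> h ` B1" for p'
      using that B1 FV by (auto simp: fh differential_apply[OF C2] B1_def)
  qed
  then show ?thesis by blast
qed

end

section \<open>Level sets and coorientations\<close>

lemma increasing_along:
  fixes \<phi> :: "'a::euclidean_space \<Rightarrow> real"
  assumes C: "C2 \<phi> W" and B: "convex B" "B \<subseteq> W" and pos: "\<And>q. q \<in> B \<Longrightarrow> D1 \<phi> q n > 0"
    and q: "q \<in> B" "q + t *\<^sub>R n \<in> B" and t: "t > 0"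
  shows "\<phi> q < \<phi> (q + t *\<^sub>R n)"
proof -
  have inB: "q + s *\<^sub>R n \<in> B" if "0 \<le> s" "s \<le> t" for s
  proof -
    have "q + s *\<^sub>R n = (1 - s / t) *\<^sub>R q + (s / t) *\<^sub>R (q + t *\<^sub>R n)"
      using t by (simp add: algebra_simps)
    then show ?thesis
      using convexD[OF B(1) q, of "1 - s / t" "s / t"] that t by simp
  qed
  have D: "((\<lambda>s. \<phi> (q + s *\<^sub>R n)) has_real_derivative D1 \<phi> (q + s *\<^sub>R n) n) (at s)" if "0 \<le> s" "s \<le> t" for s
  proof -
    have w: "q + s *\<^sub>R n \<in> W" using inB[OF that] B(2) by blast
    have "((\<lambda>s. q + s *\<^sub>R n) has_derivative (\<lambda>h. h *\<^sub>R n)) (at s)"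
      by (auto intro!: derivative_eq_intros)
    from has_derivative_compose[OF this has_jetD(1)[OF C2_jet[OF C] w]]
    have "((\<lambda>s. \<phi> (q + s *\<^sub>R n)) has_derivative (\<lambda>h. D1 \<phi> (q + s *\<^sub>R n) (h *\<^sub>R n))) (at s)" .
    moreover have "D1 \<phi> (q + s *\<^sub>R n) (h *\<^sub>R n) = D1 \<phi> (q + s *\<^sub>R n) n * h" for h
      using linear_scale[OF has_jetD(4)[OF C2_jet[OF C] w]] by simp
    ultimately show ?thesis by (simp add: has_field_derivative_def)
  qed
  have "\<phi> (q + 0 *\<^sub>R n) < \<phi> (q + t *\<^sub>R n)"
    by (rule DERIV_pos_imp_increasing[OF t]) (use D pos inB in blast)
  then show ?thesis by simp
qed

lemma isCont_nhds: "isCont g x \<Longrightarrow> (g \<longlongrightarrow> g x) (nhds x)"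
  by (simp add: isCont_def tendsto_at_iff_tendsto_nhds)

text \<open>Both functions increase along \<open>n\<close>. Every line in this direction near
  \<open>q0\<close> meets the zero set of \<open>\<phi>\<close> by the intermediate value theorem
  and meets that of \<open>\<psi>\<close> at most once, so inclusion of the zero sets near
  \<open>q0\<close> already forces equality.\<close>

lemma level_set_swap:
  fixes \<phi> \<psi> :: "'a::euclidean_space \<Rightarrow> real"
  assumes C: "C2 \<phi> W" "C2 \<psi> V" and q0: "q0 \<in> W" "q0 \<in> V" and z: "\<phi> q0 = 0"
    and pos: "D1 \<phi> q0 n > 0" "D1 \<psi> q0 n > 0"
    and sub: "\<forall>\<^sub>F q in nhds q0. \<phi> q = 0 \<longrightarrow> \<psi> q = 0"
  shows "\<forall>\<^sub>F q in nhds q0. \<psi> q = 0 \<longrightarrow> \<phi> q = 0"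
proof -
  have c: "\<forall>\<^sub>F q in nhds q0. D1 \<phi> q n > 0" "\<forall>\<^sub>F q in nhds q0. D1 \<psi> q n > 0"
    "\<forall>\<^sub>F q in nhds q0. q \<in> W" "\<forall>\<^sub>F q in nhds q0. q \<in> V"
  proof -
    have "isCont (\<lambda>q. D1 \<phi> q n) q0" "isCont (\<lambda>q. D1 \<psi> q n) q0"
      using C2D(2)[OF C(1) q0(1)] C2D(2)[OF C(2) q0(2)] by (auto intro: has_derivative_continuous)
    from order_tendstoD(1)[OF isCont_nhds[OF this(1)] pos(1)] order_tendstoD(1)[OF isCont_nhds[OF this(2)] pos(2)]
    show "\<forall>\<^sub>F q in nhds q0. D1 \<phi> q n > 0" "\<forall>\<^sub>F q in nhds q0. D1 \<psi> q n > 0" .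
    show "\<forall>\<^sub>F q in nhds q0. q \<in> W" "\<forall>\<^sub>F q in nhds q0. q \<in> V"
      using C2D(3)[OF C(1) q0(1)] C2D(3)[OF C(2) q0(2)] q0 by (auto intro: eventually_nhds_in_open)
  qed
  have "\<forall>\<^sub>F q in nhds q0. D1 \<phi> q n > 0 \<and> D1 \<psi> q n > 0 \<and> q \<in> W \<and> q \<in> V \<and> (\<phi> q = 0 \<longrightarrow> \<psi> q = 0)"
    using c sub by eventually_elim blast
  then obtain r where r: "r > 0" and B: "\<And>q. dist q q0 < r \<Longrightarrow>
      D1 \<phi> q n > 0 \<and> D1 \<psi> q n > 0 \<and> q \<in> W \<and> q \<in> V \<and> (\<phi> q = 0 \<longrightarrow> \<psi> q = 0)"
    unfolding eventually_nhds_metric by blast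
  have cB: "convex (ball q0 r)" by simp
  have BW: "ball q0 r \<subseteq> W" "ball q0 r \<subseteq> V" using B by (auto simp: dist_commute)
  define t0 where "t0 = r / (2 * (norm n + 1))"
  have t0: "t0 > 0" using r by (simp add: t0_def add_nonneg_pos)
  have tn: "\<bar>t\<bar> * norm n \<le> r / 2" if "\<bar>t\<bar> \<le> t0" for t
  proof -
    have "\<bar>t\<bar> * norm n \<le> t0 * (norm n + 1)" using that by (intro mult_mono) auto
    also have "\<dots> = r / 2"
      using norm_ge_zero[of n] by (simp add: t0_def field_simps add_nonneg_eq_0_iff)
    finally show ?thesis .
  qed
  have inB: "q + t *\<^sub>R n \<in> ball q0 r" if "dist q q0 < r / 2" "\<bar>t\<bar> \<le> t0" for q t
  proof -
    have "dist (q + t *\<^sub>R n) q0 \<le> dist (q + t *\<^sub>R n) q + dist q q0" by (rule dist_triangle)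
    also have "dist (q + t *\<^sub>R n) q = \<bar>t\<bar> * norm n" by (simp add: dist_norm)
    finally have "dist (q + t *\<^sub>R n) q0 < r" using tn[OF that(2)] that(1) by linarith
    then show ?thesis by (simp add: dist_commute)
  qed
  have q0t: "q0 + t0 *\<^sub>R n \<in> ball q0 r" "q0 + (- t0) *\<^sub>R n \<in> ball q0 r" "q0 \<in> ball q0 r"
    using inB[of q0 t0] inB[of q0 "- t0"] r t0 by auto
  have up: "\<phi> (q0 + t0 *\<^sub>R n) > 0"
    using increasing_along[OF C(1) cB BW(1), of n q0 t0] B q0t t0 z by (auto simp: dist_commute)
  have dn: "\<phi> (q0 + (- t0) *\<^sub>R n) < 0"
    using increasing_along[OF C(1) cB BW(1), of n "q0 + (- t0) *\<^sub>R n" t0] B q0t t0 z by (auto simp: dist_commute)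
  have lim: "((\<lambda>q. \<phi> (q + t *\<^sub>R n)) \<longlongrightarrow> \<phi> (q0 + t *\<^sub>R n)) (nhds q0)" if "q0 + t *\<^sub>R n \<in> ball q0 r" for t
  proof -
    have "isCont \<phi> (q0 + t *\<^sub>R n)"
      by (rule has_derivative_continuous[OF C2D(1)[OF C(1)]]) (use that BW(1) in blast)
    then have "isCont (\<lambda>q. \<phi> (q + t *\<^sub>R n)) q0" by (rule isCont_o2[where f = "\<lambda>q. q + t *\<^sub>R n", rotated]) simp
    then show ?thesis by (rule isCont_nhds)
  qed
  have near: "\<forall>\<^sub>F q in nhds q0. dist q q0 < r / 2"
    unfolding eventually_nhds_metric using r by (intro exI[of _ "r / 2"]) auto
  show ?thesis
    using order_tendstoD(1)[OF lim[OF q0t(1)] up] order_tendstoD(2)[OF lim[OF q0t(2)] dn] near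
  proof eventually_elim
    case (elim q)
    show ?case
    proof
      assume \<psi>: "\<psi> q = 0"
      have "continuous_on {- t0..t0} (\<lambda>t. \<phi> (q + t *\<^sub>R n))"
      proof (intro continuous_on_compose2[OF C2_continuous[OF C(1)]] continuous_intros image_subsetI)
        fix t assume "t \<in> {- t0..t0}"
        then have "\<bar>t\<bar> \<le> t0" by auto
        then show "q + t *\<^sub>R n \<in> W" using inB[OF elim(3)] BW(1) by blast
      qed
      then obtain t where t: "- t0 \<le> t" "t \<le> t0" "\<phi> (q + t *\<^sub>R n) = 0"
        using IVT'[of "\<lambda>t. \<phi> (q + t *\<^sub>R n)" "- t0" 0 t0] elim t0 by auto
      have m: "q + t *\<^sub>R n \<in> ball q0 r" "q \<in> ball q0 r"
        using inB[OF elim(3), of t] inB[OF elim(3), of 0] t t0 by auto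
      then have \<psi>t: "\<psi> (q + t *\<^sub>R n) = 0" using B t(3) by (simp add: dist_commute)
      have "t = 0"
      proof (rule ccontr)
        assume "t \<noteq> 0"
        then consider "t > 0" | "- t > 0" by linarith
        then show False
        proof cases
          case 1
          then show False using increasing_along[OF C(2) cB BW(2) _ m(2,1) 1] B \<psi> \<psi>t by (auto simp: dist_commute)
        next
          case 2
          then show False
            using increasing_along[OF C(2) cB BW(2) _ m(1), of n "- t"] m(2) B \<psi> \<psi>t by (auto simp: dist_commute)
        qed
      qed
      then show "\<phi> q = 0" using t by simp
    qed
  qed
qed

section \<open>Straight rays and segments, and the sign convention at extrema of the gauge\<close>

lemma rho4_scale_le:
  assumes "0 \<le> s" "s \<le> 1"
  shows "rho4 (s *\<^sub>R q) \<le> rho4 q"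
proof -
  have s2: "s\<^sup>2 \<le> 1" and s4: "s ^ 4 \<le> 1" using assms by (auto intro: power_le_one)
  have "rho4 (s *\<^sub>R q) = s ^ 4 * (fst q \<bullet> fst q)\<^sup>2 + s\<^sup>2 * (4 * (snd q)\<^sup>2)"
    by (simp add: rho4_def power_mult_distrib power4_eq_xxxx power2_eq_square mult_ac)
  also have "\<dots> \<le> 1 * (fst q \<bullet> fst q)\<^sup>2 + 1 * (4 * (snd q)\<^sup>2)"
    using s2 s4 by (intro add_mono mult_right_mono) auto
  finally show ?thesis by (simp add: rho4_def)
qed

lemma outside_of_large_rho4:
  fixes R :: "'n::finite heis set"
  assumes R: "\<And>q. q \<in> R \<Longrightarrow> rho4 q \<le> c" and q: "rho4 q > c" "q \<noteq> 0"
  shows "q \<in> outside R"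
proof -
  define ray where "ray = (\<lambda>s. s *\<^sub>R q) ` {1..}"
  have r1: "rho4 (s *\<^sub>R q) \<ge> rho4 q" if "s \<ge> 1" for s
    using rho4_scale_le[of "inverse s" "s *\<^sub>R q"] that by (simp add: field_simps)
  have sub: "ray \<subseteq> - R" using R r1 q(1) by (force simp: ray_def)
  have "connected ray" unfolding ray_def by (intro connected_continuous_image continuous_intros) (rule convex_connected, simp)
  then have "ray \<subseteq> connected_component_set (- R) q"
    using sub by (intro connected_component_maximal) (auto simp: ray_def image_iff intro!: bexI[of _ 1])
  moreover have "\<not> bounded ray"
  proof
    assume "bounded ray"
    then obtain K where K: "\<And>x. x \<in> ray \<Longrightarrow> norm x \<le> K" by (auto simp: bounded_iff)
    define s where "s = max 1 ((K + 1) / norm q)"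
    have "s *\<^sub>R q \<in> ray" unfolding ray_def by (rule imageI) (simp add: s_def)
    then have "s * norm q \<le> K" using K[of "s *\<^sub>R q"] by (simp add: s_def)
    moreover have "(K + 1) / norm q * norm q \<le> s * norm q" by (intro mult_right_mono) (auto simp: s_def)
    ultimately show False using q(2) by simp
  qed
  ultimately have "\<not> bounded (connected_component_set (- R) q)" using bounded_subset by blast
  moreover have "q \<notin> R" using R[of q] q(1) by auto
  ultimately show ?thesis by (simp add: outside)
qed

lemma component_of_small_rho4:
  fixes R :: "'n::finite heis set"
  assumes R: "\<And>q. q \<in> R \<Longrightarrow> rho4 q \<ge> c" and q: "rho4 q < c"
  shows "q \<in> connected_component_set (- R) 0"
proof -
  define seg where "seg = (\<lambda>s. s *\<^sub>R q) ` {0..1}"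
  have "seg \<subseteq> - R"
  proof
    fix x assume "x \<in> seg"
    then obtain s where s: "0 \<le> s" "s \<le> 1" "x = s *\<^sub>R q" by (auto simp: seg_def)
    then have "rho4 x < c" using rho4_scale_le[of s q] q by simp
    then show "x \<in> - R" using R[of x] by auto
  qed
  moreover have "connected seg" unfolding seg_def by (intro connected_continuous_image continuous_intros) (rule convex_connected, simp)
  moreover have "0 \<in> seg" by (auto simp: seg_def image_iff intro!: bexI[of _ 0])
  ultimately have "seg \<subseteq> connected_component_set (- R) 0" by (intro connected_component_maximal)
  moreover have "q \<in> seg" by (auto simp: seg_def image_iff intro!: bexI[of _ 1])
  ultimately show ?thesis by blast
qed

text \<open>Euler's identity for the generator of the Heisenberg dilations, under which
  \<open>rho4\<close> has degree four.\<close>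

lemma D1_rho4_dilation: "D1 rho4 q (fst q, 2 * snd q) = 4 * rho4 q"
  by (simp add: has_jet_D1[OF jet_rho4] rho4_def power2_eq_square)

lemma rho4_decreasing_direction:
  assumes "D1 rho4 q v < 0"
  shows "\<forall>\<^sub>F t in at_right 0. rho4 (q + t *\<^sub>R v) < rho4 q" "\<forall>\<^sub>F t in at_right 0. rho4 (q - t *\<^sub>R v) > rho4 q"
proof -
  have D: "((\<lambda>t. rho4 (q + t *\<^sub>R v)) has_real_derivative D1 rho4 q v) (at 0)"
  proof -
    have "((\<lambda>s. q + s *\<^sub>R v) has_derivative (\<lambda>h. h *\<^sub>R v)) (at 0)"
      by (auto intro!: derivative_eq_intros)
    moreover have "(rho4 has_derivative D1 rho4 q) (at (q + 0 *\<^sub>R v))"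
      using C2D(1)[OF C2_rho4, of q] by simp
    ultimately have "((\<lambda>s. rho4 (q + s *\<^sub>R v)) has_derivative (\<lambda>h. D1 rho4 q (h *\<^sub>R v))) (at 0)"
      by (rule has_derivative_compose)
    moreover have "D1 rho4 q (h *\<^sub>R v) = D1 rho4 q v * h" for h
      using linear_scale[OF C2D(4)[OF C2_rho4, of q]] by simp
    ultimately show ?thesis by (simp add: has_field_derivative_def)
  qed
  obtain d where d: "d > 0" "\<And>h. 0 < h \<Longrightarrow> h < d \<Longrightarrow> rho4 (q + (0 + h) *\<^sub>R v) < rho4 (q + 0 *\<^sub>R v)"
    using DERIV_neg_dec_right[OF D assms] by blast
  then show "\<forall>\<^sub>F t in at_right 0. rho4 (q + t *\<^sub>R v) < rho4 q"
    by (auto simp: eventually_at_right_field)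
  obtain d where d: "d > 0" "\<And>h. 0 < h \<Longrightarrow> h < d \<Longrightarrow> rho4 (q + 0 *\<^sub>R v) < rho4 (q + (0 - h) *\<^sub>R v)"
    using DERIV_neg_dec_left[OF D assms] by blast
  then show "\<forall>\<^sub>F t in at_right 0. rho4 (q - t *\<^sub>R v) > rho4 q"
    by (auto simp: eventually_at_right_field)
qed

context
  fixes A :: "('m::t2_space set \<times> ('m \<Rightarrow> real ^ ('n::{finite,linorder} + 'n))) set"
    and f N :: "'m \<Rightarrow> 'n heis"
  assumes atlas: "smooth_atlas A" and imm: "smooth_immersion A f" "0 \<notin> range f"
    and co: "coorientation A f N"
begin

lemma immersion_continuous: "continuous_on UNIV f"
proof (rule continuous_at_imp_continuous_on, rule ballI)
  fix p
  obtain V0 :: "(real ^ ('n + 'n)) set" and y h where V0: "open V0" "y \<in> V0" and h: "continuous_on V0 h" "h y = p"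
    and hop: "\<forall>B. open B \<longrightarrow> B \<subseteq> V0 \<longrightarrow> open (h ` B)" and sm: "smooth_on V0 (f \<circ> h)"
    using chart_at[OF atlas imm(1) co, of p] by metis
  show "isCont f p"
    unfolding continuous_at_open
  proof (intro allI impI)
    fix S assume S: "open S \<and> f p \<in> S"
    define B where "B = V0 \<inter> (f \<circ> h) -` S"
    have "open B" unfolding B_def
      by (rule continuous_open_preimage[OF smooth_on_continuous[OF sm] V0(1)]) (use S in simp)
    then have "open (h ` B)" using hop by (simp add: B_def)
    moreover have "p \<in> h ` B" using V0 h S by (auto simp: B_def)
    moreover have "\<forall>x'\<in>h ` B. f x' \<in> S" by (simp add: B_def)
    ultimately show "\<exists>T. open T \<and> p \<in> T \<and> (\<forall>x'\<in>T. f x' \<in> S)" by blast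
  qed
qed

text \<open>At an extremum the differential of the gauge vanishes on the tangent space. If it also
  vanished on the normal it would be zero, contrary to Euler's identity away from the
  origin.\<close>

lemma extremal_transversal:
  fixes \<sigma> :: real
  assumes \<sigma>: "\<sigma> \<noteq> 0" and max: "\<And>p'. \<sigma> * rho4 (f p') \<le> \<sigma> * rho4 (f p)"
  shows "D1 rho4 (f p) (N p) \<noteq> 0"
proof
  assume z: "D1 rho4 (f p) (N p) = 0"
  obtain V0 :: "(real ^ ('n + 'n)) set" and y h where V0: "open V0" "y \<in> V0" and h: "h y = p"
    and sm: "smooth_on V0 (f \<circ> h)" and inj: "\<forall>z\<in>V0. inj (frechet_derivative (f \<circ> h) (at z))"
    and n: "N p \<notin> range (frechet_derivative (f \<circ> h) (at y))"
    using chart_at[OF atlas imm(1) co, of p] by metis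
  have D: "((f \<circ> h) has_derivative frechet_derivative (f \<circ> h) (at y)) (at y)"
    by (rule smooth_on_has_derivative[OF sm V0(2)])
  have R: "(rho4 has_derivative D1 rho4 (f p)) (at ((f \<circ> h) y))" using C2D(1)[OF C2_rho4] h by simp
  have "((\<lambda>z. \<sigma> * rho4 ((f \<circ> h) z)) has_derivative (\<lambda>w. \<sigma> * D1 rho4 (f p) (frechet_derivative (f \<circ> h) (at y) w))) (at y)"
    using has_derivative_mult_right[OF has_derivative_compose[OF D R]] .
  then have "(\<lambda>w. \<sigma> * D1 rho4 (f p) (frechet_derivative (f \<circ> h) (at y) w)) = (\<lambda>v. 0)"
    by (rule differential_zero_maxmin[OF V0(2,1)]) (use max h in auto)
  then have crit: "D1 rho4 (f p) (frechet_derivative (f \<circ> h) (at y) w) = 0" for w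
    using \<sigma> by (metis mult_eq_0_iff)
  have l: "linear (D1 rho4 (f p))" using C2D(4)[OF C2_rho4] by simp
  have dim: "DIM('n heis) = Suc DIM(real ^ ('n + 'n))" by simp
  have "\<exists>w s. (fst (f p), 2 * snd (f p)) = frechet_derivative (f \<circ> h) (at y) w + s *\<^sub>R N p"
    by (rule complement_of_range[OF has_derivative_linear[OF D] bspec[OF inj V0(2)] dim n, of "(fst (f p), 2 * snd (f p))"]) blast
  then obtain w s where "(fst (f p), 2 * snd (f p)) = frechet_derivative (f \<circ> h) (at y) w + s *\<^sub>R N p" by blast
  then have "4 * rho4 (f p) = 0"
    using D1_rho4_dilation[of "f p"] by (simp add: linear_add[OF l] linear_scale[OF l] crit z)
  moreover have "f p \<noteq> 0" using imm(2) by (metis rangeI)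
  ultimately show False using rho4_pos[of "f p"] by simp
qed

text \<open>Points with larger gauge than the maximum are joined to infinity by a ray missing the
  surface. Were the derivative negative, the side \<open>- N\<close> would enter the
  exterior.\<close>

lemma outward_at_maximum:
  assumes out: "outward f N" and max: "\<And>p'. rho4 (f p') \<le> rho4 (f p)"
  shows "D1 rho4 (f p) (N p) > 0"
proof (rule ccontr)
  assume "\<not> ?thesis"
  moreover have "D1 rho4 (f p) (N p) \<noteq> 0" by (rule extremal_transversal[of 1]) (simp_all add: max)
  ultimately have "D1 rho4 (f p) (N p) < 0" by linarith
  from rho4_decreasing_direction(2)[OF this]
  have "\<forall>\<^sub>F t in at_right 0. f p - t *\<^sub>R N p \<in> outside (range f)"
  proof eventually_elim
    case (elim t)
    have "f p - t *\<^sub>R N p \<noteq> 0"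
    proof
      assume "f p - t *\<^sub>R N p = 0"
      then have "rho4 (f p - t *\<^sub>R N p) = 0" by (simp add: rho4_def)
      then show False using elim rho4_nonneg[of "f p"] by simp
    qed
    from outside_of_large_rho4[of "range f" "rho4 (f p)", OF _ elim this] max
    show ?case by (metis rangeE)
  qed
  moreover have "\<forall>\<^sub>F t in at_right 0. f p - t *\<^sub>R N p \<notin> outside (range f)"
    using out by (simp add: outward_def)
  ultimately have "\<forall>\<^sub>F t in at_right (0::real). False" by eventually_elim simp
  then show False by simp
qed

text \<open>Points with smaller gauge than the minimum are joined to the origin by a segment missing
  the surface. Were the derivative negative, \<open>N\<close> would point into the component of the
  origin, which the interior region excludes.\<close>

lemma outward_at_minimum:
  assumes int: "0 \<in> interior_region f N" and min: "\<And>p'. rho4 (f p') \<ge> rho4 (f p)"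
  shows "D1 rho4 (f p) (N p) > 0"
proof (rule ccontr)
  assume "\<not> ?thesis"
  moreover have "D1 rho4 (f p) (N p) \<noteq> 0" by (rule extremal_transversal[of "-1"]) (simp_all add: min)
  ultimately have "D1 rho4 (f p) (N p) < 0" by linarith
  from rho4_decreasing_direction(1)[OF this]
  have "\<forall>\<^sub>F t in at_right 0. f p + t *\<^sub>R N p \<in> connected_component_set (- range f) 0"
  proof eventually_elim
    case (elim t)
    from component_of_small_rho4[of "range f" "rho4 (f p)", OF _ elim] min
    show ?case by (metis rangeE)
  qed
  moreover have "\<forall>\<^sub>F t in at_right 0. f p + t *\<^sub>R N p \<notin> connected_component_set (- range f) 0"
    using int unfolding interior_region_def by blast
  ultimately have "\<forall>\<^sub>F t in at_right (0::real). False" by eventually_elim simp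
  then show False by simp
qed

end

section \<open>Touching off the axis\<close>

text \<open>At \<open>d = 0\<close> this vanishes on the Heisenberg sphere through \<open>q1 = (x, z)\<close> only at \<open>q1\<close> and
  \<open>(- x, z)\<close>; \<open>d > 0\<close> makes the last hypothesis of \<open>tan_lap_sep_neg\<close> strict.\<close>

definition hopf :: "'n::finite heis \<Rightarrow> real \<Rightarrow> 'n heis \<Rightarrow> real" where
  "hopf q1 d = sep (fst q1) ((1 - d) * (xsq q1)\<^sup>2) ((1 - d) * (2 * snd q1 * xsq q1)) (snd q1)"

lemma continuous_hopf:
  "continuous_on {x. fst (snd (snd x)) \<noteq> 0} (\<lambda>x :: 'n::finite heis \<times> real \<times> 'n heis. hopf (fst x) (fst (snd x)) (snd (snd x)))"
  unfolding hopf_def sep_def T1_def T2_def J1_def J2_def slope_def inv_xsq_def re_def xsq_def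
  by (intro continuous_intros linear_continuous_on_compose[OF _ linear_Jp]) auto

lemma sep_nonneg: "sep e k1 k2 z q \<ge> 0"
  by (simp add: sep_def)

lemma sep_eq_0: "sep e k1 k2 z q = 0 \<longleftrightarrow> T1 e q = k1 \<and> T2 e q = k2 \<and> snd q = z"
proof -
  have "a * a + b * b + (c * c) * (c * c) = 0 \<longleftrightarrow> a = 0 \<and> b = 0 \<and> c = 0" for a b c :: real
    using sum_power2_eq_zero_iff[of a b] by (smt (verit) mult_eq_0_iff power2_eq_square zero_le_square)
  from this[of "T1 e q + - k1" "T2 e q + - k2" "snd q + - z"] show ?thesis by (auto simp: sep_def)
qed

lemma hopf_self:
  assumes q: "q \<in> nonaxis"
  shows "hopf q 0 q = 0"
proof -
  have "re (fst q) q = xsq q" "im (fst q) q = 0" by (simp_all add: re_def xsq_def)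
  then have "J1 (fst q) q = (xsq q)\<^sup>2" "J2 (fst q) q = 0" by (simp_all add: J1_def J2_def power2_eq_square)
  then show ?thesis
    using xsq_pos[OF q] by (simp add: hopf_def sep_eq_0 T1_def T2_def slope_def inv_xsq_def power2_eq_square field_simps)
qed

text \<open>Equal z and equal gauge give equal |x|, and then the equation for T says w^2 = |x|^4 for
  the complex coordinate w along \<open>fst q1\<close>. Positivity selects w = |x|^2, the equality
  case of the Cauchy-Schwarz inequality.\<close>

lemma hopf_zero:
  assumes q: "q \<in> nonaxis" "q1 \<in> nonaxis" and S: "rho4 q = rho4 q1" and pos: "fst q1 \<bullet> fst q > 0"
    and z: "hopf q1 0 q = 0"
  shows "q = q1"
proof -
  define A k c1 c2 where "A = xsq q" and "k = snd q / xsq q" and "c1 = re (fst q1) q" and "c2 = im (fst q1) q"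
  have A: "A > 0" using xsq_pos[OF q(1)] by (simp add: A_def)
  have zz: "snd q = snd q1" and T: "T1 (fst q1) q = (xsq q1)\<^sup>2" "T2 (fst q1) q = 2 * snd q1 * xsq q1"
    using z by (auto simp: hopf_def sep_eq_0)
  have "(xsq q)\<^sup>2 = (xsq q1)\<^sup>2" using S zz by (simp add: rho4_xsq)
  then have A1: "xsq q1 = A" using xsq_pos[OF q(1)] xsq_pos[OF q(2)] by (simp add: A_def)
  have sl: "slope q = k" by (simp add: slope_def inv_xsq_def k_def divide_inverse)
  have zk: "snd q1 = k * A" using A zz by (simp add: k_def A_def)
  define j1 j2 where "j1 = c1 * c1 - c2 * c2" and "j2 = c1 * c2"
  have e1: "j1 - 4 * k * j2 = A * A" and e2: "2 * j2 + 2 * k * j1 = 2 * k * A * A"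
    using T by (simp_all add: T1_def T2_def J1_def J2_def sl A1 zk j1_def j2_def c1_def c2_def power2_eq_square mult.assoc)
  have "j2 = k * A * A - k * j1" using e2 by linarith
  then have "j1 - 4 * k * (k * A * A - k * j1) = A * A" using e1 by simp
  then have "(1 + 4 * (k * k)) * (j1 - A * A) = 0" by (simp add: algebra_simps)
  moreover have "1 + 4 * (k * k) > 0" by (simp add: add_pos_nonneg)
  ultimately have j1: "j1 = A * A" by simp
  then have j2: "c1 * c2 = 0" using e2 by (simp add: j2_def)
  have c1: "c1 > 0" using pos by (simp add: c1_def re_def)
  then have "c2 = 0" using j2 by simp
  then have "c1 * c1 = A * A" using j1 by (simp add: j1_def)
  then have "c1 = A" using c1 A by (metis abs_of_pos abs_mult_self_eq power2_eq_square real_sqrt_abs)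
  then have "(fst q - fst q1) \<bullet> (fst q - fst q1) = 0"
    using A1 by (simp add: inner_diff_left inner_diff_right c1_def re_def A_def xsq_def inner_commute)
  then show ?thesis using zz by (simp add: prod_eq_iff)
qed

lemma hopf_subsolution:
  fixes q1 :: "'n::finite heis"
  assumes n: "CARD('n) \<ge> 2" and q: "q \<in> nonaxis" "q1 \<in> nonaxis" and S: "rho4 q = rho4 q1" and pos: "fst q1 \<bullet> fst q > 0"
    and h: "hopf q1 d q > 0" and d: "0 < d" "d < 1" and Q: "tan_inner q (hopf q1 d) (hopf q1 d) = 0"
  shows "tan_lap q (hopf q1 d) < 0"
  unfolding hopf_def
proof (rule tan_lap_sep_neg[OF q(1) n])
  show "tan_inner q (sep (fst q1) ((1 - d) * (xsq q1)\<^sup>2) ((1 - d) * (2 * snd q1 * xsq q1)) (snd q1))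
     (sep (fst q1) ((1 - d) * (xsq q1)\<^sup>2) ((1 - d) * (2 * snd q1 * xsq q1)) (snd q1)) = 0"
    using Q by (simp add: hopf_def)
  show "0 < sep (fst q1) ((1 - d) * (xsq q1)\<^sup>2) ((1 - d) * (2 * snd q1 * xsq q1)) (snd q1) q"
    using h by (simp add: hopf_def)
  show "0 < modsq (fst q1) q" using pos by (simp add: modsq_def re_def add_pos_nonneg)
  have A1: "xsq q1 > 0" using xsq_pos[OF q(2)] .
  \<comment> \<open>The centre of the squared distance is T at \<open>q1\<close> scaled by 1 - d, so
    its modulus falls strictly below rho^2 |x1|^2.\<close>
  have "((1 - d) * (xsq q1)\<^sup>2)\<^sup>2 + ((1 - d) * (2 * snd q1 * xsq q1))\<^sup>2 = (1 - d)\<^sup>2 * (rho4 q1 * (xsq q1)\<^sup>2)"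
    by (simp add: rho4_xsq power2_eq_square algebra_simps)
  also have "\<dots> < 1 * (rho4 q1 * (xsq q1)\<^sup>2)"
    using d A1 rho4_nonaxis[OF q(2)] by (intro mult_strict_right_mono) (auto simp: power_less_one_iff)
  finally show "((1 - d) * (xsq q1)\<^sup>2)\<^sup>2 + ((1 - d) * (2 * snd q1 * xsq q1))\<^sup>2 < rho4 q * (fst q1 \<bullet> fst q1)\<^sup>2"
    by (simp add: S xsq_def)
qed

lemma C2_hopf: "C2 (hopf q1 d) nonaxis"
  unfolding hopf_def by (rule C2_sep)

text \<open>The ball is fixed before \<open>q1\<close> is selected close to its centre, so the level
  that separates the centre from the boundary part of the sphere has to serve all nearby
  \<open>q1\<close> and all small \<open>d\<close>. Twice the level bounds the unperturbed function
  on the boundary, and uniform continuity gives up one half.\<close>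

lemma hopf_uniform:
  fixes q0 :: "'n::finite heis"
  assumes r: "r > 0" "cball q0 r \<subseteq> nonaxis"
    and pos: "\<And>a b. a \<in> cball q0 r \<Longrightarrow> b \<in> cball q0 r \<Longrightarrow> fst a \<bullet> fst b > 0"
  obtains \<mu> \<eta> where "\<mu> > 0" "\<eta> > 0"
    "\<forall>q1 d. dist q1 q0 < \<eta> \<longrightarrow> 0 \<le> d \<longrightarrow> d < \<eta> \<longrightarrow> hopf q1 d q0 < \<mu> \<and>
      (\<forall>q. dist q q0 = r \<longrightarrow> rho4 q = rho4 q0 \<longrightarrow> hopf q1 d q > \<mu>)"
proof -
  define D where "D = {q. dist q q0 = r \<and> rho4 q = rho4 q0}"
  have Dr: "D \<subseteq> cball q0 r" by (auto simp: D_def dist_commute)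
  have cD: "compact D"
  proof -
    have "closed {q. dist q q0 = r}" by (intro closed_Collect_eq continuous_intros)
    moreover have "closed {q. rho4 q = rho4 q0}" by (intro closed_Collect_eq continuous_rho4 continuous_intros)
    ultimately have "closed D" unfolding D_def by (rule closed_Collect_conj)
    then show ?thesis using compact_cball Dr by (metis compact_Int_closed inf.absorb_iff2)
  qed
  have q0: "q0 \<in> cball q0 r" using r by simp
  have cont: "continuous_on (cball q0 r \<times> {0..1} \<times> cball q0 r) (\<lambda>x. hopf (fst x) (fst (snd x)) (snd (snd x)))"
    by (rule continuous_on_subset[OF continuous_hopf]) (use r in auto)
  obtain \<mu> where \<mu>: "\<mu> > 0" "\<And>q. q \<in> D \<Longrightarrow> hopf q0 0 q \<ge> 2 * \<mu>"
  proof (cases "D = {}")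
    case True
    then show ?thesis using that[of 1] by auto
  next
    case False
    have "continuous_on D (\<lambda>q. hopf q0 0 q)"
      using Dr q0 r by (intro continuous_on_compose2[OF cont, of D "\<lambda>q. (q0, 0, q)", simplified] continuous_intros) auto
    from continuous_attains_inf[OF cD False this] obtain a where a: "a \<in> D" "\<And>q. q \<in> D \<Longrightarrow> hopf q0 0 a \<le> hopf q0 0 q" by blast
    have "hopf q0 0 a \<noteq> 0"
    proof
      assume "hopf q0 0 a = 0"
      moreover have "a \<in> nonaxis" "q0 \<in> nonaxis" "fst q0 \<bullet> fst a > 0" "rho4 a = rho4 q0"
        using a(1) Dr q0 r(2) pos[of q0 a] by (blast, blast, blast, simp add: D_def)
      ultimately have "a = q0" by (intro hopf_zero)
      then show False using a(1) r by (simp add: D_def)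
    qed
    moreover have "hopf q0 0 a \<ge> 0" by (simp add: hopf_def sep_nonneg)
    ultimately show ?thesis using that[of "hopf q0 0 a / 2"] a(2) by simp
  qed
  have "uniformly_continuous_on (cball q0 r \<times> {0..1} \<times> cball q0 r) (\<lambda>x. hopf (fst x) (fst (snd x)) (snd (snd x)))"
    by (rule compact_uniformly_continuous[OF cont]) (intro compact_Times compact_cball compact_Icc)
  then obtain \<eta>' where \<eta>': "\<eta>' > 0" "\<And>x x'. x \<in> cball q0 r \<times> {0..1} \<times> cball q0 r \<Longrightarrow> x' \<in> cball q0 r \<times> {0..1} \<times> cball q0 r \<Longrightarrow>
      dist x' x < \<eta>' \<Longrightarrow> dist (hopf (fst x') (fst (snd x')) (snd (snd x'))) (hopf (fst x) (fst (snd x)) (snd (snd x))) < \<mu>"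
    unfolding uniformly_continuous_on_def using \<mu>(1) by metis
  define \<eta> where "\<eta> = min (\<eta>' / 2) (min r 1)"
  have close: "\<bar>hopf q1 d q - hopf q0 0 q\<bar> < \<mu>" if "dist q1 q0 < \<eta>" "0 \<le> d" "d < \<eta>" "q \<in> cball q0 r" for q1 d q
  proof -
    have "dist (q1, d, q) (q0, 0, q) \<le> dist q1 q0 + dist (d, q) (0, q)"
      unfolding dist_Pair_Pair[of q1] by (rule sqrt_sum_squares_le_sum) auto
    also have "dist (d, q) (0, q) \<le> dist d 0 + dist q q"
      unfolding dist_Pair_Pair by (rule sqrt_sum_squares_le_sum) auto
    finally have "dist (q1, d, q) (q0, 0, q) < \<eta>'"
      using that by (simp add: \<eta>_def dist_real_def)
    then show ?thesis
      using \<eta>'(2)[of "(q0, 0, q)" "(q1, d, q)"] that q0 by (auto simp: \<eta>_def dist_real_def dist_commute)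
  qed
  have h0: "hopf q0 0 q0 = 0" using hopf_self q0 r by blast
  show ?thesis
  proof (rule that[of \<mu> \<eta>])
    show "\<eta> > 0" using \<eta>' r by (simp add: \<eta>_def)
    show "\<forall>q1 d. dist q1 q0 < \<eta> \<longrightarrow> 0 \<le> d \<longrightarrow> d < \<eta> \<longrightarrow> hopf q1 d q0 < \<mu> \<and>
      (\<forall>q. dist q q0 = r \<longrightarrow> rho4 q = rho4 q0 \<longrightarrow> hopf q1 d q > \<mu>)"
    proof (intro allI impI conjI)
      fix q1 :: "'n heis" and d :: real
      assume a: "dist q1 q0 < \<eta>" "0 \<le> d" "d < \<eta>"
      show "hopf q1 d q0 < \<mu>" using close[OF a q0] h0 by simp
      fix q assume "dist q q0 = r" "rho4 q = rho4 q0"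
      then have "q \<in> D" by (simp add: D_def)
      then show "hopf q1 d q > \<mu>" using close[OF a, of q] \<mu>(2)[of q] Dr by force
    qed
  qed (rule \<mu>(1))
qed

lemma isCont_UNIV: "continuous_on UNIV w \<Longrightarrow> isCont w x"
  by (simp add: continuous_on_eq_continuous_at)

context
  fixes A :: "('m::t2_space set \<times> ('m \<Rightarrow> real ^ ('n::{finite,linorder} + 'n))) set"
    and f N :: "'m \<Rightarrow> 'n heis" and \<sigma> c :: real
  assumes n: "CARD('n) \<ge> 2" and atlas: "smooth_atlas A" and imm: "smooth_immersion A f" "0 \<notin> range f"
    and co: "coorientation A f N" and \<sigma>: "\<sigma> * \<sigma> = 1"
    and H: "\<And>p. nonsingular_at f N p \<Longrightarrow> \<sigma> * H_surf f N p \<le> 0"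
    and max: "\<And>p. \<sigma> * rho4 (f p) \<le> \<sigma> * c"
    and orient: "\<And>p. rho4 (f p) = c \<Longrightarrow> D1 rho4 (f p) (N p) > 0"
begin

text \<open>Otherwise some \<open>q1\<close> of the sphere near the touching point is missed by the
  sheet. With a Hopf barrier centred there, the gauge plus a small multiple of the barrier is
  maximized over the compact piece of the sheet. The maxima converge to an interior touching point,
  near which the perturbed gauge is a strict subsolution, contradicting
  \<open>no_touching\<close>.\<close>

lemma sphere_in_sheet:
  assumes l: "local_defining_function f N p0 \<phi>" and touch: "rho4 (f p0) = c" and axis: "f p0 \<in> nonaxis"
    and U: "open U" "p0 \<in> U" and W: "open W" "C2 \<phi> W" "f ` U = {q \<in> W. \<phi> q = 0}"
    and dN: "\<forall>p'\<in>U. f p' \<in> W \<and> \<phi> (f p') = 0 \<and> D1 \<phi> (f p') (N p') > 0"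
    and lU: "\<forall>p'\<in>U. local_defining_function f N p' \<phi>"
  shows "\<forall>\<^sub>F q in nhds (f p0). rho4 q = c \<longrightarrow> \<phi> q = 0"
proof (rule ccontr)
  assume neg: "\<not> ?thesis"
  define q0 n0 where "q0 = f p0" and "n0 = N p0"
  have q0W: "q0 \<in> W" and \<phi>0: "\<phi> q0 = 0" and \<phi>n: "D1 \<phi> q0 n0 > 0" using dN U(2) by (auto simp: q0_def n0_def)
  have S0: "rho4 q0 = c" and Sn: "D1 rho4 q0 n0 > 0" using touch orient by (auto simp: q0_def n0_def)
  have ax: "q0 \<in> nonaxis" using axis by (simp add: q0_def)
  have c\<phi>: "isCont (\<lambda>q. D1 \<phi> q n0) q0" and cS: "isCont (\<lambda>q. D1 rho4 q n0) q" for q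
    by (rule has_derivative_continuous[OF C2D(2)[OF W(2) q0W]], rule has_derivative_continuous[OF C2D(2)[OF C2_rho4 UNIV_I]])
  define x0 where "x0 = fst q0"
  have x0: "norm x0 > 0" using ax by (simp add: x0_def)
  have ev: "\<forall>\<^sub>F q in nhds q0. D1 \<phi> q n0 > 0 \<and> D1 rho4 q n0 > 0 \<and> q \<in> W \<and> norm (fst q - x0) < norm x0 / 3"
  proof (intro eventually_conj)
    show "\<forall>\<^sub>F q in nhds q0. D1 \<phi> q n0 > 0" by (rule order_tendstoD(1)[OF isCont_nhds[OF c\<phi>] \<phi>n])
    show "\<forall>\<^sub>F q in nhds q0. D1 rho4 q n0 > 0" by (rule order_tendstoD(1)[OF isCont_nhds[OF cS] Sn])
    show "\<forall>\<^sub>F q in nhds q0. q \<in> W" by (rule eventually_nhds_in_open[OF W(1) q0W])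
    have "isCont (\<lambda>q. norm (fst q - x0)) q0" by (intro continuous_intros)
    from order_tendstoD(2)[OF isCont_nhds[OF this], of "norm x0 / 3"]
    show "\<forall>\<^sub>F q in nhds q0. norm (fst q - x0) < norm x0 / 3" using x0 by (simp add: x0_def)
  qed
  then obtain r' where r': "r' > 0" "\<And>q. dist q q0 < r' \<Longrightarrow> D1 \<phi> q n0 > 0 \<and> D1 rho4 q n0 > 0 \<and> q \<in> W \<and> norm (fst q - x0) < norm x0 / 3"
    unfolding eventually_nhds_metric by blast
  define r where "r = r' / 2"
  have r: "r > 0" using r' by (simp add: r_def)
  have R: "D1 \<phi> q n0 > 0" "q \<in> W" "norm (fst q - x0) < norm x0 / 3" "D1 rho4 q n0 > 0" if "q \<in> cball q0 r" for q
    using r'(2)[of q] r'(1) that by (auto simp: r_def dist_commute)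
  \<comment> \<open>With both deviations below one third of |x0| the inner product stays above (1 -
    2/3 - 1/9) |x0|^2. This excludes the antipodal zero of the barrier and keeps the ball off the
    axis.\<close>
  have pos: "fst a \<bullet> fst b > 0" if "a \<in> cball q0 r" "b \<in> cball q0 r" for a b
  proof -
    define u v where "u = fst a - x0" and "v = fst b - x0"
    have uv: "norm u < norm x0 / 3" "norm v < norm x0 / 3" using R(3) that by (auto simp: u_def v_def)
    have e: "fst a \<bullet> fst b = x0 \<bullet> x0 + (x0 \<bullet> v + u \<bullet> x0 + u \<bullet> v)"
      by (simp add: u_def v_def inner_diff_left inner_diff_right)
    have "norm x0 * norm v \<le> norm x0 * (norm x0 / 3)" "norm u * norm x0 \<le> (norm x0 / 3) * norm x0"
      "norm u * norm v \<le> (norm x0 / 3) * (norm x0 / 3)"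
      by (intro mult_mono; use uv in auto)+
    moreover note Cauchy_Schwarz_ineq2[of x0 v] Cauchy_Schwarz_ineq2[of u x0] Cauchy_Schwarz_ineq2[of u v]
    moreover have "x0 \<bullet> x0 = norm x0 * norm x0" by (simp add: dot_square_norm power2_eq_square)
    moreover have "norm x0 * norm x0 > 0" using x0 by simp
    ultimately show ?thesis unfolding e by (simp add: abs_le_iff field_simps)
  qed
  have nax: "cball q0 r \<subseteq> nonaxis"
  proof
    fix q assume "q \<in> cball q0 r"
    then show "q \<in> nonaxis" using pos[of q q] by auto
  qed
  obtain \<mu> \<eta> where \<mu>: "\<mu> > 0" "\<eta> > 0"
    and sepa: "\<forall>q1 d. dist q1 q0 < \<eta> \<longrightarrow> 0 \<le> d \<longrightarrow> d < \<eta> \<longrightarrow> hopf q1 d q0 < \<mu> \<and>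
      (\<forall>q. dist q q0 = r \<longrightarrow> rho4 q = rho4 q0 \<longrightarrow> hopf q1 d q > \<mu>)"
    using hopf_uniform[OF r nax pos] by metis
  have "\<exists>q1. dist q1 q0 < min \<eta> r \<and> rho4 q1 = c \<and> \<phi> q1 \<noteq> 0"
    using neg \<mu> r unfolding eventually_nhds_metric q0_def[symmetric] by (meson min_less_iff_conj)
  then obtain q1 where q1: "dist q1 q0 < \<eta>" "dist q1 q0 < r" "rho4 q1 = c" "\<phi> q1 \<noteq> 0" by auto
  have q1r: "q1 \<in> cball q0 r" using q1(2) by (simp add: dist_commute)
  have q1ax: "q1 \<in> nonaxis" using q1r nax by blast
  have q0r: "q0 \<in> cball q0 r" using r by simp
  \<comment> \<open>\<open>K\<close> is the compact piece of the sheet in the ball and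
    \<open>T\<close> its touching points; \<open>q1\<close> belongs to neither.\<close>
  define K where "K = {q \<in> cball q0 r. \<phi> q = 0}"
  define T where "T = {q \<in> K. rho4 q = c}"
  have cK: "compact K"
  proof -
    have "closedin (top_of_set (cball q0 r)) (cball q0 r \<inter> \<phi> -` {0})"
      by (intro continuous_closedin_preimage continuous_on_subset[OF C2_continuous[OF W(2)]]) (use R(2) in auto)
    then have "compact (cball q0 r \<inter> \<phi> -` {0})" using compact_cball closedin_compact by blast
    moreover have "cball q0 r \<inter> \<phi> -` {0} = K" by (auto simp: K_def)
    ultimately show ?thesis by simp
  qed
  have cT: "compact T"
  proof -
    have "closed {q. rho4 q = c}" by (intro closed_Collect_eq continuous_rho4 continuous_intros)
    then have "compact (K \<inter> {q. rho4 q = c})" using cK by (rule compact_Int_closed[rotated])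
    moreover have "K \<inter> {q. rho4 q = c} = T" by (auto simp: T_def)
    ultimately show ?thesis by simp
  qed
  have Kr: "K \<subseteq> cball q0 r" and Kax: "K \<subseteq> nonaxis" and TK: "T \<subseteq> K" using nax by (auto simp: K_def T_def)
  have q0T: "q0 \<in> T" using \<phi>0 S0 q0r by (simp add: T_def K_def)
  have K\<sigma>: "\<sigma> * rho4 q \<le> \<sigma> * c" if "q \<in> K" for q
  proof -
    have "q \<in> f ` U" using that R(2) by (auto simp: K_def W(3))
    then show ?thesis using max by auto
  qed
  \<comment> \<open>At d = 0 the function is zero on the sphere in this ball only at
    \<open>q1\<close>, which is not in \<open>T\<close>. By compactness it stays positive on
    \<open>T\<close> for some positive \<open>d\<close>.\<close>
  obtain d where d: "0 < d" "d < 1" "d < \<eta>" "\<And>q. q \<in> T \<Longrightarrow> hopf q1 d q > 0"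
  proof -
    have cont: "continuous_on ({0..1} \<times> T) (\<lambda>x. hopf q1 (fst x) (snd x))"
      using TK Kax by (intro continuous_on_compose2[OF continuous_hopf, of _ "\<lambda>x. (q1, fst x, snd x)", simplified] continuous_intros) auto
    have cT0: "continuous_on T (\<lambda>q. hopf q1 0 q)"
      by (rule continuous_on_compose2[OF cont, of T "\<lambda>q. (0, q)", simplified]) (auto intro!: continuous_intros)
    obtain a where a: "a \<in> T" "\<And>q. q \<in> T \<Longrightarrow> hopf q1 0 a \<le> hopf q1 0 q"
      using continuous_attains_inf[OF cT _ cT0] q0T by blast
    have "hopf q1 0 a \<noteq> 0"
    proof
      assume h: "hopf q1 0 a = 0"
      have "a \<in> nonaxis" "a \<in> cball q0 r" using a(1) TK Kr Kax by blast+
      moreover have "rho4 a = rho4 q1" using a(1) q1(3) by (simp add: T_def)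
      ultimately have "a = q1" using hopf_zero[OF _ q1ax _ pos[OF q1r, of a] h] by blast
      then show False using a(1) q1(4) by (simp add: T_def K_def)
    qed
    moreover have "hopf q1 0 a \<ge> 0" by (simp add: hopf_def sep_nonneg)
    ultimately have m: "hopf q1 0 a > 0" by simp
    have "uniformly_continuous_on ({0..1} \<times> T) (\<lambda>x. hopf q1 (fst x) (snd x))"
      by (rule compact_uniformly_continuous[OF cont]) (intro compact_Times cT compact_Icc)
    then obtain e where e: "e > 0" "\<And>x x'. x \<in> {0..1} \<times> T \<Longrightarrow> x' \<in> {0..1} \<times> T \<Longrightarrow>
        dist x' x < e \<Longrightarrow> dist (hopf q1 (fst x') (snd x')) (hopf q1 (fst x) (snd x)) < hopf q1 0 a"
      unfolding uniformly_continuous_on_def using m by metis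
    define d where "d = min (e / 2) (min (\<eta> / 2) (1 / 2))"
    have dd: "0 < d" "d < 1" "d < \<eta>" "d < e" using e \<mu> by (auto simp: d_def)
    show ?thesis
    proof (rule that[OF dd(1-3)])
      fix q assume q: "q \<in> T"
      have "dist (d, q) (0, q) = d" using dd by (simp add: dist_Pair_Pair dist_real_def)
      then show "hopf q1 d q > 0"
        using e(2)[of "(0, q)" "(d, q)"] q dd a(2)[OF q] by (simp add: dist_real_def abs_diff_less_iff)
    qed
  qed
  define g where "g = hopf q1 d"
  have g0: "g q0 < \<mu>" and gD: "\<And>q. dist q q0 = r \<Longrightarrow> rho4 q = c \<Longrightarrow> g q > \<mu>"
  proof -
    have "hopf q1 d q0 < \<mu> \<and> (\<forall>q. dist q q0 = r \<longrightarrow> rho4 q = rho4 q0 \<longrightarrow> hopf q1 d q > \<mu>)"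
      using sepa q1(1) less_imp_le[OF d(1)] d(3) by blast
    then show "g q0 < \<mu>" "\<And>q. dist q q0 = r \<Longrightarrow> rho4 q = c \<Longrightarrow> g q > \<mu>" unfolding g_def S0 by blast+
  qed
  have gnn: "g q \<ge> 0" for q by (simp add: g_def hopf_def sep_nonneg)
  have gC: "C2 g nonaxis" unfolding g_def by (rule C2_hopf)
  have Tax: "T \<subseteq> nonaxis" using TK Kax by blast
  obtain lam where lam: "lam > 0" "\<And>q. q \<in> T \<Longrightarrow> lam * tan_inner q g g - tan_lap q g > 0"
  proof (rule exists_multiplier[OF cT])
    show "continuous_on T (\<lambda>q. tan_lap q g)"
      by (rule continuous_on_subset[OF continuous_perturbation(1)[OF gC order_refl] Tax])
    show "continuous_on T (\<lambda>q. tan_inner q g g)"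
      by (rule continuous_on_subset[OF continuous_tan_inner[OF gC order_refl] Tax])
    show "tan_inner q g g \<ge> 0" if "q \<in> T" for q
      unfolding g_def hopf_def by (rule tan_inner_sep_nonneg) (use that Tax in blast)
    show "tan_lap q g < 0" if q: "q \<in> T" "tan_inner q g g = 0" for q
      unfolding g_def
    proof (rule hopf_subsolution[OF n _ q1ax _ _ d(4)[OF q(1)] d(1,2)])
      show "q \<in> nonaxis" using q(1) Tax by blast
      show "rho4 q = rho4 q1" using q(1) q1(3) by (simp add: T_def)
      show "fst q1 \<bullet> fst q > 0" using pos[OF q1r, of q] q(1) TK Kr by blast
      show "tan_inner q (hopf q1 d) (hopf q1 d) = 0" using q(2) by (simp add: g_def)
    qed
  qed blast
  define h where "h q = exp (- lam * g q)" for q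
  have hC: "C2 h nonaxis" unfolding h_def[abs_def] by (rule exp_barrier(1)[OF gC])
  have hL: "tan_lap q h > 0" if "q \<in> T" for q
  proof -
    have q: "q \<in> nonaxis" using that Tax by blast
    show ?thesis
      unfolding h_def[abs_def] exp_barrier(2)[OF gC q] using lam that by (intro mult_pos_pos) auto
  qed
  have h01: "0 \<le> h q" "h q \<le> 1" for q using lam(1) gnn[of q] by (auto simp: h_def)
  define \<epsilon> where "\<epsilon> k = 1 / (real k + 1)" for k :: nat
  have \<epsilon>: "\<epsilon> k > 0" for k by (simp add: \<epsilon>_def add_nonneg_pos)
  have \<epsilon>lim: "\<epsilon> \<longlonglongrightarrow> 0" unfolding \<epsilon>_def using LIMSEQ_inverse_real_of_nat by (simp add: inverse_eq_divide add.commute)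
  have "\<exists>q\<in>K. \<forall>q'\<in>K. \<sigma> * rho4 q' + \<epsilon> k * h q' \<le> \<sigma> * rho4 q + \<epsilon> k * h q" for k
  proof -
    have "continuous_on K (\<lambda>q. \<sigma> * rho4 q + \<epsilon> k * h q)"
      by (intro continuous_intros continuous_rho4 continuous_on_subset[OF C2_continuous[OF hC] Kax])
    then show ?thesis using continuous_attains_sup[OF cK] q0T TK by blast
  qed
  then obtain qs where qs: "\<And>k. qs k \<in> K" "\<And>k q'. q' \<in> K \<Longrightarrow> \<sigma> * rho4 q' + \<epsilon> k * h q' \<le> \<sigma> * rho4 (qs k) + \<epsilon> k * h (qs k)"
    by metis
  obtain q2 s where q2: "q2 \<in> K" "strict_mono s" "(qs \<circ> s) \<longlonglongrightarrow> q2"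
    using cK qs(1) unfolding compact_def by metis
  have es: "(\<lambda>k. \<epsilon> (s k)) \<longlonglongrightarrow> 0" using LIMSEQ_subseq_LIMSEQ[OF \<epsilon>lim q2(2)] by (simp add: o_def)
  have qslim: "(\<lambda>k. qs (s k)) \<longlonglongrightarrow> q2" using q2(3) by (simp add: o_def)
  have q2ax: "q2 \<in> nonaxis" using q2(1) Kax by blast
  \<comment> \<open>Comparison with the value at \<open>q0\<close>, where the gauge is already
    extremal: the barrier is at most one, so the gauge loses at most \<epsilon>; and since the gauge
    cannot gain, the barrier cannot be smaller than at \<open>q0\<close>.\<close>
  have low: "\<sigma> * c - \<epsilon> k \<le> \<sigma> * rho4 (qs k)" "h q0 \<le> h (qs k)" for k
  proof -
    have 1: "\<sigma> * c + \<epsilon> k * h q0 \<le> \<sigma> * rho4 (qs k) + \<epsilon> k * h (qs k)" using qs(2)[of q0 k] q0T TK S0 by auto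
    have 2: "\<epsilon> k * h q0 \<ge> 0" "\<epsilon> k * h (qs k) \<le> \<epsilon> k" using \<epsilon>[of k] h01 by (auto intro: mult_left_le)
    show "\<sigma> * c - \<epsilon> k \<le> \<sigma> * rho4 (qs k)" using 1 2 by linarith
    have "\<epsilon> k * h q0 \<le> \<epsilon> k * h (qs k)" using 1 K\<sigma>[OF qs(1)[of k]] by linarith
    then show "h q0 \<le> h (qs k)" using \<epsilon>[of k] by simp
  qed
  have lim_of: "(\<lambda>k. w (qs (s k))) \<longlonglongrightarrow> w q2" if "isCont w q2" for w :: "'n heis \<Rightarrow> real"
    using isCont_tendsto_compose[OF that qslim] .
  have nax_cont: "isCont w q2" if "continuous_on nonaxis w" for w :: "'n heis \<Rightarrow> real"
    using iffD1[OF continuous_on_eq_continuous_at[OF open_nonaxis] that] q2ax by blast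
  note rlim = lim_of[OF isCont_UNIV[OF continuous_rho4]]
  have "\<sigma> * c - 0 \<le> \<sigma> * rho4 q2"
    by (rule LIMSEQ_le[OF tendsto_diff[OF tendsto_const es] tendsto_mult_left[OF rlim]]) (use low(1) in auto)
  then have "\<sigma> * rho4 q2 = \<sigma> * c" using K\<sigma>[OF q2(1)] by linarith
  then have "(\<sigma> * \<sigma>) * rho4 q2 = (\<sigma> * \<sigma>) * c" by (simp add: mult.assoc)
  then have S2: "rho4 q2 = c" by (simp add: \<sigma>)
  have q2T: "q2 \<in> T" using q2(1) S2 by (simp add: T_def)
  have "h q0 \<le> h q2"
    by (rule LIMSEQ_le_const[OF lim_of[OF nax_cont[OF C2_continuous[OF hC]]]]) (use low(2) in auto)
  \<comment> \<open>The barrier decreases in \<open>g\<close>, so \<open>q2\<close> lies on the same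
    side of the level \<open>\<mu>\<close> as \<open>q0\<close>. Hence it is not on the boundary of
    the ball and the maxima are eventually interior.\<close>
  then have "g q2 \<le> g q0" using lam(1) by (simp add: h_def)
  then have "dist q2 q0 \<noteq> r" using g0 gD[of q2] S2 by force
  then have q2in: "dist q2 q0 < r" using q2(1) Kr by (force simp: dist_commute)
  have "\<forall>\<^sub>F k in sequentially. qs (s k) \<in> ball q0 r"
    by (rule topological_tendstoD[OF qslim]) (use q2in in \<open>auto simp: dist_commute\<close>)
  \<comment> \<open>The second and third order terms carry powers of \<epsilon> and die out in the
    limit, while the linear coefficient stays positive: strictness at touching points passes to the
    nearby maxima.\<close>
  moreover have "\<forall>\<^sub>F k in sequentially. 16 * xsq (qs (s k)) * rho4 (qs (s k)) * tan_lap (qs (s k)) h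
      + \<sigma> * \<epsilon> (s k) * perturb2 h (qs (s k)) + (\<epsilon> (s k))\<^sup>2 * perturb3 h (qs (s k)) > 0"
  proof (rule order_tendstoD(1))
    note cp = continuous_perturbation[OF hC order_refl]
    show "(\<lambda>k. 16 * xsq (qs (s k)) * rho4 (qs (s k)) * tan_lap (qs (s k)) h
      + \<sigma> * \<epsilon> (s k) * perturb2 h (qs (s k)) + (\<epsilon> (s k))\<^sup>2 * perturb3 h (qs (s k))) \<longlonglongrightarrow>
      16 * xsq q2 * rho4 q2 * tan_lap q2 h + \<sigma> * 0 * perturb2 h q2 + 0\<^sup>2 * perturb3 h q2"
      by (intro tendsto_intros es rlim lim_of[OF nax_cont[OF cp(1)]] lim_of[OF nax_cont[OF cp(2)]] lim_of[OF nax_cont[OF cp(3)]]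
          lim_of[OF nax_cont[OF continuous_xsq]])
    show "0 < 16 * xsq q2 * rho4 q2 * tan_lap q2 h + \<sigma> * 0 * perturb2 h q2 + 0\<^sup>2 * perturb3 h q2"
      using xsq_pos[OF q2ax] rho4_nonaxis[OF q2ax] hL[OF q2T] by simp
  qed
  moreover have "\<forall>\<^sub>F k in sequentially. D1 rho4 (qs (s k)) n0 + \<sigma> * \<epsilon> (s k) * D1 h (qs (s k)) n0 > 0"
  proof (rule order_tendstoD(1))
    show "(\<lambda>k. D1 rho4 (qs (s k)) n0 + \<sigma> * \<epsilon> (s k) * D1 h (qs (s k)) n0) \<longlonglongrightarrow> D1 rho4 q2 n0 + \<sigma> * 0 * D1 h q2 n0"
      by (intro tendsto_intros es lim_of[OF cS] lim_of[OF nax_cont[OF C2_D1_continuous[OF hC]]])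
    have "D1 rho4 q2 n0 > 0" using R(4) q2(1) Kr by blast
    then show "0 < D1 rho4 q2 n0 + \<sigma> * 0 * D1 h q2 n0" by simp
  qed
  moreover have "\<forall>\<^sub>F k in sequentially. norm ((4 * \<sigma>) *\<^sub>R Pt (qs (s k)) + \<epsilon> (s k) *\<^sub>R hor_grad (qs (s k)) (D1 h (qs (s k)))) > 0"
  proof (rule order_tendstoD(1))
    have 1: "(\<lambda>k. Pt (qs (s k))) \<longlonglongrightarrow> Pt q2"
      by (rule isCont_tendsto_compose[OF isCont_UNIV[OF continuous_Pt] qslim])
    have "isCont (\<lambda>q. hor_grad q (D1 h q)) q2"
      using iffD1[OF continuous_on_eq_continuous_at[OF open_nonaxis] continuous_hor_grad[OF hC]] q2ax by blast
    from isCont_tendsto_compose[OF this qslim]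
    have 2: "(\<lambda>k. hor_grad (qs (s k)) (D1 h (qs (s k)))) \<longlonglongrightarrow> hor_grad q2 (D1 h q2)" .
    show "(\<lambda>k. norm ((4 * \<sigma>) *\<^sub>R Pt (qs (s k)) + \<epsilon> (s k) *\<^sub>R hor_grad (qs (s k)) (D1 h (qs (s k))))) \<longlonglongrightarrow>
       norm ((4 * \<sigma>) *\<^sub>R Pt q2 + 0 *\<^sub>R hor_grad q2 (D1 h q2))"
      by (intro tendsto_intros 1 2 es)
    have "Pt q2 \<bullet> Pt q2 > 0" using Pt_inner_Pt[of q2] xsq_pos[OF q2ax] rho4_nonaxis[OF q2ax] by simp
    then have "Pt q2 \<noteq> 0" by auto
    moreover have "\<sigma> \<noteq> 0" using \<sigma> by auto
    ultimately show "norm ((4 * \<sigma>) *\<^sub>R Pt q2 + 0 *\<^sub>R hor_grad q2 (D1 h q2)) > 0" by simp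
  qed
  ultimately have "\<forall>\<^sub>F k in sequentially. False"
  proof eventually_elim
    case (elim k)
    define q e where "q = qs (s k)" and "e = \<epsilon> (s k)"
    have qK: "q \<in> K" using qs(1) by (simp add: q_def)
    have qax: "q \<in> nonaxis" using qK Kax by blast
    have "q \<in> f ` U" using qK R(2) by (auto simp: K_def W(3))
    then obtain p where p: "p \<in> U" "f p = q" by blast
    have e: "e > 0" using \<epsilon> by (simp add: e_def)
    have jet: "has_jet (\<lambda>q. \<sigma> * rho4 q + e * h q) (UNIV \<inter> nonaxis) (\<lambda>q v. \<sigma> * D1 rho4 q v + e * D1 h q v)
       (\<lambda>q v w. \<sigma> * D2 rho4 q v w + e * D2 h q v w)"
      by (rule has_jet_linear_comb[OF C2_jet[OF C2_rho4] C2_jet[OF hC]])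
    show False
    proof (rule no_touching[OF atlas imm co bspec[OF lU p(1)] \<sigma> H jet, where u = n0])
      show "f p \<in> UNIV \<inter> nonaxis" using p qax by simp
      have "\<forall>\<^sub>F p' in nhds p. p' \<in> U \<and> f p' \<in> ball q0 r"
      proof (intro eventually_conj eventually_nhds_in_open[OF U(1) p(1)])
        from topological_tendstoD[OF isCont_nhds[OF isCont_UNIV[OF immersion_continuous[OF atlas imm co]]], of "ball q0 r" p]
        show "\<forall>\<^sub>F p' in nhds p. f p' \<in> ball q0 r" using elim(1) p(2) by (simp add: q_def)
      qed
      then show "\<forall>\<^sub>F p' in nhds p. \<sigma> * rho4 (f p') + e * h (f p') \<le> \<sigma> * rho4 (f p) + e * h (f p)"
      proof eventually_elim
        case (elim p')
        then have "f p' \<in> K" using dN by (auto simp: K_def)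
        then show ?case using qs(2)[of "f p'" "s k"] p(2) by (simp add: q_def e_def)
      qed
      show "D1 \<phi> (f p) n0 > 0" using R(1)[of q] qK Kr p by auto
      have "\<sigma> * (\<sigma> * D1 rho4 q n0 + e * D1 h q n0) = (\<sigma> * \<sigma>) * D1 rho4 q n0 + \<sigma> * e * D1 h q n0"
        by (simp only: distrib_left mult.assoc)
      then show "\<sigma> * (\<sigma> * D1 rho4 (f p) n0 + e * D1 h (f p) n0) > 0"
        using elim(3) p(2) by (simp add: q_def e_def \<sigma>)
      show "hor_grad (f p) (\<lambda>v. \<sigma> * D1 rho4 (f p) v + e * D1 h (f p) v) \<noteq> 0"
        using elim(4) p(2) by (simp add: hor_grad_comb hor_grad_rho4 q_def e_def mult.commute)
      show "mean_op (f p) (\<lambda>v. \<sigma> * D1 rho4 (f p) v + e * D1 h (f p) v) (\<lambda>v w. \<sigma> * D2 rho4 (f p) v w + e * D2 h (f p) v w) > 0"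
        unfolding p(2) mean_op_perturb[OF hC qax qax \<sigma>] using elim(2) e by (simp add: q_def e_def)
    qed
  qed
  then show False by simp
qed

end

section \<open>Touching at the poles\<close>

lemma jet_norm: "has_jet (\<lambda>q. sqrt (xsq q)) nonaxis (\<lambda>q v. 1 / (2 * sqrt (xsq q)) * D1 xsq q v)
  (\<lambda>q v w. 1 / (2 * sqrt (xsq q)) * D2 xsq q v w + - 1 / (4 * xsq q * sqrt (xsq q)) * (D1 xsq q v * D1 xsq q w))"
proof (rule jet_compose[where h' = "\<lambda>s. 1 / (2 * sqrt s)" and h'' = "\<lambda>s. - 1 / (4 * s * sqrt s)"])
  show "C2 xsq nonaxis" by (rule C2_nonaxis[OF C2_xsq])
  fix q :: "'a heis" assume "q \<in> nonaxis"
  then have p: "xsq q > 0" by (rule xsq_pos)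
  show "(sqrt has_real_derivative 1 / (2 * sqrt (xsq q))) (at (xsq q))"
    using DERIV_real_sqrt[OF p] by (simp add: field_simps)
  have s: "sqrt (xsq q) * sqrt (xsq q) = xsq q" using p by simp
  show "((\<lambda>s. 1 / (2 * sqrt s)) has_real_derivative - 1 / (4 * xsq q * sqrt (xsq q))) (at (xsq q))"
    using p s by (auto intro!: derivative_eq_intros DERIV_real_sqrt simp: field_simps)
next
  show "continuous_on (xsq ` nonaxis) (\<lambda>s. - 1 / (4 * s * sqrt s))"
    by (intro continuous_intros) (auto simp: xsq_def)
qed

text \<open>The maximum of the perturbed gauge may lie arbitrarily close to the pole, so
  \<open>e\<close> cannot be taken small relative to |x| and the linear term alone does not decide.
  With r = |x|, the terms linear, quadratic and cubic in \<open>e\<close> are completed to a square,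
  which absorbs the one term whose sign depends on \<open>\<sigma>\<close>.\<close>

lemma norm_barrier:
  fixes q :: "'n::finite heis" and \<sigma> e :: real
  assumes n: "CARD('n) \<ge> 2" and q: "q \<in> nonaxis" and near: "5 * (xsq q)\<^sup>2 < 8 * (snd q)\<^sup>2"
    and \<sigma>: "\<sigma> * \<sigma> = 1" and e: "e > 0"
  defines "k \<equiv> \<lambda>q. sqrt (xsq q)"
  shows "C2 k nonaxis" "\<bar>D1 k q v\<bar> \<le> norm v"
    "hor_grad q (\<lambda>v. \<sigma> * D1 rho4 q v + e * D1 k q v) \<noteq> 0"
    "mean_op q (\<lambda>v. \<sigma> * D1 rho4 q v + e * D1 k q v) (\<lambda>v w. \<sigma> * D2 rho4 q v w + e * D2 k q v w) > 0"
proof -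
  define r where "r = sqrt (xsq q)"
  have A: "xsq q > 0" using xsq_pos[OF q] .
  then have r: "r > 0" and rr: "xsq q = r * r" by (simp_all add: r_def)
  have xx: "fst q \<bullet> fst q = r * r" using rr by (simp add: xsq_def)
  show C: "C2 k nonaxis" unfolding k_def by (rule has_jet_C2[OF jet_norm])
  have d1: "D1 k q v = (fst q \<bullet> fst v) / r" for v
    unfolding k_def has_jet_D1[OF jet_norm q] has_jet_D1[OF jet_xsq UNIV_I] r_def[symmetric] using r by simp
  have d2: "D2 k q v w = (fst v \<bullet> fst w) / r - (fst q \<bullet> fst v) * (fst q \<bullet> fst w) / (r * r * r)" for v w
    unfolding k_def has_jet_D2[OF jet_norm q] has_jet_D1[OF jet_xsq UNIV_I] has_jet_D2[OF jet_xsq UNIV_I] r_def[symmetric] rr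
    using r by (simp add: field_simps)
  show "\<bar>D1 k q v\<bar> \<le> norm v"
  proof -
    have "norm (fst q) = r" by (simp add: norm_eq_sqrt_inner r_def xsq_def)
    then have "\<bar>fst q \<bullet> fst v\<bar> \<le> r * norm (fst v)" using Cauchy_Schwarz_ineq2[of "fst q" "fst v"] by simp
    also have "\<dots> \<le> r * norm v" using r norm_fst_le[of "fst v" "snd v"] by simp
    finally show ?thesis using r by (simp add: d1 field_simps)
  qed
  define G where "G = hor_grad q (D1 k q)"
  have G: "G = (1 / r) *\<^sub>R fst q"
    by (simp add: G_def hor_grad_def d1 vec_eq_iff lift_def inner_axis)
  define S where "S = rho4 q"
  have S0: "S > 0" using rho4_nonaxis[OF q] by (simp add: S_def)
  define P where "P = Pt q"
  have P: "fst q \<bullet> P = r ^ 4" "P \<bullet> Jp (fst q) = 2 * snd q * (r * r)"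
    using Pt_inner_x[of q] Pt_inner_Jp[of q] by (simp_all add: P_def rr power2_eq_square power4_eq_xxxx inner_commute)
  have z: "snd q \<noteq> 0" using near A by auto
  \<comment> \<open>The gradient of |x| is radial, hence orthogonal to \<open>Jp (fst q)\<close>,
    while the gradient of the gauge is not since z is nonzero.\<close>
  show "hor_grad q (\<lambda>v. \<sigma> * D1 rho4 q v + e * D1 k q v) \<noteq> 0"
  proof
    assume "hor_grad q (\<lambda>v. \<sigma> * D1 rho4 q v + e * D1 k q v) = 0"
    then have "(\<sigma> *\<^sub>R (4 *\<^sub>R P) + e *\<^sub>R G) \<bullet> Jp (fst q) = 0"
      by (simp add: hor_grad_comb hor_grad_rho4 G_def P_def)
    then have "\<sigma> * (4 * (2 * snd q * (r * r))) = 0" by (simp add: inner_add_left P G)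
    then show False using \<sigma> z r by auto
  qed
  define N a where "N = real CARD('n)" and "a = 2 * N - 1"
  have a: "a \<ge> 3" using n by (simp add: a_def N_def)
  have N: "N = (a + 1) / 2" by (simp add: a_def)
  define B where "B = 4 * (snd q)\<^sup>2"
  have SB: "S = r ^ 4 + B" by (simp add: S_def rho4_xsq rr B_def power2_eq_square power4_eq_xxxx)
  have nB: "5 * r ^ 4 < 2 * B" using near by (simp add: rr B_def power2_eq_square power4_eq_xxxx)
  have t: "hor_trace q (D2 k q) = a / r"
  proof -
    have s: "(\<Sum>I\<in>UNIV. (fst q $ I) * (fst q $ I)) = r * r" using xx by (simp add: inner_vec_def)
    have "hor_trace q (D2 k q) = (\<Sum>I\<in>(UNIV :: ('n + 'n) set). 1 / r - (fst q $ I) * (fst q $ I) / (r * r * r))"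
      by (simp add: hor_trace_def d2 lift_def inner_axis inner_axis_axis)
    also have "\<dots> = 2 * N / r - (r * r) / (r * r * r)"
      by (simp only: sum_subtractf sum_divide_distrib[symmetric] s) (simp add: N_def)
    finally show ?thesis using r by (simp add: a_def field_simps)
  qed
  have dl: "D2 k q (lift q u) (lift q v) = (u \<bullet> v) / r - (fst q \<bullet> u) * (fst q \<bullet> v) / (r * r * r)" for u v
    by (simp add: d2 lift_def)
  have GG: "G \<bullet> G = 1" "P \<bullet> G = r ^ 3" "fst q \<bullet> G = r" "G \<bullet> Jp (fst q) = 0" "G \<bullet> P = r ^ 3"
    using r P by (simp_all add: G xx inner_commute[of P] power3_eq_cube power4_eq_xxxx)
  have PP: "P \<bullet> P = r * r * S" using Pt_inner_Pt[of q] by (simp add: P_def rr S_def)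
  define Y where "Y = (a * S - (a + 2) * r ^ 4) / S"
  have LLk: "tan_lap q k = (a * S - B - (a + 2) * r ^ 4) / (r * S)"
  proof -
    have "tan_lap q k = a / r - (S * r - r ^ 5) / (r * r * S) - (a + 2) * r ^ 3 / S"
      unfolding tan_lap_def P_def[symmetric] S_def[symmetric] t dl d1 PP P xx N_def[symmetric]
      using r S0 by (simp add: lift_def P N field_simps power_add[symmetric] numeral_eq_Suc)
    moreover have "S * r - r ^ 5 = r * B" by (simp add: SB algebra_simps numeral_eq_Suc)
    ultimately have "tan_lap q k = a / r - r * B / (r * r * S) - (a + 2) * r ^ 3 / S" by (simp only:)
    also have "\<dots> = (a * S - B - (a + 2) * r ^ 4) / (r * S)"
      using r S0 by (simp add: field_simps numeral_eq_Suc)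
    finally show ?thesis .
  qed
  have R3k: "perturb3 k q = Y / r"
    unfolding perturb3_def Let_def G_def[symmetric] P_def[symmetric] S_def[symmetric] t dl GG N_def[symmetric] Y_def
    using r S0 by (simp add: N field_simps numeral_eq_Suc)
  have R2k: "perturb2 k q = 8 * (r * r) * Y"
    unfolding perturb2_def Let_def G_def[symmetric] P_def[symmetric] S_def[symmetric] t dl GG N_def[symmetric] Y_def rr P
    using r S0 by (simp add: N field_simps numeral_eq_Suc)
  have S16: "16 * xsq q * rho4 q * tan_lap q k = 16 * r * (a * S - B - (a + 2) * r ^ 4)"
    unfolding LLk rr S_def[symmetric] using r S0 by (simp add: field_simps)
  have r4: "r ^ 4 > 0" using r by simp
  have Y0: "Y > 0"
  proof -
    have "B \<ge> 0" by (simp add: B_def)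
    then have "a * B \<ge> 3 * B" using a by (intro mult_right_mono) auto
    moreover have "a * S - (a + 2) * r ^ 4 = a * B - 2 * r ^ 4" by (simp add: SB algebra_simps)
    ultimately have "a * S - (a + 2) * r ^ 4 > 0" using nB r4 by linarith
    then show ?thesis using S0 by (simp add: Y_def)
  qed
  have Ya: "Y \<le> a" using S0 a r4 by (simp add: Y_def field_simps)
  have pos: "a * S - B - (a + 2) * r ^ 4 - r ^ 4 * Y > 0"
  proof -
    have 1: "r ^ 4 * Y \<le> r ^ 4 * a" using mult_left_mono[OF Ya, of "r ^ 4"] r4 by linarith
    have 2: "(a - 1) * (5 * r ^ 4) < (a - 1) * (2 * B)"
      using a by (intro mult_strict_left_mono[OF nB]) simp
    \<comment> \<open>Origin of the constants in the closeness hypothesis: (a - 1) B > (a + 2) r^4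
      is needed, and 5/2 is the value of (a + 2) / (a - 1) at a = 3, that is n = 2, the worst
      case.\<close>
    have "2 * (a + 2) \<le> (a - 1) * 5" using a by simp
    then have 3: "2 * (a + 2) * r ^ 4 \<le> (a - 1) * 5 * r ^ 4"
      using r4 by (intro mult_right_mono) auto
    have "2 * (a * S - B - (a + 2) * r ^ 4 - r ^ 4 * Y)
      = ((a - 1) * (2 * B) - (a - 1) * (5 * r ^ 4)) + ((a - 1) * 5 * r ^ 4 - 2 * (a + 2) * r ^ 4) + 2 * (r ^ 4 * a - r ^ 4 * Y)"
      by (simp add: SB algebra_simps)
    also have "\<dots> > 0"
      using 1 2 3 by (intro add_pos_nonneg) (simp_all only: diff_gt_0_iff_gt diff_ge_0_iff_ge zero_le_mult_iff, simp_all)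
    finally show ?thesis by (simp only: zero_less_mult_iff) simp
  qed
  have "16 * xsq q * rho4 q * tan_lap q k + \<sigma> * e * perturb2 k q + e\<^sup>2 * perturb3 k q
    = Y / r * (e + 4 * \<sigma> * r ^ 3)\<^sup>2 + 16 * r * (a * S - B - (a + 2) * r ^ 4 - r ^ 4 * Y)"
  proof -
    \<comment> \<open>Completing the square costs 16 r^5 Y, which is the extra term subtracted in
      \<open>pos\<close>.\<close>
    have "(e + 4 * \<sigma> * r ^ 3)\<^sup>2 = e\<^sup>2 + 8 * \<sigma> * e * r ^ 3 + 16 * (\<sigma> * \<sigma>) * r ^ 6"
      by (simp add: power2_eq_square algebra_simps numeral_eq_Suc)
    then have "Y / r * (e + 4 * \<sigma> * r ^ 3)\<^sup>2 = e\<^sup>2 * (Y / r) + \<sigma> * e * (8 * (r * r) * Y) + 16 * r * (r ^ 4 * Y)"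
      unfolding \<sigma> using r by (simp add: field_simps numeral_eq_Suc)
    then show ?thesis unfolding S16 R2k R3k by (simp add: algebra_simps)
  qed
  moreover have "Y / r * (e + 4 * \<sigma> * r ^ 3)\<^sup>2 \<ge> 0" using Y0 r by simp
  moreover have "16 * r * (a * S - B - (a + 2) * r ^ 4 - r ^ 4 * Y) > 0" using pos r by simp
  ultimately have "16 * xsq q * rho4 q * tan_lap q k + \<sigma> * e * perturb2 k q + e\<^sup>2 * perturb3 k q > 0" by linarith
  then show "mean_op q (\<lambda>v. \<sigma> * D1 rho4 q v + e * D1 k q v) (\<lambda>v w. \<sigma> * D2 rho4 q v w + e * D2 k q v w) > 0"
    unfolding mean_op_perturb[OF C q q \<sigma>] using e by simp
qed

lemma Ck_on_linear_compose:
  assumes l: "bounded_linear l" and S: "open S"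
  shows "Ck_on k S f \<Longrightarrow> Ck_on k S (\<lambda>x. l (f x))"
proof (induction k arbitrary: f)
  case 0
  then show ?case by (simp add: bounded_linear.continuous_on[OF l])
next
  case (Suc k)
  show ?case
    by (rule Ck_on_SucI[OF S bounded_linear.has_derivative[OF l Ck_on_SucD(1)[OF Suc.prems]]])
      (auto intro: Suc.IH Ck_on_SucD(2)[OF Suc.prems])
qed

lemma D1_shift: "D1 (\<lambda>q. rho4 q + c) q = D1 rho4 q" and C2_shift: "C2 (\<lambda>q. rho4 q + c) UNIV"
proof -
  have j: "has_jet (\<lambda>q. c) UNIV (\<lambda>q v. 0) (\<lambda>q v w. 0)" by (rule jet_const) simp
  show "D1 (\<lambda>q. rho4 q + c) q = D1 rho4 q"
    using has_jet_D1[OF jet_add[OF C2_rho4 has_jet_C2[OF j]] UNIV_I, of q] has_jet_D1[OF j UNIV_I, of q] by simp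
  show "C2 (\<lambda>q. rho4 q + c) UNIV" by (rule C2_add[OF C2_rho4 has_jet_C2[OF j]])
qed

section \<open>Openness of the touching set\<close>

context
  fixes A :: "('m::t2_space set \<times> ('m \<Rightarrow> real ^ ('n::{finite,linorder} + 'n))) set"
    and f N :: "'m \<Rightarrow> 'n heis" and \<sigma> c :: real
  assumes n: "CARD('n) \<ge> 2" and atlas: "smooth_atlas A" and imm: "smooth_immersion A f" "0 \<notin> range f"
    and co: "coorientation A f N" and \<sigma>: "\<sigma> * \<sigma> = 1"
    and H: "\<And>p. nonsingular_at f N p \<Longrightarrow> \<sigma> * H_surf f N p \<le> 0"
    and max: "\<And>p. \<sigma> * rho4 (f p) \<le> \<sigma> * c"
    and orient: "\<And>p. rho4 (f p) = c \<Longrightarrow> D1 rho4 (f p) (N p) > 0"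
begin

lemma immersion_isCont: "isCont f p"
  by (rule isCont_UNIV[OF immersion_continuous[OF atlas imm co]])

text \<open>So far the sphere is known to lie locally in the sheet; openness in the parameter space
  needs the reverse inclusion. Both functions increase along the coorientation, so
  \<open>level_set_swap\<close> provides it.\<close>

lemma touching_open_off_axis:
  assumes touch: "rho4 (f p0) = c" and axis: "f p0 \<in> nonaxis"
  shows "\<forall>\<^sub>F p in nhds p0. rho4 (f p) = c"
proof -
  obtain \<phi> where l: "local_defining_function f N p0 \<phi>"
    using exists_local_defining_function[OF atlas imm co] by blast
  obtain U W where U: "open U" "p0 \<in> U" and W: "open W" and "0 \<notin> W" and C: "C2 \<phi> W" and fU: "f ` U = {q \<in> W. \<phi> q = 0}"
    and dN: "\<forall>p'\<in>U. f p' \<in> W \<and> \<phi> (f p') = 0 \<and> D1 \<phi> (f p') (N p') > 0"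
    and lU: "\<forall>p'\<in>U. local_defining_function f N p' \<phi>"
    by (rule local_defining_functionE[OF l])
  have "\<forall>\<^sub>F q in nhds (f p0). rho4 q = c \<longrightarrow> \<phi> q = 0"
    by (rule sphere_in_sheet[OF n atlas imm co \<sigma> H max orient l touch axis U W C fU dN lU])
  then have sub: "\<forall>\<^sub>F q in nhds (f p0). rho4 q + (- c) = 0 \<longrightarrow> \<phi> q = 0" by simp
  have "\<forall>\<^sub>F q in nhds (f p0). \<phi> q = 0 \<longrightarrow> rho4 q + (- c) = 0"
    by (rule level_set_swap[OF C2_shift C UNIV_I _ _ _ _ sub, of "N p0"])
      (use touch orient bspec[OF dN U(2)] in \<open>auto simp: D1_shift[of "- c", simplified]\<close>)
  then have "\<forall>\<^sub>F p in nhds p0. \<phi> (f p) = 0 \<longrightarrow> rho4 (f p) + (- c) = 0"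
    using eventually_compose_filterlim[OF _ isCont_nhds[OF immersion_isCont]] by blast
  then show ?thesis
    using eventually_nhds_in_open[OF U] by eventually_elim (use dN in auto)
qed

text \<open>On a punctured parameter ball the touching set is open by the case off the axis, and
  closed, so it is everything or empty by connectedness. If it were empty, adding a small multiple
  of |x| would create a maximum off the pole where \<open>norm_barrier\<close> applies: |x| has a
  corner at the pole while the gauge is stationary there along the surface.\<close>

lemma touching_open_at_pole:
  assumes touch: "rho4 (f p0) = c" and pole: "f p0 \<notin> nonaxis"
  shows "\<forall>\<^sub>F p in nhds p0. rho4 (f p) = c"
proof -
  obtain \<phi> where l: "local_defining_function f N p0 \<phi>"
    using exists_local_defining_function[OF atlas imm co] by blast
  obtain U W where U: "open U" "p0 \<in> U" and W: "open W" and "0 \<notin> W" and C: "C2 \<phi> W" and fU: "f ` U = {q \<in> W. \<phi> q = 0}"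
    and dN: "\<forall>p'\<in>U. f p' \<in> W \<and> \<phi> (f p') = 0 \<and> D1 \<phi> (f p') (N p') > 0"
    and lU: "\<forall>p'\<in>U. local_defining_function f N p' \<phi>"
    by (rule local_defining_functionE[OF l])
  obtain V0 :: "(real ^ ('n + 'n)) set" and y h where V0: "open V0" "y \<in> V0" and hc: "continuous_on V0 h" and hy: "h y = p0"
    and hop: "\<forall>B. open B \<longrightarrow> B \<subseteq> V0 \<longrightarrow> open (h ` B)"
    and sm: "smooth_on V0 (f \<circ> h)" and inj: "\<forall>z\<in>V0. inj (frechet_derivative (f \<circ> h) (at z))"
    using chart_at[OF atlas imm(1) co, of p0] by metis
  define F q0 n0 where "F = f \<circ> h" and "q0 = f p0" and "n0 = N p0"
  have Fh: "F z = f (h z)" for z by (simp add: F_def)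
  have Fy: "F y = q0" by (simp add: F_def q0_def hy)
  have FD: "(F has_derivative frechet_derivative F (at z)) (at z)" if "z \<in> V0" for z
    unfolding F_def by (rule smooth_on_has_derivative[OF sm that])
  have FC: "continuous_on V0 F" unfolding F_def by (rule smooth_on_continuous[OF sm])
  have x0: "fst q0 = 0" using pole by (simp add: q0_def)
  have q0ne: "q0 \<noteq> 0" using imm(2) by (metis q0_def rangeI)
  then have z0: "snd q0 \<noteq> 0" using x0 by (auto simp: prod_eq_iff)
  define L where "L w = frechet_derivative F (at y) w" for w
  have crit: "D1 rho4 q0 (L w) = 0" for w
  proof -
    have "((\<lambda>z. \<sigma> * rho4 (F z)) has_derivative (\<lambda>w. \<sigma> * D1 rho4 q0 (L w))) (at y)"
      unfolding L_def
      using has_derivative_mult_right[OF has_derivative_compose[OF FD[OF V0(2)], of rho4 "D1 rho4 q0"]] C2D(1)[OF C2_rho4 UNIV_I, of q0]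
      by (simp add: Fy)
    then have "(\<lambda>w. \<sigma> * D1 rho4 q0 (L w)) = (\<lambda>v. 0)"
      by (rule differential_zero_maxmin[OF V0(2,1)]) (use max touch in \<open>auto simp: Fh hy\<close>)
    then have "\<sigma> * D1 rho4 q0 (L w) = 0" by meson
    moreover have "\<sigma> \<noteq> 0" using \<sigma> by auto
    ultimately show ?thesis by simp
  qed
  have linL: "linear L" unfolding L_def using has_derivative_linear[OF FD[OF V0(2)]] .
  have injL: "inj L" using inj V0 by (simp add: L_def[abs_def] F_def)
  \<comment> \<open>At the pole the differential of the gauge is 8 z dz, so the tangent plane is the
    plane of the x-coordinates. These are local coordinates on the surface, and nearby parameters
    other than \<open>y\<close> are off the axis.\<close>
  have sndL: "snd (L w) = 0" for w
    using crit[of w] z0 by (simp add: has_jet_D1[OF jet_rho4] x0)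
  have fstL: "fst (L w) = 0 \<Longrightarrow> w = 0" for w
    using sndL[of w] injL linear_0[OF linL] by (metis injD prod_eq_iff fst_zero snd_zero)
  have Xsm: "smooth_on V0 (\<lambda>z. fst (F z))"
    unfolding smooth_on_def using sm
    by (auto intro!: Ck_on_linear_compose[OF bounded_linear_fst V0(1)] simp: smooth_on_def F_def[symmetric])
  have XD: "((\<lambda>z. fst (F z)) has_derivative (\<lambda>w. fst (L w))) (at y)"
    unfolding L_def by (rule has_derivative_fst[OF FD[OF V0(2)]])
  have "inj (frechet_derivative (\<lambda>z. fst (F z)) (at y))"
  proof -
    have lin: "linear (\<lambda>w. fst (L w))" using has_derivative_linear[OF XD] .
    show ?thesis
      unfolding frechet_derivative_at[OF XD, symmetric] using linear_injective_0[OF lin] fstL by blast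
  qed
  from smooth_local_inverse[OF V0(1) Xsm V0(2) this]
  obtain U' V g where U': "open U'" "U' \<subseteq> V0" "y \<in> U'" and hom: "homeomorphism U' V (\<lambda>z. fst (F z)) g" by blast
  have nax: "F z \<in> nonaxis" if "z \<in> U'" "z \<noteq> y" for z
  proof -
    have "fst (F z) \<noteq> fst (F y)"
      using hom that U'(3) unfolding homeomorphism_def by metis
    then show ?thesis by (simp add: Fy x0)
  qed
  define m0 where "m0 = D1 rho4 q0 n0 / 2"
  have m0: "m0 > 0" "D1 rho4 q0 n0 > m0" using orient[OF touch] by (auto simp: m0_def q0_def n0_def)
  have \<phi>n: "D1 \<phi> q0 n0 > 0" and q0W: "q0 \<in> W" using bspec[OF dN U(2)] by (auto simp: q0_def n0_def)
  have isF: "isCont F y" using iffD1[OF continuous_on_eq_continuous_at[OF V0(1)] FC] V0(2) by blast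
  have ish: "isCont h z" if "z \<in> V0" for z using iffD1[OF continuous_on_eq_continuous_at[OF V0(1)] hc] that by blast
  have limF: "filterlim F (nhds q0) (nhds y)" using isCont_nhds[OF isF] by (simp only: Fy)
  have limh: "filterlim h (nhds p0) (nhds y)" using isCont_nhds[OF ish[OF V0(2)]] by (simp only: hy)
  have near: "\<forall>\<^sub>F q in nhds q0. D1 \<phi> q n0 > 0 \<and> D1 rho4 q n0 > m0 \<and> 5 * (xsq q)\<^sup>2 < 8 * (snd q)\<^sup>2"
  proof (intro eventually_conj)
    show "\<forall>\<^sub>F q in nhds q0. D1 \<phi> q n0 > 0"
      by (rule order_tendstoD(1)[OF isCont_nhds[OF has_derivative_continuous[OF C2D(2)[OF C q0W]]] \<phi>n])
    show "\<forall>\<^sub>F q in nhds q0. D1 rho4 q n0 > m0"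
      by (rule order_tendstoD(1)[OF isCont_nhds[OF has_derivative_continuous[OF C2D(2)[OF C2_rho4 UNIV_I]]] m0(2)])
    have "isCont (\<lambda>q :: 'n heis. 8 * (snd q)\<^sup>2 - 5 * (xsq q)\<^sup>2) q0"
      by (rule isCont_UNIV) (intro continuous_intros continuous_xsq)
    from order_tendstoD(1)[OF isCont_nhds[OF this], of 0]
    show "\<forall>\<^sub>F q in nhds q0. 5 * (xsq q)\<^sup>2 < 8 * (snd q)\<^sup>2" using z0 x0 by (simp add: xsq_def)
  qed
  have "\<forall>\<^sub>F z in nhds y. z \<in> U' \<and> h z \<in> U \<and> D1 \<phi> (F z) n0 > 0 \<and> D1 rho4 (F z) n0 > m0 \<and> 5 * (xsq (F z))\<^sup>2 < 8 * (snd (F z))\<^sup>2"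
    using eventually_nhds_in_open[OF U'(1,3)] eventually_compose_filterlim[OF near limF]
      eventually_compose_filterlim[OF eventually_nhds_in_open[OF U] limh]
    by eventually_elim blast
  then obtain r where r: "r > 0" and R: "\<And>z. dist z y < r \<Longrightarrow> z \<in> U' \<and> h z \<in> U \<and> D1 \<phi> (F z) n0 > 0 \<and> D1 rho4 (F z) n0 > m0
      \<and> 5 * (xsq (F z))\<^sup>2 < 8 * (snd (F z))\<^sup>2"
    unfolding eventually_nhds_metric by blast
  have bV: "ball y r \<subseteq> V0" using R U'(2) by (force simp: dist_commute)
  define B' where "B' = ball y r - {y}"
  define M where "M = B' \<inter> (\<lambda>z. rho4 (F z)) -` {c}"
  have rF: "continuous_on V0 (\<lambda>z. rho4 (F z))"
    by (rule continuous_on_compose2[OF continuous_rho4[of UNIV] FC]) simp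
  have conn: "connected B'"
    unfolding B'_def using n by (intro connected_punctured_ball) simp
  have clo: "closedin (top_of_set B') M"
    unfolding M_def by (intro continuous_closedin_preimage continuous_on_subset[OF rF]) (use bV in \<open>auto simp: B'_def\<close>)
  have opn: "openin (top_of_set B') M"
  proof -
    have "open M"
      unfolding open_subopen[of M]
    proof
      fix z assume z: "z \<in> M"
      have zr: "dist z y < r" "z \<noteq> y" "rho4 (F z) = c" using z by (auto simp: M_def B'_def dist_commute)
      have zV: "z \<in> V0" using zr bV by (auto simp: dist_commute)
      have "\<forall>\<^sub>F p in nhds (h z). rho4 (f p) = c"
        by (rule touching_open_off_axis) (use zr nax[of z] R in \<open>auto simp: Fh\<close>)
      from eventually_compose_filterlim[OF this isCont_nhds[OF ish[OF zV]]]
      have "\<forall>\<^sub>F z' in nhds z. rho4 (F z') = c" by (simp add: Fh)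
      moreover have "\<forall>\<^sub>F z' in nhds z. z' \<in> B'"
        using z by (intro eventually_nhds_in_open) (auto simp: B'_def M_def)
      ultimately have "\<forall>\<^sub>F z' in nhds z. z' \<in> M" by eventually_elim (simp add: M_def)
      then show "\<exists>T. open T \<and> z \<in> T \<and> T \<subseteq> M" unfolding eventually_nhds by blast
    qed
    then show ?thesis by (auto simp: M_def intro: open_subset)
  qed
  have "M = {} \<or> M = B'" using conn clo opn unfolding connected_clopen by blast
  moreover have "M \<noteq> {}"
  proof
    assume empty: "M = {}"
    have strict: "\<sigma> * rho4 (F z) < \<sigma> * c" if "dist z y < r" "z \<noteq> y" for z
    proof -
      have "rho4 (F z) \<noteq> c" using empty that by (auto simp: M_def B'_def dist_commute)
      then have "\<sigma> * rho4 (F z) \<noteq> \<sigma> * c" using \<sigma> by auto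
      then show ?thesis using max[of "h z"] by (simp add: Fh less_le)
    qed
    define s where "s = r / 2"
    have s: "s > 0" "s < r" using r by (auto simp: s_def)
    have sr: "cball y s \<subseteq> V0" and sr': "\<And>z. z \<in> cball y s \<Longrightarrow> dist z y < r" using s bV by (auto simp: dist_commute)
    obtain \<mu> where \<mu>: "\<mu> > 0" "\<And>z. z \<in> sphere y s \<Longrightarrow> \<sigma> * rho4 (F z) \<le> \<sigma> * c - \<mu>"
    proof (cases "sphere y s = {}")
      case True
      then show ?thesis using that[of 1] by auto
    next
      case False
      have "continuous_on (sphere y s) (\<lambda>z. \<sigma> * rho4 (F z))"
        using sr by (intro continuous_intros continuous_on_subset[OF rF]) auto
      from continuous_attains_sup[OF compact_sphere False this]
      obtain a where a: "a \<in> sphere y s" "\<And>z. z \<in> sphere y s \<Longrightarrow> \<sigma> * rho4 (F z) \<le> \<sigma> * rho4 (F a)" by blast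
      have "\<sigma> * rho4 (F a) < \<sigma> * c" using a(1) s by (intro strict) (auto simp: dist_commute)
      then show ?thesis using that[of "\<sigma> * c - \<sigma> * rho4 (F a)"] a(2) by auto
    qed
    have Xc: "continuous_on (cball y s) (\<lambda>z. fst (F z))"
      using sr by (intro continuous_intros continuous_on_subset[OF FC]) auto
    then have "bounded ((\<lambda>z. fst (F z)) ` cball y s)"
      by (intro compact_imp_bounded compact_continuous_image compact_cball)
    then obtain K where K: "K > 0" "\<And>z. z \<in> cball y s \<Longrightarrow> norm (fst (F z)) \<le> K"
      unfolding bounded_pos by auto
    \<comment> \<open>The first bound keeps the perturbation below the gap \<open>\<mu>\<close> on
      the boundary sphere, so the maximum is interior. The second preserves the sign of the
      derivative along \<open>n0\<close>, as |x| has Lipschitz constant one.\<close>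
    define e where "e = min (\<mu> / (2 * K)) (m0 / (2 * (norm n0 + 1)))"
    have n1: "norm n0 + 1 > 0" by (simp add: add_nonneg_pos)
    have e: "e > 0" using \<mu> K m0 n1 by (simp add: e_def)
    have eK: "e * K < \<mu>"
    proof -
      have "e * K \<le> \<mu> / (2 * K) * K" using K by (intro mult_right_mono) (auto simp: e_def)
      also have "\<dots> < \<mu>" using K \<mu> by simp
      finally show ?thesis .
    qed
    have en: "e * norm n0 < m0"
    proof -
      have "e * norm n0 \<le> m0 / (2 * (norm n0 + 1)) * (norm n0 + 1)" using e by (intro mult_mono) (auto simp: e_def)
      also have "\<dots> = m0 / 2" using n1 by (metis mult.commute nonzero_mult_divide_mult_cancel_right less_irrefl times_divide_eq_right)
      also have "\<dots> < m0" using m0 by simp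
      finally show ?thesis .
    qed
    define k where "k = (\<lambda>q :: 'n heis. sqrt (xsq q))"
    have kn: "k q = norm (fst q)" for q by (simp add: k_def xsq_def norm_eq_sqrt_inner)
    define \<Psi> where "\<Psi> z = \<sigma> * rho4 (F z) + e * k (F z)" for z
    have "continuous_on (cball y s) \<Psi>"
      unfolding \<Psi>_def kn using sr by (intro continuous_intros continuous_on_subset[OF rF] Xc) auto
    then obtain z1 where z1: "z1 \<in> cball y s" "\<And>z. z \<in> cball y s \<Longrightarrow> \<Psi> z \<le> \<Psi> z1"
      using continuous_attains_sup[OF compact_cball, of y s \<Psi>] s by auto
    \<comment> \<open>The function |x| is not differentiable along the surface at the pole, so it is
      replaced by a linear minorant, its pairing with the unit vector of \<open>v\<close>. The
      minorant has positive slope, the gauge slope zero, hence \<open>\<Psi>\<close> exceeds its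
      value at \<open>y\<close>.\<close>
    have above: "\<Psi> z1 > \<sigma> * c"
    proof -
      obtain w :: "real ^ ('n + 'n)" where w: "w \<in> Basis" using nonempty_Basis by blast
      then have w0: "w \<noteq> 0" by (rule nonzero_Basis)
      define v where "v = fst (L w)"
      have v: "v \<noteq> 0" using fstL[of w] w0 by (auto simp: v_def)
      have lD: "((\<lambda>t. y + t *\<^sub>R w) has_derivative (\<lambda>t. t *\<^sub>R w)) (at 0)" by (auto intro!: derivative_eq_intros)
      define u where "u t = \<sigma> * rho4 (F (y + t *\<^sub>R w)) + e / norm v * (fst (F (y + t *\<^sub>R w)) \<bullet> v)" for t :: real
      have 1: "((\<lambda>t. rho4 (F (y + t *\<^sub>R w))) has_derivative (\<lambda>t. D1 rho4 q0 (L (t *\<^sub>R w)))) (at 0)"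
        unfolding L_def
        by (rule has_derivative_compose[OF has_derivative_compose[OF lD]])
          (use FD[OF V0(2)] C2D(1)[OF C2_rho4 UNIV_I, of q0] in \<open>simp_all add: Fy\<close>)
      have 2: "((\<lambda>t. fst (F (y + t *\<^sub>R w))) has_derivative (\<lambda>t. fst (L (t *\<^sub>R w)))) (at 0)"
        by (rule has_derivative_compose[OF lD]) (use XD in simp)
      have "(u has_derivative (\<lambda>t. \<sigma> * D1 rho4 q0 (L (t *\<^sub>R w)) + e / norm v * (fst (L (t *\<^sub>R w)) \<bullet> v))) (at 0)"
        unfolding u_def[abs_def]
        by (intro has_derivative_add has_derivative_mult_right has_derivative_inner_left 1 2)
      moreover have "\<sigma> * D1 rho4 q0 (L (t *\<^sub>R w)) + e / norm v * (fst (L (t *\<^sub>R w)) \<bullet> v) = e * norm v * t" for t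
        unfolding crit using v by (simp add: linear_scale[OF linL] v_def[symmetric] dot_square_norm power2_eq_square)
      ultimately have "(u has_real_derivative e * norm v) (at 0)" by (simp add: has_field_derivative_def)
      then obtain d where d: "d > 0" "\<And>t. 0 < t \<Longrightarrow> t < d \<Longrightarrow> u 0 < u (0 + t)"
        using DERIV_pos_inc_right[of u "e * norm v" 0] e v by auto
      define t where "t = min (d / 2) s"
      have t: "0 < t" "t < d" "t \<le> s" using d s by (auto simp: t_def)
      define z where "z = y + t *\<^sub>R w"
      have zs: "z \<in> cball y s" using t w by (simp add: z_def dist_norm)
      have "u 0 = \<sigma> * c" using touch x0 by (simp add: u_def Fy q0_def)
      then have "\<sigma> * c < u t" using d(2)[OF t(1,2)] by simp
      also have "u t \<le> \<Psi> z"
      proof -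
        have "fst (F z) \<bullet> v \<le> norm (fst (F z)) * norm v" by (rule norm_cauchy_schwarz)
        then have "e / norm v * (fst (F z) \<bullet> v) \<le> e / norm v * (norm (fst (F z)) * norm v)"
          using e by (intro mult_left_mono) auto
        then show ?thesis using v by (simp add: u_def \<Psi>_def kn z_def)
      qed
      also have "\<dots> \<le> \<Psi> z1" by (rule z1(2)[OF zs])
      finally show ?thesis .
    qed
    have z1y: "z1 \<noteq> y" using above touch by (auto simp: \<Psi>_def kn Fy x0 q0_def[symmetric])
    have "z1 \<notin> sphere y s"
    proof
      assume a: "z1 \<in> sphere y s"
      have "e * k (F z1) \<le> e * K" using K(2)[OF z1(1)] e by (simp add: kn)
      then show False using above \<mu>(2)[OF a] eK by (simp add: \<Psi>_def)
    qed
    then have z1s: "z1 \<in> ball y s" using z1(1) by auto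
    define q where "q = F z1"
    note R1 = R[OF sr'[OF z1(1)]]
    have qax: "q \<in> nonaxis" using nax[of z1] R1 z1y by (simp add: q_def)
    have nearq: "5 * (xsq q)\<^sup>2 < 8 * (snd q)\<^sup>2" using R1 by (simp add: q_def)
    note bar = norm_barrier[OF n qax nearq \<sigma> e, folded k_def]
    have pq: "f (h z1) = q" by (simp add: q_def Fh)
    have jet: "has_jet (\<lambda>q. \<sigma> * rho4 q + e * k q) (UNIV \<inter> nonaxis) (\<lambda>q v. \<sigma> * D1 rho4 q v + e * D1 k q v)
       (\<lambda>q v w. \<sigma> * D2 rho4 q v w + e * D2 k q v w)"
      by (rule has_jet_linear_comb[OF C2_jet[OF C2_rho4] C2_jet[OF bar(1)]])
    show False
    proof (rule no_touching[OF atlas imm co _ \<sigma> H jet, of "h z1" \<phi> n0])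
      show "local_defining_function f N (h z1) \<phi>" using lU R1 by blast
      show "f (h z1) \<in> UNIV \<inter> nonaxis" using qax by (simp add: pq)
      have "open (h ` ball y s)" using hop sr by (meson ball_subset_cball open_ball order_trans)
      then have "\<forall>\<^sub>F p' in nhds (h z1). p' \<in> h ` ball y s"
        using z1s by (intro eventually_nhds_in_open) auto
      then show "\<forall>\<^sub>F p' in nhds (h z1). \<sigma> * rho4 (f p') + e * k (f p') \<le> \<sigma> * rho4 (f (h z1)) + e * k (f (h z1))"
      proof eventually_elim
        case (elim p')
        then obtain z where "z \<in> ball y s" "p' = h z" by blast
        then show ?case using z1(2)[of z] by (simp add: \<Psi>_def Fh)
      qed
      show "D1 \<phi> (f (h z1)) n0 > 0" using R1 by (simp add: pq q_def)
      have "\<bar>\<sigma>\<bar> = 1" using \<sigma> by (metis abs_mult_self_eq abs_1 abs_square_eq_1 power2_eq_square)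
      then have "\<bar>\<sigma> * e * D1 k q n0\<bar> \<le> e * norm n0" using e bar(2)[of n0] by (simp add: abs_mult)
      moreover have "D1 rho4 q n0 > m0" using R1 by (simp add: q_def)
      ultimately have "D1 rho4 q n0 + \<sigma> * e * D1 k q n0 > 0" using en by linarith
      moreover have "\<sigma> * (\<sigma> * D1 rho4 q n0 + e * D1 k q n0) = (\<sigma> * \<sigma>) * D1 rho4 q n0 + \<sigma> * e * D1 k q n0"
        by (simp only: distrib_left mult.assoc)
      ultimately show "\<sigma> * (\<sigma> * D1 rho4 (f (h z1)) n0 + e * D1 k (f (h z1)) n0) > 0" by (simp add: pq \<sigma>)
      show "hor_grad (f (h z1)) (\<lambda>v. \<sigma> * D1 rho4 (f (h z1)) v + e * D1 k (f (h z1)) v) \<noteq> 0"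
        unfolding pq by (rule bar(3))
      show "mean_op (f (h z1)) (\<lambda>v. \<sigma> * D1 rho4 (f (h z1)) v + e * D1 k (f (h z1)) v)
         (\<lambda>v w. \<sigma> * D2 rho4 (f (h z1)) v w + e * D2 k (f (h z1)) v w) > 0"
        unfolding pq by (rule bar(4))
    qed
  qed
  ultimately have all: "M = B'" by blast
  have "rho4 (F z) = c" if "z \<in> ball y r" for z
  proof (cases "z = y")
    case True
    then show ?thesis using touch by (simp add: Fy q0_def)
  next
    case False
    then have "z \<in> M" using that all by (simp add: B'_def)
    then show ?thesis by (simp add: M_def)
  qed
  moreover have "\<forall>\<^sub>F p in nhds p0. p \<in> h ` ball y r"
    using hop bV r hy by (intro eventually_nhds_in_open) (auto simp: image_iff intro!: bexI[of _ y])
  ultimately show ?thesis by (auto elim!: eventually_mono simp: Fh)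
qed

end

section \<open>Rigidity\<close>

text \<open>The punctured space is connected and is mapped onto the sphere by the Heisenberg
  dilation that normalizes the gauge of each point.\<close>

lemma connected_gauge_sphere:
  assumes c: "c > 0"
  shows "connected {q :: 'n::finite heis. rho4 q = c}"
proof -
  define g where "g q = (root 4 (c / rho4 q) *\<^sub>R fst q, (root 4 (c / rho4 q))\<^sup>2 * snd q)" for q :: "'n heis"
  have r4: "root 4 x ^ 4 = x" if "x \<ge> 0" for x :: real using that by simp
  have gr: "rho4 (g q) = root 4 (c / rho4 q) ^ 4 * rho4 q" for q
    by (simp add: g_def rho4_def power_mult_distrib algebra_simps power2_eq_square power4_eq_xxxx)
  have "g ` (- {0}) = {q. rho4 q = c}"
  proof
    show "g ` (- {0}) \<subseteq> {q. rho4 q = c}"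
      using c rho4_pos by (fastforce simp: gr r4 less_imp_le)
    show "{q. rho4 q = c} \<subseteq> g ` (- {0})"
    proof
      fix q :: "'n heis" assume q: "q \<in> {q. rho4 q = c}"
      have "q \<noteq> 0" using q c by (auto simp: rho4_def)
      moreover have "g q = q" using q c by (simp add: g_def)
      ultimately show "q \<in> g ` (- {0})" by (metis ComplI image_eqI singletonD)
    qed
  qed
  moreover have "continuous_on (- {0}) g"
    unfolding g_def by (intro continuous_intros continuous_rho4) (auto dest: rho4_pos)
  moreover have "connected (- {0 :: 'n heis})"
    by (rule connected_punctured_universe) (simp, use zero_less_card_finite[where 'a='n] in linarith)
  ultimately show ?thesis by (metis connected_continuous_image)
qed

context
  fixes A :: "('m::t2_space set \<times> ('m \<Rightarrow> real ^ ('n::{finite,linorder} + 'n))) set"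
    and f N :: "'m \<Rightarrow> 'n heis" and \<sigma> c :: real
  assumes n: "CARD('n) \<ge> 2" and atlas: "smooth_atlas A" and imm: "smooth_immersion A f" "0 \<notin> range f"
    and co: "coorientation A f N" and \<sigma>: "\<sigma> * \<sigma> = 1"
    and H: "\<And>p. nonsingular_at f N p \<Longrightarrow> \<sigma> * H_surf f N p \<le> 0"
    and max: "\<And>p. \<sigma> * rho4 (f p) \<le> \<sigma> * c"
    and orient: "\<And>p. rho4 (f p) = c \<Longrightarrow> D1 rho4 (f p) (N p) > 0"
begin

lemma touching_everywhere:
  assumes conn: "connected (UNIV :: 'm set)" and touch: "rho4 (f p0) = c"
  shows "rho4 (f p) = c"
proof -
  define M where "M = {p. rho4 (f p) = c}"
  have "open M"
    unfolding open_subopen[of M]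
  proof
    fix p assume "p \<in> M"
    then have p: "rho4 (f p) = c" by (simp add: M_def)
    have "\<forall>\<^sub>F p' in nhds p. rho4 (f p') = c"
    proof (cases "f p \<in> nonaxis")
      case True
      show ?thesis
        by (rule touching_open_off_axis[OF n atlas imm co \<sigma> H max orient p True])
    next
      case False
      show ?thesis
        by (rule touching_open_at_pole[OF n atlas imm co \<sigma> H max orient p False])
    qed
    then show "\<exists>T. open T \<and> p \<in> T \<and> T \<subseteq> M" unfolding eventually_nhds M_def by blast
  qed
  moreover have "closed M"
    unfolding M_def
    by (intro closed_Collect_eq continuous_on_const
        continuous_on_compose2[OF continuous_rho4[of UNIV] immersion_continuous[OF atlas imm co]]) auto
  ultimately have "M = {} \<or> M = UNIV" using conn unfolding connected_clopen by (simp add: closed_closedin[symmetric])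
  then show ?thesis using touch by (auto simp: M_def)
qed

end

section \<open>Image and curvature of a surface contained in a gauge sphere\<close>

context
  fixes A :: "('m::t2_space set \<times> ('m \<Rightarrow> real ^ ('n::{finite,linorder} + 'n))) set"
    and f N :: "'m \<Rightarrow> 'n heis" and c :: real
  assumes atlas: "smooth_atlas A" and imm: "smooth_immersion A f" "0 \<notin> range f"
    and co: "coorientation A f N" and on: "\<And>p. rho4 (f p) = c"
    and orient: "\<And>p. D1 rho4 (f p) (N p) > 0"
begin

text \<open>Each sheet lies in the sphere, so by \<open>level_set_swap\<close> the sphere locally
  lies in the sheet. The image is thus open in the sphere, and closed by compactness.\<close>

lemma range_eq_gauge_sphere:
  assumes compact: "compact (UNIV :: 'm set)"
  shows "c > 0" "range f = {q. rho4 q = c}"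
proof -
  show c: "c > 0" using rho4_pos[of "f undefined"] imm(2) on by (metis rangeI)
  define S where "S = {q :: 'n heis. rho4 q = c}"
  have fS: "range f \<subseteq> S" using on by (auto simp: S_def)
  have "openin (top_of_set S) (range f)"
    unfolding openin_euclidean_subtopology_iff
  proof (intro conjI ballI fS)
    fix q assume "q \<in> range f"
    then obtain p where q: "q = f p" by blast
    obtain \<phi> where l: "local_defining_function f N p \<phi>"
      using exists_local_defining_function[OF atlas imm co] by blast
    obtain U W where U: "open U" "p \<in> U" and W: "open W" and "0 \<notin> W" and C: "C2 \<phi> W" and fU: "f ` U = {q \<in> W. \<phi> q = 0}"
      and dN: "\<forall>p'\<in>U. f p' \<in> W \<and> \<phi> (f p') = 0 \<and> D1 \<phi> (f p') (N p') > 0"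
      and "\<forall>p'\<in>U. local_defining_function f N p' \<phi>"
      by (rule local_defining_functionE[OF l])
    have p: "f p \<in> W" "\<phi> (f p) = 0" "D1 \<phi> (f p) (N p) > 0" using bspec[OF dN U(2)] by auto
    have "\<forall>\<^sub>F q in nhds (f p). q \<in> W" by (rule eventually_nhds_in_open[OF W p(1)])
    then have "\<forall>\<^sub>F q in nhds (f p). \<phi> q = 0 \<longrightarrow> rho4 q + (- c) = 0"
    proof eventually_elim
      case (elim q)
      then have "\<phi> q = 0 \<longrightarrow> q \<in> f ` U" using fU by simp
      then show ?case using on by auto
    qed
    from level_set_swap[OF C C2_shift p(1) UNIV_I p(2,3) _ this]
    have "\<forall>\<^sub>F q in nhds (f p). rho4 q + (- c) = 0 \<longrightarrow> \<phi> q = 0"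
      using orient[of p] D1_shift[of "- c" "f p"] by simp
    with eventually_nhds_in_open[OF W p(1)]
    have "\<forall>\<^sub>F q in nhds (f p). q \<in> S \<longrightarrow> q \<in> range f"
    proof eventually_elim
      case (elim q)
      show ?case
      proof
        assume "q \<in> S"
        then have "q \<in> f ` U" using elim fU by (simp add: S_def)
        then show "q \<in> range f" by blast
      qed
    qed
    then show "\<exists>e>0. \<forall>x'\<in>S. dist x' q < e \<longrightarrow> x' \<in> range f"
      unfolding q eventually_nhds_metric by blast
  qed
  moreover have "closedin (top_of_set S) (range f)"
    using compact_imp_closed[OF compact_continuous_image[OF immersion_continuous[OF atlas imm co] compact]] fS
    by (rule closed_subset[rotated])
  moreover have "connected S" unfolding S_def by (rule connected_gauge_sphere[OF c])
  ultimately have "range f = S" unfolding connected_clopen by blast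
  then show "range f = {q. rho4 q = c}" by (simp add: S_def)
qed

text \<open>The gauge is constant along the surface and may be compared with a defining function in
  both directions, so the two values of \<open>mean_op\<close> have the same sign, namely
  zero.\<close>

lemma H_surf_on_gauge_sphere:
  assumes ns: "nonsingular_at f N p"
  shows "H_surf f N p = 0"
proof -
  obtain \<phi> where l: "local_defining_function f N p \<phi>" and co0: "conorm (f p) (differential \<phi> (f p)) \<noteq> 0"
    using ns unfolding nonsingular_at_def by blast
  obtain U W where U: "open U" "p \<in> U" and "open W" "0 \<notin> W" and C: "C2 \<phi> W" and "f ` U = {q \<in> W. \<phi> q = 0}"
    and dN: "\<forall>p'\<in>U. f p' \<in> W \<and> \<phi> (f p') = 0 \<and> D1 \<phi> (f p') (N p') > 0"
    and "\<forall>p'\<in>U. local_defining_function f N p' \<phi>"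
    by (rule local_defining_functionE[OF l])
  have p: "f p \<in> W" "\<phi> (f p) = 0" "D1 \<phi> (f p) (N p) > 0" using bspec[OF dN U(2)] by auto
  have q0: "f p \<noteq> 0" using imm(2) by (metis rangeI)
  have g: "hor_grad (f p) (D1 \<phi> (f p)) \<noteq> 0" using co0 by (auto simp: conorm_D1[OF C p(1) q0])
  have z: "\<forall>\<^sub>F p' in nhds p. \<phi> (f p') = \<phi> (f p)" "\<forall>\<^sub>F p' in nhds p. \<phi> (f p') \<le> \<phi> (f p)"
    using eventually_nhds_in_open[OF U] dN p(2) by (auto elim!: eventually_mono)
  have z': "\<forall>\<^sub>F p' in nhds p. rho4 (f p') = rho4 (f p)" "\<forall>\<^sub>F p' in nhds p. rho4 (f p') \<le> rho4 (f p)"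
    using on by simp_all
  obtain k where k: "k > 0" "D1 rho4 (f p) = (\<lambda>v. k * D1 \<phi> (f p) v)"
      "mean_op (f p) (D1 rho4 (f p)) (D2 rho4 (f p)) \<ge> k ^ 3 * mean_op (f p) (D1 \<phi> (f p)) (D2 \<phi> (f p))"
    by (rule surface_comparison[OF atlas imm co C2_jet[OF C2_rho4] C2_jet[OF C] UNIV_I p(1) z'(1) z(2) orient p(3) g])
  have g': "hor_grad (f p) (D1 rho4 (f p)) \<noteq> 0" using g k(1) by (simp add: k(2) hor_grad_cmult)
  have "Pt (f p) = 0" if "fst (f p) = 0"
    using that by (simp add: Pt_def linear_0[OF linear_Jp])
  with g' have "f p \<in> nonaxis" by (auto simp: hor_grad_rho4)
  \<comment> \<open>With \<epsilon> = 0 the expansion says that \<open>mean_op\<close> annihilates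
    the gauge. It is available only off the axis; on the axis \<open>Pt\<close> is zero and the
    point would be singular.\<close>
  from mean_op_perturb[OF C2_rho4 UNIV_I this, of 1 0]
  have M: "mean_op (f p) (D1 rho4 (f p)) (D2 rho4 (f p)) = 0" by simp
  obtain k' where "k' > 0" "D1 \<phi> (f p) = (\<lambda>v. k' * D1 rho4 (f p) v)"
      "mean_op (f p) (D1 \<phi> (f p)) (D2 \<phi> (f p)) \<ge> k' ^ 3 * mean_op (f p) (D1 rho4 (f p)) (D2 rho4 (f p))"
    by (rule surface_comparison[OF atlas imm co C2_jet[OF C] C2_jet[OF C2_rho4] p(1) UNIV_I z(1) z'(2) p(3) orient g'])
  then have "mean_op (f p) (D1 \<phi> (f p)) (D2 \<phi> (f p)) \<ge> 0" by (simp add: M)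
  moreover have "mean_op (f p) (D1 \<phi> (f p)) (D2 \<phi> (f p)) \<le> 0"
    using k(3) zero_less_power[OF k(1), of 3] by (simp add: M mult_le_0_iff)
  ultimately have "mean_op (f p) (D1 \<phi> (f p)) (D2 \<phi> (f p)) = 0" by simp
  then show ?thesis by (simp add: H_surf_eq(2)[OF atlas imm co l g])
qed

end

theorem theoremL:
  fixes A :: "('m::t2_space set \<times> ('m \<Rightarrow> real ^ ('n::{finite,linorder} + 'n))) set"
    and f N :: "'m \<Rightarrow> 'n heis"
  assumes n: "CARD('n) \<ge> 2"
    and closed: "compact (UNIV :: 'm set)" "connected (UNIV :: 'm set)"
    and atlas: "smooth_atlas A"
    and immersed: "smooth_immersion A f" "0 \<notin> range f"
    and sign_convention: "coorientation A f N" "outward f N"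
    and curvature:
      "(\<forall>p. nonsingular_at f N p \<longrightarrow> H_surf f N p \<le> 0) \<or>
       (\<forall>p. nonsingular_at f N p \<longrightarrow> H_surf f N p \<ge> 0) \<and> 0 \<in> interior_region f N"
  shows "(\<exists>c>0. range f = {q. rho q ^ 4 = c}) \<and>
         (\<forall>p. nonsingular_at f N p \<longrightarrow> H_surf f N p = 0)"
proof -
  note co = sign_convention(1)
  have rc: "continuous_on UNIV (\<lambda>p. rho4 (f p))"
    by (rule continuous_on_compose2[OF continuous_rho4[of UNIV] immersion_continuous[OF atlas immersed co]]) simp
  have "\<exists>c. (\<forall>p. rho4 (f p) = c) \<and> (\<forall>p. D1 rho4 (f p) (N p) > 0)"
    using curvature
  proof
    assume H: "\<forall>p. nonsingular_at f N p \<longrightarrow> H_surf f N p \<le> 0"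
    obtain p0 where p0: "\<And>p. rho4 (f p) \<le> rho4 (f p0)"
      using continuous_attains_sup[OF closed(1) _ rc] by auto
    have orient: "D1 rho4 (f p) (N p) > 0" if "rho4 (f p) = rho4 (f p0)" for p
      by (rule outward_at_maximum[OF atlas immersed co sign_convention(2)]) (simp add: that p0)
    have "rho4 (f p) = rho4 (f p0)" for p
      by (rule touching_everywhere[OF n atlas immersed co, of 1]) (simp_all add: H p0 orient closed)
    then show ?thesis using orient by blast
  next
    assume H: "(\<forall>p. nonsingular_at f N p \<longrightarrow> H_surf f N p \<ge> 0) \<and> 0 \<in> interior_region f N"
    obtain p0 where p0: "\<And>p. rho4 (f p0) \<le> rho4 (f p)"
      using continuous_attains_inf[OF closed(1) _ rc] by auto
    have orient: "D1 rho4 (f p) (N p) > 0" if "rho4 (f p) = rho4 (f p0)" for p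
      by (rule outward_at_minimum[OF atlas immersed co conjunct2[OF H]]) (simp add: that p0)
    \<comment> \<open>The sign - 1 turns the minimum into a maximum and the curvature hypothesis
      into the form required for touching from within.\<close>
    have "rho4 (f p) = rho4 (f p0)" for p
      by (rule touching_everywhere[OF n atlas immersed co, of "- 1"]) (simp_all add: H p0 orient closed)
    then show ?thesis using orient by blast
  qed
  then obtain c where c: "\<And>p. rho4 (f p) = c" "\<And>p. D1 rho4 (f p) (N p) > 0" by blast
  show ?thesis
    using range_eq_gauge_sphere[OF atlas immersed co c closed(1)] H_surf_on_gauge_sphere[OF atlas immersed co c]
    by (auto simp: rho_power4)
qed

end
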